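(* Under the Main Assumptions and the controllability assumption (both listed in the context), if $LH_{(w,z)}=UH_{(w,z)}$ on $\mathbb{R}^n\times\mathbb{R}^m\times\mathbb{R}^n\times\mathbb{R}^m$ for every $(w,z)\in\{-1,1\}^2$, then the differential game has an equilibrium, i.e. $\underline V(x,y,w,z)=\overline V(x,y,w,z)$ for every $(w,z)\in\{-1,1\}^2$ and every $(x,y)\in\overline B_{(w,z)}$.
   Context: **Sectors.** Fix reals $\rho_{-1}<\rho_1$ and $\eta_{-1}<\eta_1$ (switching thresholds). Let $x\cdot e_1$, $y\cdot e_1$ denote first coordinates of $x\in\mathbb{R}^n$, $y\in\mathbb{R}^m$. Set $\Omega_X^{1}=\{x: x\cdot e_1>\rho_{-1}\}$, $\Omega_X^{-1}=\{x:x\cdot e_1<\rho_1\}$, $\Omega_Y^{1}=\{y:y\cdot e_1>\eta_{-1}\}$, $\Omega_Y^{-1}=\{y:y\cdot e_1<\eta_1\}$, with closures $\overline\Omega_X^w,\overline\Omega_Y^z$; thus $\partial\Omega_X^w=\{x\cdot e_1=\rho_{-w}\}$, $\partial\Omega_Y^z=\{y\cdot e_1=\eta_{-z}\}$. Set $\overline B_{(w,z)}=\overline\Omega_X^w\times\overline\Omega_Y^z$ for $(w,z)\in\{-1,1\}^2$. **Controls and strategies.** $A,B$ are compact (metric) sets; $\mathcal A$ (resp. $\mathcal B$) is the set of measurable functions $[0,+\infty[\to A$ (resp. $\to B$). $\Gamma$ is the set of non-anticipating strategies $\gamma:\mathcal B\to\mathcal A$, i.e. for all $t\ge0$, $\beta_1=\beta_2$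 a.e. in $[0,t]$ implies $\gamma[\beta_1]=\gamma[\beta_2]$ a.e. in $[0,t]$; $\Xi$ is the set of non-anticipating strategies $\xi:\mathcal A\to\mathcal B$, defined symmetrically. **Main Assumptions.** $f:\mathbb{R}^n\times\{-1,1\}\times A\to\mathbb{R}^n$ and $g:\mathbb{R}^m\times\{-1,1\}\times B\to\mathbb{R}^m$ are continuous, bounded, and Lipschitz in the state variable ($x$, resp. $y$) uniformly in the other variables. The running cost is $\ell(x,y,w,z,a,b)=\ell_1(x,y,w,z,a)+\ell_2(x,y,w,z,b)\in[0,+\infty[$ with $\ell_1,\ell_2$ continuous, bounded, and Lipschitz in $(x,y)$ uniformly in the other variables. $\lambda>0$ is a constant. **Controllability assumption.** With $f_1,g_1$ the first components of $f,g$: for all $w\in\{-1,1\}$ and $x\in\partial\Omega_X^w$ there are $a_1,a_2\in A$ with $f_1(x,w,a_1)<0<f_1(x,w,a_2)$; for all $z\in\{-1,1\}$ and $y\in\partial\Omega_Y^z$ there are $b_1,b_2\in B$ with $g_1(y,z,b_1)<0<g_1(y,z,b_2)$. **Switching dynamics.** For $x\in\overline\Omega_X^w$ and $\alpha\in\mathcal A$, the trajectory $(X,W)$ is the solution of $X'=f(X,W,\alpha)$, $X(0)=x$, where $W$ is governed by the delayed thermostat with thresholds $(\rho_{-1},\rho_1)$ applied to $X\cdot e_1$, with initial output $w$. That is, $(X,W)$ is the unique pair such that (i) $X$ is continuous and $W:[0,+\infty[\to\{-1,1\}$ is left-continuous with $W(0)=w$; (ii) $X(t)=x+\int_0^tf(X(s),W(s),\alpha(s))ds$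 and $X(t)\in\overline\Omega_X^{W(t)}$ for all $t\ge0$; (iii) for every $t$ it minimizes the number of switchings of $W$ in $[0,t]$ among pairs satisfying (i), (ii). Equivalently: move with dynamics $f(\cdot,w,\alpha)$ until the first exit time $t_1=\inf\{t\ge0:X(t)\notin\overline\Omega_X^w\}$, then from $X(t_1)$ with $f(\cdot,-w,\alpha)$ until the first exit time from $\overline\Omega_X^{-w}$, and so on; at a switching instant $W$ still has its old value. The trajectory $(Y,Z)$ from $(y,z)$, $y\in\overline\Omega_Y^z$, with control $\beta\in\mathcal B$ is defined in the same way with $g$, thresholds $(\eta_{-1},\eta_1)$ and $Y\cdot e_1$. **Cost and values.** For $(x,y)\in\overline B_{(w,z)}$, $J(x,y,w,z,\alpha,\beta)=\int_0^{+\infty}e^{-\lambda t}\ell(X(t),Y(t),W(t),Z(t),\alpha(t),\beta(t))\,dt$, and $$\underline V(x,y,w,z)=\inf_{\gamma\in\Gamma}\sup_{\beta\in\mathcal B}J(x,y,w,z,\gamma[\beta],\beta),\quad \overline V(x,y,w,z)=\sup_{\xi\in\Xi}\inf_{\alpha\in\mathcal A}J(x,y,w,z,\alpha,\xi[\alpha]).$$ **Hamiltonians.** For $(x,y,p,q)\in\mathbb{R}^n\times\mathbb{R}^m\times\mathbb{R}^n\times\mathbb{R}^m$, $$UH_{(w,z)}(x,y,p,q)=\min_{b\in B}\max_{a\in A}\{-f(x,w,a)\cdot p-g(y,z,b)\cdot q-\ell(x,y,w,z,a,b)\},$$ $$LH_{(w,z)}(x,y,p,q)=\max_{a\in A}\min_{b\in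 B}\{-f(x,w,a)\cdot p-g(y,z,b)\cdot q-\ell(x,y,w,z,a,b)\}.$$ *)

theory Defs
  imports "HOL-Analysis.Analysis"
begin

text \<open>
  \<open>\<real>\<^sup>n\<close> and \<open>\<real>\<^sup>m\<close> are arbitrary Euclidean spaces, \<open>e\<close> is the basis vector selecting the first
  coordinate. Outputs in \<open>{-1, 1}\<close> are integers, so that a pair of thresholds is a function
  \<open>\<rho> :: int \<Rightarrow> real\<close>, only used at \<open>-1\<close> and \<open>1\<close>.
\<close>

definition sector :: "'x::euclidean_space \<Rightarrow> (int \<Rightarrow> real) \<Rightarrow> int \<Rightarrow> 'x set" where
  "sector e \<rho> w = (if w = 1 then {x. x \<bullet> e > \<rho> (-1)} else {x. x \<bullet> e < \<rho> 1})"

definition regular :: "'u::topological_space set \<Rightarrow> ('s::metric_space \<Rightarrow> 'u \<Rightarrow> 'v::metric_space) \<Rightarrow> bool" where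
  "regular U F \<longleftrightarrow>
     continuous_on (UNIV \<times> U) (\<lambda>(s, u). F s u) \<and>
     bounded ((\<lambda>(s, u). F s u) ` (UNIV \<times> U)) \<and>
     (\<exists>L. \<forall>u\<in>U. L-lipschitz_on UNIV (\<lambda>s. F s u))"

definition controllable ::
  "'x::euclidean_space \<Rightarrow> (int \<Rightarrow> real) \<Rightarrow> 'a set \<Rightarrow> ('x \<Rightarrow> int \<Rightarrow> 'a \<Rightarrow> 'x) \<Rightarrow> bool" where
  "controllable e \<rho> A f \<longleftrightarrow>
     (\<forall>w\<in>{-1, 1}. \<forall>x\<in>frontier (sector e \<rho> w).
        \<exists>a1\<in>A. \<exists>a2\<in>A. f x w a1 \<bullet> e < 0 \<and> 0 < f x w a2 \<bullet> e)"

text \<open>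
  Values at negative times are irrelevant: they are constrained neither here nor in the
  trajectories, and a non-anticipating strategy cannot depend on them (up to null sets).
\<close>

definition controls :: "'a::metric_space set \<Rightarrow> (real \<Rightarrow> 'a) set" where
  "controls A = {\<alpha> \<in> borel_measurable (lebesgue_on {0..}). \<forall>t\<ge>0. \<alpha> t \<in> A}"

definition strategies ::
  "'b::metric_space set \<Rightarrow> 'a::metric_space set \<Rightarrow> ((real \<Rightarrow> 'b) \<Rightarrow> (real \<Rightarrow> 'a)) set" where
  "strategies B A = {\<gamma> \<in> controls B \<rightarrow> controls A.
     \<forall>t\<ge>0. \<forall>\<beta>1\<in>controls B. \<forall>\<beta>2\<in>controls B.
       (AE s in lebesgue_on {0..t}. \<beta>1 s = \<beta>2 s) \<longrightarrow>
       (AE s in lebesgue_on {0..t}. \<gamma> \<beta>1 s = \<gamma> \<beta>2 s)}"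

definition mode_solution ::
  "('x::euclidean_space \<Rightarrow> int \<Rightarrow> 'a \<Rightarrow> 'x) \<Rightarrow> int \<Rightarrow> (real \<Rightarrow> 'a) \<Rightarrow> real \<Rightarrow> 'x \<Rightarrow> (real \<Rightarrow> 'x) \<Rightarrow> bool" where
  "mode_solution f w \<alpha> s x \<xi> \<longleftrightarrow>
     continuous_on {s..} \<xi> \<and>
     (\<forall>t\<ge>s. \<xi> t = x + (LINT r:{s..t}|lebesgue. f (\<xi> r) w (\<alpha> r)))"

definition exit_time :: "'x::topological_space set \<Rightarrow> real \<Rightarrow> (real \<Rightarrow> 'x) \<Rightarrow> ereal" where
  "exit_time C s \<xi> = Inf (ereal ` {t. s \<le> t \<and> \<xi> t \<notin> C})"

text \<open>
  The last conjunct is the delayed thermostat: \<open>\<tau> k\<close> are the switching instants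
  (\<open>\<infinity>\<close> if there are no further ones), each one being the first exit time of the motion \<open>\<xi>\<close> that
  keeps the current dynamics forever. Minimality of the number of switchings on every \<open>[0, t]\<close> is
  deliberately not used instead: an early switching may save later ones, so that for some
  controls no pair is minimal for all \<open>t\<close> simultaneously.
\<close>

definition switching_trajectory ::
  "('x::euclidean_space \<Rightarrow> int \<Rightarrow> 'a \<Rightarrow> 'x) \<Rightarrow> 'x \<Rightarrow> (int \<Rightarrow> real) \<Rightarrow> 'x \<Rightarrow> int \<Rightarrow> (real \<Rightarrow> 'a) \<Rightarrow>
   (real \<Rightarrow> 'x) \<Rightarrow> (real \<Rightarrow> int) \<Rightarrow> bool" where
  "switching_trajectory f e \<rho> x w \<alpha> X W \<longleftrightarrow>
     continuous_on {0..} X \<and>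
     (\<forall>t\<ge>0. W t \<in> {-1, 1}) \<and> (\<forall>t>0. continuous (at_left t) W) \<and> W 0 = w \<and>
     (\<forall>t\<ge>0. X t = x + (LINT s:{0..t}|lebesgue. f (X s) (W s) (\<alpha> s))) \<and>
     (\<forall>t\<ge>0. X t \<in> closure (sector e \<rho> (W t))) \<and>
     (\<exists>\<tau> :: nat \<Rightarrow> ereal. \<tau> 0 = 0 \<and> incseq \<tau> \<and> \<tau> \<longlonglongrightarrow> \<infinity> \<and>
        (\<forall>k s. \<tau> k = ereal s \<longrightarrow>
           (\<exists>\<xi>. mode_solution f ((-1) ^ k * w) \<alpha> s (X s) \<xi> \<and>
                \<tau> (Suc k) = exit_time (closure (sector e \<rho> ((-1) ^ k * w))) s \<xi>) \<and>
           (\<forall>t. s < t \<and> ereal t \<le> \<tau> (Suc k) \<longrightarrow> W t = (-1) ^ k * w)))"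

text \<open>
  The trajectory is determined on \<open>[0, \<infinity>)\<close> only, and only its values there are used; hence
  \<open>SOME\<close> rather than \<open>THE\<close>.
\<close>

definition trajectory ::
  "('x::euclidean_space \<Rightarrow> int \<Rightarrow> 'a \<Rightarrow> 'x) \<Rightarrow> 'x \<Rightarrow> (int \<Rightarrow> real) \<Rightarrow> 'x \<Rightarrow> int \<Rightarrow> (real \<Rightarrow> 'a) \<Rightarrow>
   (real \<Rightarrow> 'x) \<times> (real \<Rightarrow> int)" where
  "trajectory f e \<rho> x w \<alpha> = (SOME (X, W). switching_trajectory f e \<rho> x w \<alpha> X W)"

definition cost ::
  "('x::euclidean_space \<Rightarrow> int \<Rightarrow> 'a \<Rightarrow> 'x) \<Rightarrow> ('y::euclidean_space \<Rightarrow> int \<Rightarrow> 'b \<Rightarrow> 'y) \<Rightarrow>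
   ('x \<Rightarrow> 'y \<Rightarrow> int \<Rightarrow> int \<Rightarrow> 'a \<Rightarrow> 'b \<Rightarrow> real) \<Rightarrow> real \<Rightarrow>
   'x \<Rightarrow> (int \<Rightarrow> real) \<Rightarrow> 'y \<Rightarrow> (int \<Rightarrow> real) \<Rightarrow>
   'x \<Rightarrow> 'y \<Rightarrow> int \<Rightarrow> int \<Rightarrow> (real \<Rightarrow> 'a) \<Rightarrow> (real \<Rightarrow> 'b) \<Rightarrow> real" where
  "cost f g l lam e \<rho> e' \<eta> x y w z \<alpha> \<beta> =
     (let (X, W) = trajectory f e \<rho> x w \<alpha>; (Y, Z) = trajectory g e' \<eta> y z \<beta>
      in LINT t:{0..}|lebesgue. exp (- lam * t) * l (X t) (Y t) (W t) (Z t) (\<alpha> t) (\<beta> t))"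

text \<open>
  In the values and Hamiltonians all infima and suprema are over nonempty sets of uniformly
  bounded reals (under the standing assumptions); in the Hamiltonians they are attained, by
  compactness.
\<close>

definition lower_value ::
  "('x::euclidean_space \<Rightarrow> int \<Rightarrow> 'a::metric_space \<Rightarrow> 'x) \<Rightarrow>
   ('y::euclidean_space \<Rightarrow> int \<Rightarrow> 'b::metric_space \<Rightarrow> 'y) \<Rightarrow>
   ('x \<Rightarrow> 'y \<Rightarrow> int \<Rightarrow> int \<Rightarrow> 'a \<Rightarrow> 'b \<Rightarrow> real) \<Rightarrow> real \<Rightarrow>
   'x \<Rightarrow> (int \<Rightarrow> real) \<Rightarrow> 'y \<Rightarrow> (int \<Rightarrow> real) \<Rightarrow> 'a set \<Rightarrow> 'b set \<Rightarrow>
   'x \<Rightarrow> 'y \<Rightarrow> int \<Rightarrow> int \<Rightarrow> real" where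
  "lower_value f g l lam e \<rho> e' \<eta> A B x y w z =
     (INF \<gamma>\<in>strategies B A. SUP \<beta>\<in>controls B. cost f g l lam e \<rho> e' \<eta> x y w z (\<gamma> \<beta>) \<beta>)"

definition upper_value ::
  "('x::euclidean_space \<Rightarrow> int \<Rightarrow> 'a::metric_space \<Rightarrow> 'x) \<Rightarrow>
   ('y::euclidean_space \<Rightarrow> int \<Rightarrow> 'b::metric_space \<Rightarrow> 'y) \<Rightarrow>
   ('x \<Rightarrow> 'y \<Rightarrow> int \<Rightarrow> int \<Rightarrow> 'a \<Rightarrow> 'b \<Rightarrow> real) \<Rightarrow> real \<Rightarrow>
   'x \<Rightarrow> (int \<Rightarrow> real) \<Rightarrow> 'y \<Rightarrow> (int \<Rightarrow> real) \<Rightarrow> 'a set \<Rightarrow> 'b set \<Rightarrow>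
   'x \<Rightarrow> 'y \<Rightarrow> int \<Rightarrow> int \<Rightarrow> real" where
  "upper_value f g l lam e \<rho> e' \<eta> A B x y w z =
     (SUP \<xi>\<in>strategies A B. INF \<alpha>\<in>controls A. cost f g l lam e \<rho> e' \<eta> x y w z \<alpha> (\<xi> \<alpha>))"

definition UH ::
  "('x::euclidean_space \<Rightarrow> int \<Rightarrow> 'a \<Rightarrow> 'x) \<Rightarrow> ('y::euclidean_space \<Rightarrow> int \<Rightarrow> 'b \<Rightarrow> 'y) \<Rightarrow>
   ('x \<Rightarrow> 'y \<Rightarrow> int \<Rightarrow> int \<Rightarrow> 'a \<Rightarrow> 'b \<Rightarrow> real) \<Rightarrow> 'a set \<Rightarrow> 'b set \<Rightarrow>
   int \<Rightarrow> int \<Rightarrow> 'x \<Rightarrow> 'y \<Rightarrow> 'x \<Rightarrow> 'y \<Rightarrow> real" where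
  "UH f g l A B w z x y p q =
     (INF b\<in>B. SUP a\<in>A. - (f x w a \<bullet> p) - g y z b \<bullet> q - l x y w z a b)"

definition LH ::
  "('x::euclidean_space \<Rightarrow> int \<Rightarrow> 'a \<Rightarrow> 'x) \<Rightarrow> ('y::euclidean_space \<Rightarrow> int \<Rightarrow> 'b \<Rightarrow> 'y) \<Rightarrow>
   ('x \<Rightarrow> 'y \<Rightarrow> int \<Rightarrow> int \<Rightarrow> 'a \<Rightarrow> 'b \<Rightarrow> real) \<Rightarrow> 'a set \<Rightarrow> 'b set \<Rightarrow>
   int \<Rightarrow> int \<Rightarrow> 'x \<Rightarrow> 'y \<Rightarrow> 'x \<Rightarrow> 'y \<Rightarrow> real" where
  "LH f g l A B w z x y p q =
     (SUP a\<in>A. INF b\<in>B. - (f x w a \<bullet> p) - g y z b \<bullet> q - l x y w z a b)"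

end

theory Submission
  imports Defs
begin

text \<open>
  Each player steers a separate system, and the running cost is the sum of a part that depends on the
  control of the one and a part that depends on the control of the other. If a player reacts with a
  small delay, this moves the trajectory and the cost contribution of that player slightly in time;
  whatever the opponent does, the total cost should change little. Suppose that both players have
  such delay maps. Then the value exists for an elementary reason (\<open>game_value\<close>). On the one hand,
  given strategies \<open>\<gamma>\<close> and \<open>\<xi>\<close> and a delay map \<open>\<Phi>\<close>, the iterates of \<open>\<alpha> \<mapsto> \<Phi> (\<gamma> (\<xi> \<alpha>))\<close> agree on
  longer and longer time intervals, so that they end up with a pair of controls that is almost
  consistent with both strategies; this shows that the upper value is at most the lower one. On the
  other hand, when time is cut into steps as long as the delay and the players choose pieces of control
  in turn, one of them can force the cost to be on the desired side of any given number. A winning plan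
  of the minimizer is a nonanticipating strategy. One of the maximizer looks ahead by one step, and
  becomes a nonanticipating strategy when it is composed with the delay map.

  The work is in the delay map (\<open>delay_map\<close>), as the trajectories of a thermostat do not depend
  continuously on their initial points: if a trajectory only touches a threshold, an arbitrarily small
  perturbation may make it switch. This is where controllability enters. The map \<open>follow\<close> replays a
  control, but inserts short pushes. At the beginning of each step of fixed length, the tracking
  trajectory is pushed into its sector by more than the tracking error can grow during the step,
  so it cannot switch before the tracked one does. When the tracked trajectory switches, the tracking
  one is close to the threshold and is pushed across. After that, both are a full gap away from the
  next threshold. The error grows by a constant factor in each step (\<open>step_tracking\<close>), so over a bounded
  time it is proportional to the length of the first push (\<open>tracking\<close>), which is also the delay. Later times
  are negligible because of the discount.

  It remains to compare the costs. The trajectories are close except for a short time around each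
  switching. Along a fixed trajectory, inserting a short piece into the control delays the rest of it,
  which is harmless because the running cost is continuous under translations in the mean
  (\<open>insertions_integral\<close>): the modes have bounded variation in time (\<open>mode_translation\<close>), and
  everything else is Lipschitz.
\<close>

section \<open>Games with negligible delays\<close>

text \<open>
  The exceptional set need only be contained in a null set: in a non-separable metric space the
  coincidence set of two controls may fail to be measurable.
\<close>

definition aeq :: "real \<Rightarrow> (real \<Rightarrow> 'c) \<Rightarrow> (real \<Rightarrow> 'c) \<Rightarrow> bool" where
  "aeq t u v \<longleftrightarrow> (\<exists>N. negligible N \<and> (\<forall>s\<in>{0..t} - N. u s = v s))"

lemma AE_iff_aeq: "(AE s in lebesgue_on {0..t}. u s = v s) \<longleftrightarrow> aeq t u v"
proof -
  have "(AE s in lebesgue_on {0..t}. u s = v s) \<longleftrightarrow> (AE s in lebesgue. s \<in> {0..t} \<longrightarrow> u s = v s)"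
    by (rule AE_restrict_space_iff) simp
  also have "\<dots> \<longleftrightarrow> aeq t u v"
    unfolding eventually_ae_filter_negligible aeq_def by blast
  finally show ?thesis .
qed

lemma aeq_refl [simp]: "aeq t u u"
  unfolding aeq_def by (rule exI[of _ "{}"]) simp

lemma aeq_sym: "aeq t u v \<Longrightarrow> aeq t v u"
  unfolding aeq_def by metis

lemma aeq_trans [trans]: "aeq t u v \<Longrightarrow> aeq t v w \<Longrightarrow> aeq t u w"
  unfolding aeq_def
proof (elim exE conjE)
  fix N1 N2
  assume "negligible N1" "negligible N2" "\<forall>s\<in>{0..t} - N1. u s = v s" "\<forall>s\<in>{0..t} - N2. v s = w s"
  then show "\<exists>N. negligible N \<and> (\<forall>s\<in>{0..t} - N. u s = w s)"
    by (intro exI[of _ "N1 \<union> N2"]) auto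
qed

lemma aeq_mono: "aeq t u v \<Longrightarrow> s \<le> t \<Longrightarrow> aeq s u v"
  unfolding aeq_def by (metis DiffD1 DiffD2 DiffI atLeastAtMost_iff order_trans)

lemma aeq_eqI: "(\<And>s. 0 \<le> s \<Longrightarrow> s \<le> t \<Longrightarrow> u s = v s) \<Longrightarrow> aeq t u v"
  unfolding aeq_def by (rule exI[of _ "{}"]) simp

lemma aeq_0: "t \<le> 0 \<Longrightarrow> aeq t u v"
  unfolding aeq_def by (rule exI[of _ "{0}"]) auto

lemma strategies_iff:
  "\<gamma> \<in> strategies B A \<longleftrightarrow> (\<forall>\<beta>\<in>controls B. \<gamma> \<beta> \<in> controls A) \<and>
     (\<forall>t\<ge>0. \<forall>\<beta>1\<in>controls B. \<forall>\<beta>2\<in>controls B. aeq t \<beta>1 \<beta>2 \<longrightarrow> aeq t (\<gamma> \<beta>1) (\<gamma> \<beta>2))"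
  unfolding strategies_def AE_iff_aeq by (auto simp: Pi_iff)

definition paste :: "real \<Rightarrow> (real \<Rightarrow> 'c) \<Rightarrow> (real \<Rightarrow> 'c) \<Rightarrow> real \<Rightarrow> 'c" where
  "paste s u v = (\<lambda>t. if t \<le> s then u t else v t)"

lemma paste_controls:
  assumes "u \<in> controls A" "v \<in> controls A" shows "paste s u v \<in> controls A"
proof -
  have "{t \<in> space (lebesgue_on {0..}). t \<le> s} \<in> sets (lebesgue_on {0..})"
    by (auto simp: sets_restrict_space_iff Int_def)
  then show ?thesis
    using assms unfolding controls_def paste_def by (auto intro!: measurable_If)
qed

lemma aeq_paste: "aeq s u u' \<Longrightarrow> aeq t v v' \<Longrightarrow> aeq t (paste s u v) (paste s u' v')"
  unfolding aeq_def
proof (elim exE conjE)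
  fix N1 N2
  assume "negligible N1" "negligible N2" "\<forall>r\<in>{0..s} - N1. u r = u' r" "\<forall>r\<in>{0..t} - N2. v r = v' r"
  then show "\<exists>N. negligible N \<and> (\<forall>r\<in>{0..t} - N. paste s u v r = paste s u' v' r)"
    by (intro exI[of _ "N1 \<union> N2"]) (auto simp: paste_def)
qed

lemma paste_same: "paste s u u = u"
  by (auto simp: paste_def)

lemma aeq_paste_self: "aeq s u v \<Longrightarrow> aeq t (paste s u v) v"
  using aeq_paste[of s u v t v v] by (simp add: paste_same)

text \<open>
  \<open>wins j s \<alpha> \<beta>\<close>: in the game of perfect information in which time advances by \<open>j\<close> steps of length
  \<open>\<delta>\<close>, starting at \<open>s\<close> with past \<open>(\<alpha>, \<beta>)\<close>, and in each of which the minimizer commits to a piece of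
  control before the maximizer answers, the minimizer can keep the cost at most \<open>c\<close>.
\<close>

primrec wins :: "'a::metric_space set \<Rightarrow> 'b::metric_space set \<Rightarrow>
    ((real \<Rightarrow> 'a) \<Rightarrow> (real \<Rightarrow> 'b) \<Rightarrow> real) \<Rightarrow> real \<Rightarrow> real \<Rightarrow> nat \<Rightarrow> real \<Rightarrow>
    (real \<Rightarrow> 'a) \<Rightarrow> (real \<Rightarrow> 'b) \<Rightarrow> bool" where
  "wins A B J \<delta> c 0 s \<alpha> \<beta> \<longleftrightarrow> J \<alpha> \<beta> \<le> c"
| "wins A B J \<delta> c (Suc j) s \<alpha> \<beta> \<longleftrightarrow>
     (\<exists>\<alpha>'\<in>controls A. \<forall>\<beta>'\<in>controls B. wins A B J \<delta> c j (s + \<delta>) (paste s \<alpha> \<alpha>') (paste s \<beta> \<beta>'))"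

text \<open>
  A plan for the remaining game, given the past up to \<open>s\<close>. The guarantee is only required against
  opponents whose past agrees with \<open>\<beta>0\<close> almost everywhere, so a plan depends on the past of the
  opponent through its equivalence class. This makes the choice of a plan nonanticipating.
\<close>

definition min_plan :: "'a::metric_space set \<Rightarrow> 'b::metric_space set \<Rightarrow>
    ((real \<Rightarrow> 'a) \<Rightarrow> (real \<Rightarrow> 'b) \<Rightarrow> real) \<Rightarrow> real \<Rightarrow> real \<Rightarrow>
    (real \<Rightarrow> 'a) \<Rightarrow> (real \<Rightarrow> 'b) \<Rightarrow> ((real \<Rightarrow> 'b) \<Rightarrow> (real \<Rightarrow> 'a)) \<Rightarrow> bool" where
  "min_plan A B J c s \<alpha> \<beta>0 \<gamma> \<longleftrightarrow> \<gamma> \<in> strategies B A \<and>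
     (\<forall>\<beta>\<in>controls B. \<forall>t\<in>{0..s}. \<gamma> \<beta> t = \<alpha> t) \<and>
     (\<forall>\<beta>\<in>controls B. aeq s \<beta> \<beta>0 \<longrightarrow> J (\<gamma> \<beta>) \<beta> \<le> c)"

text \<open>
  The maximizer answers a piece of control that is already known, hence anticipates by one step.
\<close>

definition max_plan :: "'a::metric_space set \<Rightarrow> 'b::metric_space set \<Rightarrow>
    ((real \<Rightarrow> 'a) \<Rightarrow> (real \<Rightarrow> 'b) \<Rightarrow> real) \<Rightarrow> real \<Rightarrow> real \<Rightarrow> real \<Rightarrow>
    (real \<Rightarrow> 'a) \<Rightarrow> (real \<Rightarrow> 'b) \<Rightarrow> ((real \<Rightarrow> 'a) \<Rightarrow> (real \<Rightarrow> 'b)) \<Rightarrow> bool" where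
  "max_plan A B J \<delta> c s \<alpha>0 \<beta> \<xi> \<longleftrightarrow> (\<forall>\<alpha>\<in>controls A. \<xi> \<alpha> \<in> controls B) \<and>
     (\<forall>t\<ge>0. \<forall>\<alpha>1\<in>controls A. \<forall>\<alpha>2\<in>controls A. aeq (t + \<delta>) \<alpha>1 \<alpha>2 \<longrightarrow> aeq t (\<xi> \<alpha>1) (\<xi> \<alpha>2)) \<and>
     (\<forall>\<alpha>\<in>controls A. \<forall>t\<in>{0..s}. \<xi> \<alpha> t = \<beta> t) \<and>
     (\<forall>\<alpha>\<in>controls A. aeq s \<alpha> \<alpha>0 \<longrightarrow> J \<alpha> (\<xi> \<alpha>) \<ge> c)"

lemma min_plan_cong: "aeq s \<beta>0 \<beta>1 \<Longrightarrow> min_plan A B J c s \<alpha> \<beta>0 = min_plan A B J c s \<alpha> \<beta>1"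
proof -
  assume "aeq s \<beta>0 \<beta>1"
  then have "aeq s \<beta> \<beta>0 = aeq s \<beta> \<beta>1" for \<beta> by (metis aeq_sym aeq_trans)
  then show ?thesis unfolding min_plan_def fun_eq_iff by simp
qed

lemma max_plan_cong: "aeq s \<alpha>0 \<alpha>1 \<Longrightarrow> max_plan A B J \<delta> c s \<alpha>0 \<beta> = max_plan A B J \<delta> c s \<alpha>1 \<beta>"
proof -
  assume "aeq s \<alpha>0 \<alpha>1"
  then have "aeq s \<alpha> \<alpha>0 = aeq s \<alpha> \<alpha>1" for \<alpha> by (metis aeq_sym aeq_trans)
  then show ?thesis unfolding max_plan_def fun_eq_iff by simp
qed

text \<open>
  The hypothesis \<open>trunc\<close> says that the cost is decided by time \<open>T\<close>, up to \<open>\<epsilon>\<close>; by then the steps are over.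
  After the first move of the minimizer, a plan for the rest of the game is chosen for each class of
  answers on the first step.
\<close>

lemma wins_min_plan:
  assumes trunc: "\<And>\<alpha> \<alpha>' \<beta> \<beta>'. \<lbrakk>\<alpha> \<in> controls A; \<alpha>' \<in> controls A; \<beta> \<in> controls B; \<beta>' \<in> controls B;
        aeq T \<alpha> \<alpha>'; aeq T \<beta> \<beta>'\<rbrakk> \<Longrightarrow> \<bar>J \<alpha> \<beta> - J \<alpha>' \<beta>'\<bar> \<le> \<epsilon>"
    and "0 < \<delta>"
  shows "\<lbrakk>wins A B J \<delta> c j s \<alpha> \<beta>0; \<alpha> \<in> controls A; \<beta>0 \<in> controls B; 0 \<le> s; T \<le> s + j * \<delta>\<rbrakk>
    \<Longrightarrow> \<exists>\<gamma>. min_plan A B J (c + \<epsilon>) s \<alpha> \<beta>0 \<gamma>"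
proof (induction j arbitrary: s \<alpha> \<beta>0)
  case 0
  have "J \<alpha> \<beta> \<le> c + \<epsilon>" if "\<beta> \<in> controls B" "aeq s \<beta> \<beta>0" for \<beta>
  proof -
    have "aeq T \<beta> \<beta>0" using 0 that by (auto elim: aeq_mono)
    then have "\<bar>J \<alpha> \<beta> - J \<alpha> \<beta>0\<bar> \<le> \<epsilon>" using 0 that by (intro trunc) auto
    with 0 show ?thesis by auto
  qed
  then show ?case
    using 0 by (intro exI[of _ "\<lambda>_. \<alpha>"]) (auto simp: min_plan_def strategies_iff)
next
  case (Suc j)
  from Suc.prems obtain \<alpha>' where \<alpha>': "\<alpha>' \<in> controls A"
    and w: "\<And>\<beta>'. \<beta>' \<in> controls B \<Longrightarrow> wins A B J \<delta> c j (s + \<delta>) (paste s \<alpha> \<alpha>') (paste s \<beta>0 \<beta>')"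
    by auto
  define P where "P \<beta> = min_plan A B J (c + \<epsilon>) (s + \<delta>) (paste s \<alpha> \<alpha>') (paste s \<beta>0 \<beta>)" for \<beta>
  define G where "G \<beta> = (SOME \<gamma>. P \<beta> \<gamma>)" for \<beta>
  have G: "P \<beta> (G \<beta>)" if "\<beta> \<in> controls B" for \<beta>
  proof -
    have "T \<le> s + \<delta> + j * \<delta>" using Suc.prems(5) by (simp add: algebra_simps)
    then have "\<exists>\<gamma>. P \<beta> \<gamma>"
      unfolding P_def using Suc.prems \<alpha>' that w[OF that] \<open>0 < \<delta>\<close>
      by (intro Suc.IH paste_controls) auto
    then show ?thesis unfolding G_def by (rule someI_ex)
  qed
  have G_cong: "G \<beta>1 = G \<beta>2" if "aeq (s + \<delta>) \<beta>1 \<beta>2" for \<beta>1 \<beta>2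
  proof -
    have "aeq (s + \<delta>) (paste s \<beta>0 \<beta>1) (paste s \<beta>0 \<beta>2)"
      using that by (intro aeq_paste) auto
    then show ?thesis unfolding G_def P_def by (simp add: min_plan_cong)
  qed
  have past: "G \<beta> \<beta> t = paste s \<alpha> \<alpha>' t" if "\<beta> \<in> controls B" "0 \<le> t" "t \<le> s + \<delta>" for \<beta> t
    using G[OF that(1)] that unfolding P_def min_plan_def by auto
  have strat: "G \<beta> \<in> strategies B A" if "\<beta> \<in> controls B" for \<beta>
    using G[OF that] unfolding P_def min_plan_def by auto
  have "aeq t (G \<beta>1 \<beta>1) (G \<beta>2 \<beta>2)"
    if "0 \<le> t" "\<beta>1 \<in> controls B" "\<beta>2 \<in> controls B" "aeq t \<beta>1 \<beta>2" for t \<beta>1 \<beta>2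
  proof (cases "t \<le> s + \<delta>")
    case True
    then show ?thesis using that by (intro aeq_eqI) (auto simp: past)
  next
    case False
    then have "aeq (s + \<delta>) \<beta>1 \<beta>2" using that by (auto elim: aeq_mono)
    then show ?thesis using G_cong[of \<beta>1 \<beta>2] strat[of \<beta>2] that unfolding strategies_iff by auto
  qed
  moreover have "J (G \<beta> \<beta>) \<beta> \<le> c + \<epsilon>" if "\<beta> \<in> controls B" "aeq s \<beta> \<beta>0" for \<beta>
    using G[OF that(1)] that unfolding P_def min_plan_def by (metis aeq_paste_self aeq_sym)
  moreover have "G \<beta> \<beta> t = \<alpha> t" if "\<beta> \<in> controls B" "0 \<le> t" "t \<le> s" for \<beta> t
    using past[of \<beta> t] that \<open>0 < \<delta>\<close> by (auto simp: paste_def)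
  ultimately show ?case
    using strat by (intro exI[of _ "\<lambda>\<beta>. G \<beta> \<beta>"]) (auto simp: min_plan_def strategies_iff)
qed

lemma not_wins_max_plan:
  assumes trunc: "\<And>\<alpha> \<alpha>' \<beta> \<beta>'. \<lbrakk>\<alpha> \<in> controls A; \<alpha>' \<in> controls A; \<beta> \<in> controls B; \<beta>' \<in> controls B;
        aeq T \<alpha> \<alpha>'; aeq T \<beta> \<beta>'\<rbrakk> \<Longrightarrow> \<bar>J \<alpha> \<beta> - J \<alpha>' \<beta>'\<bar> \<le> \<epsilon>"
    and "0 < \<delta>"
  shows "\<lbrakk>\<not> wins A B J \<delta> c j s \<alpha>0 \<beta>; \<alpha>0 \<in> controls A; \<beta> \<in> controls B; 0 \<le> s; T \<le> s + j * \<delta>\<rbrakk>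
    \<Longrightarrow> \<exists>\<xi>. max_plan A B J \<delta> (c - \<epsilon>) s \<alpha>0 \<beta> \<xi>"
proof (induction j arbitrary: s \<alpha>0 \<beta>)
  case 0
  have "c - \<epsilon> \<le> J \<alpha> \<beta>" if "\<alpha> \<in> controls A" "aeq s \<alpha> \<alpha>0" for \<alpha>
  proof -
    have "aeq T \<alpha> \<alpha>0" using 0 that by (auto elim: aeq_mono)
    then have "\<bar>J \<alpha> \<beta> - J \<alpha>0 \<beta>\<bar> \<le> \<epsilon>" using 0 that by (intro trunc) auto
    with 0 show ?thesis by auto
  qed
  then show ?case
    using 0 by (intro exI[of _ "\<lambda>_. \<beta>"]) (auto simp: max_plan_def)
next
  case (Suc j)
  have w: "\<exists>\<beta>'\<in>controls B. \<not> wins A B J \<delta> c j (s + \<delta>) (paste s \<alpha>0 \<alpha>) (paste s \<beta> \<beta>')"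
    if "\<alpha> \<in> controls A" for \<alpha>
    using Suc.prems(1) that by auto
  define P where "P \<alpha> \<xi> \<longleftrightarrow> (\<exists>\<beta>'\<in>controls B.
      max_plan A B J \<delta> (c - \<epsilon>) (s + \<delta>) (paste s \<alpha>0 \<alpha>) (paste s \<beta> \<beta>') \<xi>)" for \<alpha> \<xi>
  define G where "G \<alpha> = (SOME \<xi>. P \<alpha> \<xi>)" for \<alpha>
  have G: "P \<alpha> (G \<alpha>)" if \<alpha>: "\<alpha> \<in> controls A" for \<alpha>
  proof -
    obtain \<beta>' where \<beta>': "\<beta>' \<in> controls B"
      "\<not> wins A B J \<delta> c j (s + \<delta>) (paste s \<alpha>0 \<alpha>) (paste s \<beta> \<beta>')"
      using w[OF \<alpha>] by auto
    have "T \<le> s + \<delta> + j * \<delta>" using Suc.prems(5) by (simp add: algebra_simps)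
    then have "\<exists>\<xi>. max_plan A B J \<delta> (c - \<epsilon>) (s + \<delta>) (paste s \<alpha>0 \<alpha>) (paste s \<beta> \<beta>') \<xi>"
      using Suc.prems that \<beta>' \<open>0 < \<delta>\<close> by (intro Suc.IH paste_controls) auto
    then have "\<exists>\<xi>. P \<alpha> \<xi>" unfolding P_def using \<beta>'(1) by blast
    then show ?thesis unfolding G_def by (rule someI_ex)
  qed
  have G_cong: "G \<alpha>1 = G \<alpha>2" if "aeq (s + \<delta>) \<alpha>1 \<alpha>2" for \<alpha>1 \<alpha>2
  proof -
    have "aeq (s + \<delta>) (paste s \<alpha>0 \<alpha>1) (paste s \<alpha>0 \<alpha>2)"
      using that by (intro aeq_paste) auto
    then show ?thesis unfolding G_def P_def by (simp add: max_plan_cong)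
  qed
  have past: "G \<alpha> \<alpha> t = \<beta> t" if \<alpha>: "\<alpha> \<in> controls A" and t: "0 \<le> t" "t \<le> s" for \<alpha> t
  proof -
    from G[OF \<alpha>] obtain \<beta>' where "\<forall>t\<in>{0..s + \<delta>}. G \<alpha> \<alpha> t = paste s \<beta> \<beta>' t"
      using \<alpha> unfolding P_def max_plan_def by blast
    then show ?thesis using t \<open>0 < \<delta>\<close> by (auto simp: paste_def)
  qed
  have ctrl: "G \<alpha> \<alpha>' \<in> controls B" if "\<alpha> \<in> controls A" "\<alpha>' \<in> controls A" for \<alpha> \<alpha>'
    using G[OF that(1)] that(2) unfolding P_def max_plan_def by blast
  have "aeq t (G \<alpha>1 \<alpha>1) (G \<alpha>2 \<alpha>2)"
    if "0 \<le> t" "\<alpha>1 \<in> controls A" "\<alpha>2 \<in> controls A" "aeq (t + \<delta>) \<alpha>1 \<alpha>2" for t \<alpha>1 \<alpha>2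
  proof (cases "t \<le> s")
    case True
    then show ?thesis using that by (intro aeq_eqI) (auto simp: past)
  next
    case False
    then have "aeq (s + \<delta>) \<alpha>1 \<alpha>2" using that by (auto elim: aeq_mono)
    then show ?thesis using G_cong[of \<alpha>1 \<alpha>2] G[of \<alpha>2] that unfolding P_def max_plan_def by metis
  qed
  moreover have "J \<alpha> (G \<alpha> \<alpha>) \<ge> c - \<epsilon>" if "\<alpha> \<in> controls A" "aeq s \<alpha> \<alpha>0" for \<alpha>
    using G[OF that(1)] that unfolding P_def max_plan_def by (metis aeq_paste_self aeq_sym)
  ultimately show ?case
    using ctrl past by (intro exI[of _ "\<lambda>\<alpha>. G \<alpha> \<alpha>"]) (auto simp: max_plan_def)
qed

definition delaying :: "'a::metric_space set \<Rightarrow> real \<Rightarrow> ((real \<Rightarrow> 'a) \<Rightarrow> (real \<Rightarrow> 'a)) \<Rightarrow> bool" where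
  "delaying A \<delta> \<Phi> \<longleftrightarrow> (\<forall>\<alpha>\<in>controls A. \<Phi> \<alpha> \<in> controls A) \<and>
     (\<forall>t\<ge>0. \<forall>\<alpha>\<in>controls A. \<forall>\<alpha>'\<in>controls A. aeq t \<alpha> \<alpha>' \<longrightarrow> aeq (t + \<delta>) (\<Phi> \<alpha>) (\<Phi> \<alpha>'))"

text \<open>
  Two determinacy arguments: a fixed point in time for one inequality, the discrete game of perfect
  information for the other. For the latter, \<open>c\<close> is any number strictly between the values: if the
  minimizer wins, then the lower value is about \<open>c\<close> at most, and otherwise the upper value is about \<open>c\<close> at
  least.
\<close>

theorem game_value:
  fixes A :: "'a::metric_space set" and B :: "'b::metric_space set" and J :: "(real \<Rightarrow> 'a) \<Rightarrow> (real \<Rightarrow> 'b) \<Rightarrow> real"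
  assumes ne: "A \<noteq> {}" "B \<noteq> {}"
    and bdd: "\<And>\<alpha> \<beta>. \<alpha> \<in> controls A \<Longrightarrow> \<beta> \<in> controls B \<Longrightarrow> \<bar>J \<alpha> \<beta>\<bar> \<le> C"
    and trunc: "\<And>\<epsilon>. \<epsilon> > 0 \<Longrightarrow> \<exists>T. \<forall>\<alpha>\<in>controls A. \<forall>\<alpha>'\<in>controls A. \<forall>\<beta>\<in>controls B. \<forall>\<beta>'\<in>controls B.
        aeq T \<alpha> \<alpha>' \<longrightarrow> aeq T \<beta> \<beta>' \<longrightarrow> \<bar>J \<alpha> \<beta> - J \<alpha>' \<beta>'\<bar> \<le> \<epsilon>"
    and delayA: "\<And>\<epsilon>. \<epsilon> > 0 \<Longrightarrow> \<exists>\<delta>>0. \<exists>\<Phi>. delaying A \<delta> \<Phi> \<and>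
        (\<forall>\<alpha>\<in>controls A. \<forall>\<beta>\<in>controls B. \<bar>J (\<Phi> \<alpha>) \<beta> - J \<alpha> \<beta>\<bar> \<le> \<epsilon>)"
    and delayB: "\<And>\<epsilon>. \<epsilon> > 0 \<Longrightarrow> \<exists>\<delta>>0. \<exists>\<Phi>. delaying B \<delta> \<Phi> \<and>
        (\<forall>\<alpha>\<in>controls A. \<forall>\<beta>\<in>controls B. \<bar>J \<alpha> (\<Phi> \<beta>) - J \<alpha> \<beta>\<bar> \<le> \<epsilon>)"
  shows "(INF \<gamma>\<in>strategies B A. SUP \<beta>\<in>controls B. J (\<gamma> \<beta>) \<beta>) =
         (SUP \<xi>\<in>strategies A B. INF \<alpha>\<in>controls A. J \<alpha> (\<xi> \<alpha>))"
proof -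
  obtain a b where ab: "a \<in> A" "b \<in> B" using ne by blast
  have ca: "(\<lambda>_. a) \<in> controls A" and cb: "(\<lambda>_. b) \<in> controls B"
    using ab by (auto simp: controls_def)
  have sa: "(\<lambda>_ _. a) \<in> strategies B A" and sb: "(\<lambda>_ _. b) \<in> strategies A B"
    using ca cb by (auto simp: strategies_iff)
  have ub: "bdd_above ((\<lambda>\<beta>. J (\<gamma> \<beta>) \<beta>) ` controls B)" if "\<gamma> \<in> strategies B A" for \<gamma>
    using that bdd by (intro bdd_aboveI2[of _ _ C]) (fastforce simp: strategies_iff abs_le_iff)
  have lb: "bdd_below ((\<lambda>\<alpha>. J \<alpha> (\<xi> \<alpha>)) ` controls A)" if "\<xi> \<in> strategies A B" for \<xi>
    using that bdd by (intro bdd_belowI2[of _ "- C"]) (fastforce simp: strategies_iff abs_le_iff)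
  let ?s = "\<lambda>\<gamma>. SUP \<beta>\<in>controls B. J (\<gamma> \<beta>) \<beta>" and ?i = "\<lambda>\<xi>. INF \<alpha>\<in>controls A. J \<alpha> (\<xi> \<alpha>)"
  let ?L = "INF \<gamma>\<in>strategies B A. ?s \<gamma>" and ?U = "SUP \<xi>\<in>strategies A B. ?i \<xi>"
  have s_ge: "J (\<gamma> \<beta>) \<beta> \<le> ?s \<gamma>" if "\<gamma> \<in> strategies B A" "\<beta> \<in> controls B" for \<gamma> \<beta>
    using cSUP_upper[OF that(2) ub[OF that(1)]] .
  have i_le: "?i \<xi> \<le> J \<alpha> (\<xi> \<alpha>)" if "\<xi> \<in> strategies A B" "\<alpha> \<in> controls A" for \<xi> \<alpha>
    using cINF_lower[OF lb[OF that(1)] that(2)] .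
  have bL: "bdd_below (?s ` strategies B A)"
  proof (rule bdd_belowI2[of _ "- C"])
    fix \<gamma> assume \<gamma>: "\<gamma> \<in> strategies B A"
    have "- C \<le> J (\<gamma> (\<lambda>_. b)) (\<lambda>_. b)"
      using bdd[of "\<gamma> (\<lambda>_. b)" "\<lambda>_. b"] \<gamma> cb by (auto simp: strategies_iff)
    with s_ge[OF \<gamma> cb] show "- C \<le> ?s \<gamma>" by linarith
  qed
  have bU: "bdd_above (?i ` strategies A B)"
  proof (rule bdd_aboveI2[of _ _ C])
    fix \<xi> assume \<xi>: "\<xi> \<in> strategies A B"
    have "J (\<lambda>_. a) (\<xi> (\<lambda>_. a)) \<le> C"
      using bdd[of "\<lambda>_. a" "\<xi> (\<lambda>_. a)"] \<xi> ca by (auto simp: strategies_iff)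
    with i_le[OF \<xi> ca] show "?i \<xi> \<le> C" by linarith
  qed

  have "?U \<le> ?L"
  proof (rule cSUP_least)
    show "strategies A B \<noteq> {}" using sb by blast
    fix \<xi> assume \<xi>: "\<xi> \<in> strategies A B"
    show "?i \<xi> \<le> ?L"
    proof (rule cINF_greatest)
      show "strategies B A \<noteq> {}" using sa by blast
      fix \<gamma> assume \<gamma>: "\<gamma> \<in> strategies B A"
      show "?i \<xi> \<le> ?s \<gamma>"
      proof (rule field_le_epsilon)
        fix \<epsilon> :: real assume "\<epsilon> > 0"
        then have "\<epsilon> / 2 > 0" by simp
        from trunc[OF this] obtain T where T: "\<And>\<alpha> \<alpha>' \<beta>. \<lbrakk>\<alpha> \<in> controls A; \<alpha>' \<in> controls A;
            \<beta> \<in> controls B; aeq T \<alpha> \<alpha>'\<rbrakk> \<Longrightarrow> \<bar>J \<alpha> \<beta> - J \<alpha>' \<beta>\<bar> \<le> \<epsilon> / 2"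
          by (metis aeq_refl)
        from delayA[OF \<open>\<epsilon> / 2 > 0\<close>] obtain \<delta> \<Phi> where "\<delta> > 0" and \<Phi>: "delaying A \<delta> \<Phi>"
          and close: "\<And>\<alpha> \<beta>. \<alpha> \<in> controls A \<Longrightarrow> \<beta> \<in> controls B \<Longrightarrow> \<bar>J (\<Phi> \<alpha>) \<beta> - J \<alpha> \<beta>\<bar> \<le> \<epsilon> / 2"
          by blast
        \<comment> \<open>The delay makes the composed response a contraction in time, so that its iterates
          approach a pair of controls consistent with both strategies.\<close>
        define F where "F \<alpha> = \<Phi> (\<gamma> (\<xi> \<alpha>))" for \<alpha>
        define u where "u n = (F ^^ n) (\<lambda>_. a)" for n
        have cu: "u n \<in> controls A" for n
          unfolding u_def by (induction n) (use ca \<gamma> \<xi> \<Phi> in \<open>auto simp: F_def strategies_iff delaying_def\<close>)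
        have c\<xi>: "\<xi> (u n) \<in> controls B" and c\<gamma>: "\<gamma> (\<xi> (u n)) \<in> controls A" for n
          using cu[of n] \<xi> \<gamma> by (auto simp: strategies_iff)
        have "aeq (n * \<delta>) (u n) (u (Suc n))" for n
        proof (induction n)
          case 0
          show ?case by (rule aeq_0) simp
        next
          case (Suc n)
          have "aeq (n * \<delta>) (\<xi> (u n)) (\<xi> (u (Suc n)))"
            using Suc \<xi> cu[of n] cu[of "Suc n"] \<open>\<delta> > 0\<close> unfolding strategies_iff by simp
          then have "aeq (n * \<delta>) (\<gamma> (\<xi> (u n))) (\<gamma> (\<xi> (u (Suc n))))"
            using \<gamma> c\<xi>[of n] c\<xi>[of "Suc n"] \<open>\<delta> > 0\<close> unfolding strategies_iff by simp
          then have "aeq (n * \<delta> + \<delta>) (F (u n)) (F (u (Suc n)))"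
            using \<Phi> c\<gamma>[of n] c\<gamma>[of "Suc n"] \<open>\<delta> > 0\<close> unfolding delaying_def F_def by simp
          then show ?case by (simp add: u_def algebra_simps)
        qed
        note iter = this
        obtain n :: nat where "T / \<delta> \<le> n" using real_arch_simple by blast
        then have "T \<le> n * \<delta>" using \<open>\<delta> > 0\<close> by (simp add: field_simps)
        with iter have near: "aeq T (u n) (u (Suc n))" by (rule aeq_mono)
        have "J (u n) (\<xi> (u n)) - J (u (Suc n)) (\<xi> (u n)) \<le> \<epsilon> / 2"
          using T[OF cu cu c\<xi> near, of n] by (rule order_trans[OF abs_ge_self])
        moreover have "J (u (Suc n)) (\<xi> (u n)) - J (\<gamma> (\<xi> (u n))) (\<xi> (u n)) \<le> \<epsilon> / 2"
          using order_trans[OF abs_ge_self close[OF c\<gamma> c\<xi>, of n n]] by (simp add: u_def F_def)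
        ultimately have "J (u n) (\<xi> (u n)) \<le> J (\<gamma> (\<xi> (u n))) (\<xi> (u n)) + \<epsilon>"
          by linarith
        with i_le[OF \<xi> cu, of n] s_ge[OF \<gamma> c\<xi>, of n] show "?i \<xi> \<le> ?s \<gamma> + \<epsilon>" by linarith
      qed
    qed
  qed
  moreover have "?L \<le> ?U"
  proof (rule ccontr)
    assume "\<not> ?L \<le> ?U"
    define \<epsilon> where "\<epsilon> = (?L - ?U) / 6"
    define c where "c = ?L - 2 * \<epsilon>"
    have "\<epsilon> > 0" using \<open>\<not> ?L \<le> ?U\<close> by (simp add: \<epsilon>_def)
    have Uc: "?U = c - 4 * \<epsilon>" by (simp add: c_def \<epsilon>_def field_simps)
    from trunc[OF \<open>\<epsilon> > 0\<close>] obtain T where T: "\<And>\<alpha> \<alpha>' \<beta> \<beta>'. \<lbrakk>\<alpha> \<in> controls A; \<alpha>' \<in> controls A;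
        \<beta> \<in> controls B; \<beta>' \<in> controls B; aeq T \<alpha> \<alpha>'; aeq T \<beta> \<beta>'\<rbrakk> \<Longrightarrow> \<bar>J \<alpha> \<beta> - J \<alpha>' \<beta>'\<bar> \<le> \<epsilon>"
      by metis
    from delayB[OF \<open>\<epsilon> > 0\<close>] obtain \<delta> \<Phi> where "\<delta> > 0" and \<Phi>: "delaying B \<delta> \<Phi>"
      and close: "\<And>\<alpha> \<beta>. \<alpha> \<in> controls A \<Longrightarrow> \<beta> \<in> controls B \<Longrightarrow> \<bar>J \<alpha> (\<Phi> \<beta>) - J \<alpha> \<beta>\<bar> \<le> \<epsilon>"
      by blast
    obtain n :: nat where "T / \<delta> \<le> n" using real_arch_simple by blast
    then have n: "T \<le> 0 + n * \<delta>" using \<open>\<delta> > 0\<close> by (simp add: field_simps)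
    show False
    proof (cases "wins A B J \<delta> c n 0 (\<lambda>_. a) (\<lambda>_. b)")
      case True
      obtain \<gamma> where \<gamma>: "min_plan A B J (c + \<epsilon>) 0 (\<lambda>_. a) (\<lambda>_. b) \<gamma>"
        using wins_min_plan[OF T \<open>\<delta> > 0\<close> True ca cb order_refl n] by blast
      have "J (\<gamma> \<beta>) \<beta> \<le> c + \<epsilon>" if "\<beta> \<in> controls B" for \<beta>
        using \<gamma> that aeq_0[of 0 \<beta> "\<lambda>_. b"] by (auto simp: min_plan_def)
      then have "?s \<gamma> \<le> c + \<epsilon>" using cb by (intro cSUP_least) auto
      moreover have "?L \<le> ?s \<gamma>" using \<gamma> by (intro cINF_lower[OF bL]) (simp add: min_plan_def)
      ultimately show False using \<open>\<epsilon> > 0\<close> by (simp add: c_def)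
    next
      case False
      obtain \<xi> where \<xi>: "max_plan A B J \<delta> (c - \<epsilon>) 0 (\<lambda>_. a) (\<lambda>_. b) \<xi>"
        using not_wins_max_plan[OF T \<open>\<delta> > 0\<close> False ca cb order_refl n] by blast
      then have c\<xi>: "\<xi> \<alpha> \<in> controls B" if "\<alpha> \<in> controls A" for \<alpha>
        using that by (auto simp: max_plan_def)
      have "aeq t (\<Phi> (\<xi> \<alpha>)) (\<Phi> (\<xi> \<alpha>'))"
        if "0 \<le> t" "\<alpha> \<in> controls A" "\<alpha>' \<in> controls A" "aeq t \<alpha> \<alpha>'" for t \<alpha> \<alpha>'
      proof (cases "\<delta> \<le> t")
        case True
        then have "aeq (t - \<delta>) (\<xi> \<alpha>) (\<xi> \<alpha>')" using \<xi> that by (auto simp: max_plan_def)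
        then have "aeq (t - \<delta> + \<delta>) (\<Phi> (\<xi> \<alpha>)) (\<Phi> (\<xi> \<alpha>'))"
          using True \<Phi> c\<xi> that unfolding delaying_def by (metis diff_ge_0_iff_ge)
        then show ?thesis by simp
      next
        case False
        have "aeq 0 (\<xi> \<alpha>) (\<xi> \<alpha>')" by (rule aeq_0) simp
        then have "aeq (0 + \<delta>) (\<Phi> (\<xi> \<alpha>)) (\<Phi> (\<xi> \<alpha>'))"
          using \<Phi> c\<xi> that unfolding delaying_def by blast
        then show ?thesis using False by (auto elim: aeq_mono)
      qed
      then have strat: "(\<lambda>\<alpha>. \<Phi> (\<xi> \<alpha>)) \<in> strategies A B"
        using \<Phi> c\<xi> by (auto simp: strategies_iff delaying_def)
      have "c - 2 * \<epsilon> \<le> J \<alpha> (\<Phi> (\<xi> \<alpha>))" if "\<alpha> \<in> controls A" for \<alpha>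
      proof -
        have "c - \<epsilon> \<le> J \<alpha> (\<xi> \<alpha>)"
          using \<xi> that aeq_0[of 0 \<alpha> "\<lambda>_. a"] by (auto simp: max_plan_def)
        with close[OF that c\<xi>[OF that]] show ?thesis by linarith
      qed
      then have "c - 2 * \<epsilon> \<le> ?i (\<lambda>\<alpha>. \<Phi> (\<xi> \<alpha>))" using ca by (intro cINF_greatest) auto
      moreover have "?i (\<lambda>\<alpha>. \<Phi> (\<xi> \<alpha>)) \<le> ?U" using strat by (intro cSUP_upper[OF _ bU])
      ultimately show False using \<open>\<epsilon> > 0\<close> Uc by linarith
    qed
  qed
  ultimately show ?thesis by linarith
qed

section \<open>Controlled differential equations\<close>

text \<open>
  The control space is not assumed to be separable, so the pair of a state and a control need not
  be measurable for the Borel sets of the product. Approximating the state by simple functions avoids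
  the pair.
\<close>

lemma caratheodory_measurable:
  fixes F :: "'s::euclidean_space \<Rightarrow> 'u \<Rightarrow> 'v::metric_space"
  assumes s: "s \<in> borel_measurable M"
    and F: "\<And>x. (\<lambda>t. F x (u t)) \<in> borel_measurable M"
    and cont: "\<And>t. t \<in> space M \<Longrightarrow> continuous_on UNIV (\<lambda>x. F x (u t))"
  shows "(\<lambda>t. F (s t) (u t)) \<in> borel_measurable M"
proof -
  obtain S where S: "\<And>i. simple_function M (S i)" and lim: "\<And>t. t \<in> space M \<Longrightarrow> (\<lambda>i. S i t) \<longlonglongrightarrow> s t"
    using borel_measurable_implies_sequence_metric[OF s, of 0] by blast
  show ?thesis
  proof (rule borel_measurable_LIMSEQ_metric)
    fix i
    have "S i \<in> measurable M (count_space (S i ` space M))"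
      using simple_functionD[OF S[of i]] by (subst measurable_count_space_eq2) auto
    then show "(\<lambda>t. F (S i t) (u t)) \<in> borel_measurable M"
      by (rule measurable_compose_countable'[where f="\<lambda>x t. F x (u t)", OF F])
        (rule countable_finite[OF simple_functionD(1)[OF S]])
  next
    fix t assume t: "t \<in> space M"
    show "(\<lambda>i. F (S i t) (u t)) \<longlonglongrightarrow> F (s t) (u t)"
      by (rule continuous_on_tendsto_compose[OF cont[OF t] lim[OF t]]) auto
  qed
qed

lemma continuous_on_atLeastI:
  assumes "\<And>t. continuous_on {s..t::real} \<xi>" shows "continuous_on {s..} \<xi>"
  unfolding continuous_on_eq_continuous_within
proof
  fix t assume "t \<in> {s..}"
  then have "continuous (at t within {s..t + 1}) \<xi>"
    using assms[of "t + 1"] by (auto simp: continuous_on_eq_continuous_within)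
  moreover have "at t within {s..} = at t within {s..t + 1}"
    by (rule at_within_nhd[of _ "{..<t + 1}"]) auto
  ultimately show "continuous (at t within {s..}) \<xi>" by simp
qed

lemma control_in: "\<alpha> \<in> controls A \<Longrightarrow> 0 \<le> t \<Longrightarrow> \<alpha> t \<in> A"
  by (simp add: controls_def)

lemma control_measurable:
  fixes F :: "'a::metric_space \<Rightarrow> 'v::topological_space"
  assumes "\<alpha> \<in> controls A" "continuous_on A F" "S \<subseteq> {0..}"
  shows "(\<lambda>t. F (\<alpha> t)) \<in> borel_measurable (lebesgue_on S)"
proof -
  have "\<alpha> \<in> lebesgue_on {0..} \<rightarrow>\<^sub>M restrict_space borel A"
    using assms(1) by (intro measurable_restrict_space2) (auto simp: controls_def)
  then have "(\<lambda>t. F (\<alpha> t)) \<in> borel_measurable (lebesgue_on {0..})"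
    using borel_measurable_continuous_on_restrict[OF assms(2)] by (rule measurable_compose)
  then show ?thesis using assms(3) by (rule measurable_restrict_mono)
qed

lemma has_integral_norm_le:
  fixes h :: "real \<Rightarrow> 'v::euclidean_space"
  assumes "(h has_integral i) {s..t}" "s \<le> t" "\<And>r. r \<in> {s..t} \<Longrightarrow> norm (h r) \<le> C" "0 \<le> C"
  shows "norm i \<le> C * (t - s)"
  using has_integral_bound_real[OF assms(4) finite.emptyI assms(1)] assms(2,3) by simp

lemma has_integral_Icc_diff:
  fixes h :: "real \<Rightarrow> 'v::euclidean_space"
  assumes "(h has_integral i) {s..t}" "(h has_integral j) {s..t'}" "s \<le> t" "t \<le> t'"
  shows "(h has_integral (j - i)) {t..t'}"
proof -
  have "h integrable_on {t..t'}"
    using assms by (meson has_integral_integrable integrable_subinterval_real atLeastatMost_subset_iff order_refl)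
  then obtain k where k: "(h has_integral k) {t..t'}" by blast
  from has_integral_combine[OF assms(3,4) assms(1) k] have "i + k = j"
    using assms(2) by (rule has_integral_unique)
  with k show ?thesis by auto
qed

lemma has_integral_exp_shift:
  fixes k :: real
  assumes "k \<noteq> 0" "s \<le> t"
  shows "((\<lambda>r. exp (k * (r - s))) has_integral ((exp (k * (t - s)) - 1) / k)) {s..t}"
proof -
  have "((\<lambda>r. exp (k * (r - s)) / k) has_vector_derivative exp (k * (r - s))) (at r within {s..t})" for r
    using assms(1) by (auto intro!: derivative_eq_intros simp: has_real_derivative_iff_has_vector_derivative[symmetric])
  from fundamental_theorem_of_calculus[OF assms(2) this]
  show ?thesis using assms(1) by (simp add: diff_divide_distrib)
qed

locale player =
  fixes f :: "'x::euclidean_space \<Rightarrow> int \<Rightarrow> 'a::metric_space \<Rightarrow> 'x"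
    and e :: 'x and \<rho> :: "int \<Rightarrow> real" and A :: "'a set" and L M :: real
  assumes basis: "e \<in> Basis"
    and thresholds: "\<rho> (-1) < \<rho> 1"
    and cont: "\<And>w x. w \<in> {-1, 1} \<Longrightarrow> continuous_on A (\<lambda>a. f x w a)"
    and speed: "\<And>w x a. w \<in> {-1, 1} \<Longrightarrow> a \<in> A \<Longrightarrow> norm (f x w a) \<le> M"
    and lipschitz: "\<And>w x y a. w \<in> {-1, 1} \<Longrightarrow> a \<in> A \<Longrightarrow> norm (f x w a - f y w a) \<le> L * norm (x - y)"
    and L_pos: "0 < L" and M_pos: "0 < M"
    and ctrl: "controllable e \<rho> A f"
begin

text \<open>
  \<open>X\<close> follows the dynamics on \<open>[s, T]\<close> while the modes are prescribed by \<open>W\<close>. Gauge integrals are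
  used because they restrict, shift and join without any measurability bookkeeping.
\<close>

definition solves :: "(real \<Rightarrow> int) \<Rightarrow> (real \<Rightarrow> 'a) \<Rightarrow> real \<Rightarrow> real \<Rightarrow> (real \<Rightarrow> 'x) \<Rightarrow> bool" where
  "solves W \<alpha> s T X \<longleftrightarrow>
     (\<forall>t\<in>{s..T}. ((\<lambda>r. f (X r) (W r) (\<alpha> r)) has_integral (X t - X s)) {s..t})"

lemma solves_diff:
  assumes "solves W \<alpha> s T X" "s \<le> t" "t \<le> t'" "t' \<le> T"
  shows "((\<lambda>r. f (X r) (W r) (\<alpha> r)) has_integral (X t' - X t)) {t..t'}"
  using has_integral_Icc_diff[of _ "X t - X s" s t "X t' - X s" t'] assms
  by (auto simp: solves_def)

lemma solves_sub:
  "solves W \<alpha> s T X \<Longrightarrow> s \<le> s' \<Longrightarrow> T' \<le> T \<Longrightarrow> solves W \<alpha> s' T' X"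
  by (subst solves_def) (auto intro: solves_diff)

lemma solves_cong:
  assumes "solves W \<alpha> s T X" and N: "negligible N"
    and eq: "\<And>t. t \<in> {s..T} - N \<Longrightarrow> W t = W' t \<and> \<alpha> t = \<alpha>' t" and X: "\<And>t. t \<in> {s..T} \<Longrightarrow> X t = X' t"
  shows "solves W' \<alpha>' s T X'"
  unfolding solves_def
proof
  fix t assume t: "t \<in> {s..T}"
  then have "((\<lambda>r. f (X r) (W r) (\<alpha> r)) has_integral (X' t - X' s)) {s..t}"
    using bspec[OF assms(1)[unfolded solves_def] t] X[of t] X[of s] by simp
  then show "((\<lambda>r. f (X' r) (W' r) (\<alpha>' r)) has_integral (X' t - X' s)) {s..t}"
    by (rule has_integral_spike[OF N, rotated]) (use t eq X in auto)
qed

lemma solves_shift: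
  assumes "solves W \<alpha> s T X"
  shows "solves (\<lambda>t. W (c + t)) (\<lambda>t. \<alpha> (c + t)) (s - c) (T - c) (\<lambda>t. X (c + t))"
  unfolding solves_def
proof
  fix t assume "t \<in> {s - c..T - c}"
  then have "((\<lambda>r. f (X r) (W r) (\<alpha> r)) has_integral (X (c + t) - X s)) {s - c + c..t + c}"
    using assms by (auto simp: solves_def add.commute)
  then show "((\<lambda>r. f (X (c + r)) (W (c + r)) (\<alpha> (c + r))) has_integral
      (X (c + t) - X (c + (s - c)))) {s - c..t}"
    by (subst (asm) has_integral_shift_Icc_real[symmetric]) (simp add: o_def)
qed

lemma solves_join:
  assumes "solves W \<alpha> s t X" "solves W \<alpha> t T X" "s \<le> t"
  shows "solves W \<alpha> s T X"
  unfolding solves_def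
proof
  fix r assume r: "r \<in> {s..T}"
  show "((\<lambda>r. f (X r) (W r) (\<alpha> r)) has_integral (X r - X s)) {s..r}"
  proof (cases "r \<le> t")
    case True
    then show ?thesis using assms(1) r by (auto simp: solves_def)
  next
    case False
    have "((\<lambda>r. f (X r) (W r) (\<alpha> r)) has_integral (X t - X s)) {s..t}"
      "((\<lambda>r. f (X r) (W r) (\<alpha> r)) has_integral (X r - X t)) {t..r}"
      using assms r False by (auto simp: solves_def)
    from has_integral_combine[OF \<open>s \<le> t\<close> _ this] False show ?thesis by simp
  qed
qed

lemma solves_speed:
  assumes "solves W \<alpha> s T X" "s \<le> t" "t \<le> t'" "t' \<le> T" "0 \<le> s" "\<alpha> \<in> controls A"
    and "\<And>t. t \<in> {s..T} \<Longrightarrow> W t \<in> {-1, 1}"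
  shows "norm (X t' - X t) \<le> M * (t' - t)"
  using solves_diff[OF assms(1-4)] assms M_pos
  by (intro has_integral_norm_le[where h="\<lambda>r. f (X r) (W r) (\<alpha> r)"] speed control_in[of \<alpha>]) auto

lemma solves_continuous:
  assumes "solves W \<alpha> s T X" "0 \<le> s" "\<alpha> \<in> controls A" "\<And>t. t \<in> {s..T} \<Longrightarrow> W t \<in> {-1, 1}"
  shows "continuous_on {s..T} X"
proof -
  have "M-lipschitz_on {s..T} X"
  proof (rule lipschitz_onI)
    fix t t' assume "t \<in> {s..T}" "t' \<in> {s..T}"
    then show "dist (X t) (X t') \<le> M * dist t t'"
      using solves_speed[OF assms(1) _ _ _ assms(2-4), of t t']
        solves_speed[OF assms(1) _ _ _ assms(2-4), of t' t]
      by (cases "t \<le> t'") (auto simp: dist_norm norm_minus_commute)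
  qed (use M_pos in simp)
  then show ?thesis by (rule lipschitz_on_continuous_on)
qed

text \<open>
  A form of Gronwall's inequality: the maximum of \<open>e\<^sup>-\<^sup>2\<^sup>L\<^sup>t \<bar>X - X'\<bar>\<close> controls itself with factor
  \<open>1/2\<close>.
\<close>

lemma solves_stability:
  assumes X: "solves W \<alpha> s T X" and X': "solves W \<alpha>' s T X'"
    and s: "0 \<le> s" and \<alpha>: "\<alpha> \<in> controls A" "\<alpha>' \<in> controls A"
    and W: "\<And>t. t \<in> {s..T} \<Longrightarrow> W t \<in> {-1, 1}"
    and N: "negligible N" "\<And>t. t \<in> {s..T} - N \<Longrightarrow> \<alpha> t = \<alpha>' t"
    and t: "t \<in> {s..T}"
  shows "norm (X t - X' t) \<le> 2 * exp (2 * L * (t - s)) * norm (X s - X' s)"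
proof -
  define u where "u t = norm (X t - X' t)" for t
  define \<phi> where "\<phi> t = exp (- (2 * L) * (t - s)) * u t" for t
  have u_\<phi>: "u r = \<phi> r * exp (2 * L * (r - s))" for r
    unfolding \<phi>_def by (simp add: exp_minus)
  have X': "solves W \<alpha> s T X'" using solves_cong[OF X' N(1), of W \<alpha> X'] N(2) by simp
  have "continuous_on {s..T} \<phi>"
    unfolding \<phi>_def u_def
    by (intro continuous_intros solves_continuous[OF X s \<alpha>(1) W] solves_continuous[OF X' s \<alpha>(1) W])
  moreover have "{s..T} \<noteq> {}" using t by auto
  ultimately obtain m where m: "m \<in> {s..T}" and max: "\<And>r. r \<in> {s..T} \<Longrightarrow> \<phi> r \<le> \<phi> m"
    using continuous_attains_sup[of "{s..T}" \<phi>] by auto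
  have u_le: "u r \<le> \<phi> m * exp (2 * L * (r - s))" if "r \<in> {s..T}" for r
    unfolding u_\<phi>[of r] using max[OF that] by simp
  have "0 \<le> \<phi> m" by (simp add: \<phi>_def u_def)
  have "((\<lambda>r. f (X r) (W r) (\<alpha> r) - f (X' r) (W r) (\<alpha> r)) has_integral
      ((X m - X s) - (X' m - X' s))) {s..m}"
    using X X' m by (intro has_integral_diff) (auto simp: solves_def)
  moreover have "((\<lambda>r. (L * \<phi> m) * exp (2 * L * (r - s))) has_integral
      ((L * \<phi> m) * ((exp (2 * L * (m - s)) - 1) / (2 * L)))) {s..m}"
    using m L_pos by (intro has_integral_mult_right has_integral_exp_shift) auto
  moreover have "norm (f (X r) (W r) (\<alpha> r) - f (X' r) (W r) (\<alpha> r)) \<le> (L * \<phi> m) * exp (2 * L * (r - s))"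
    if "r \<in> {s..m}" for r
  proof -
    have "norm (f (X r) (W r) (\<alpha> r) - f (X' r) (W r) (\<alpha> r)) \<le> L * u r"
      unfolding u_def using that m s \<alpha> W[of r] by (intro lipschitz control_in) auto
    also have "\<dots> \<le> L * (\<phi> m * exp (2 * L * (r - s)))"
      using u_le[of r] that m L_pos by (intro mult_left_mono) auto
    finally show ?thesis by (simp add: mult.assoc)
  qed
  ultimately have "norm ((X m - X s) - (X' m - X' s)) \<le> (L * \<phi> m) * ((exp (2 * L * (m - s)) - 1) / (2 * L))"
    by (metis (no_types, lifting) has_integral_iff integral_norm_bound_integral)
  also have "\<dots> \<le> \<phi> m * exp (2 * L * (m - s)) / 2"
    using L_pos \<open>0 \<le> \<phi> m\<close> by (simp add: field_simps)
  finally have "norm ((X m - X s) - (X' m - X' s)) \<le> \<phi> m * exp (2 * L * (m - s)) / 2" .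
  moreover have "u m \<le> norm ((X m - X s) - (X' m - X' s)) + u s"
    unfolding u_def using norm_triangle_ineq[of "(X m - X s) - (X' m - X' s)" "X s - X' s"]
    by (simp add: algebra_simps)
  moreover note u_\<phi>[of m]
  ultimately have "\<phi> m * exp (2 * L * (m - s)) / 2 \<le> u s" by linarith
  moreover have "\<phi> m * 1 \<le> \<phi> m * exp (2 * L * (m - s))"
    using \<open>0 \<le> \<phi> m\<close> m L_pos by (intro mult_left_mono) auto
  ultimately have "\<phi> m \<le> 2 * u s" by linarith
  then have "\<phi> m * exp (2 * L * (t - s)) \<le> 2 * u s * exp (2 * L * (t - s))"
    by (intro mult_right_mono) auto
  with u_le[OF t] have "u t \<le> 2 * u s * exp (2 * L * (t - s))" by linarith
  then show ?thesis unfolding u_def by (simp add: mult_ac)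
qed

lemma field_measurable:
  assumes \<alpha>: "\<alpha> \<in> controls A" and S: "S \<subseteq> {0..}" and w: "w \<in> {-1, 1}"
    and X: "X \<in> borel_measurable (lebesgue_on S)"
  shows "(\<lambda>t. f (X t) w (\<alpha> t)) \<in> borel_measurable (lebesgue_on S)"
proof (rule caratheodory_measurable[where F="\<lambda>x a. f x w a", OF X])
  show "(\<lambda>t. f x w (\<alpha> t)) \<in> borel_measurable (lebesgue_on S)" for x
    by (rule control_measurable[OF \<alpha> cont[OF w] S])
next
  fix t assume "t \<in> space (lebesgue_on S)"
  then have "\<alpha> t \<in> A" using \<alpha> S by (auto simp: controls_def)
  then have "L-lipschitz_on UNIV (\<lambda>x. f x w (\<alpha> t))"
    using lipschitz[OF w, of "\<alpha> t"] L_pos by (auto simp: lipschitz_on_def dist_norm)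
  then show "continuous_on UNIV (\<lambda>x. f x w (\<alpha> t))" by (rule lipschitz_on_continuous_on)
qed

lemma field_absolutely_integrable:
  assumes \<alpha>: "\<alpha> \<in> controls A" and s: "0 \<le> s" and w: "w \<in> {-1, 1}"
    and X: "continuous_on {s..t} X"
  shows "(\<lambda>r. f (X r) w (\<alpha> r)) absolutely_integrable_on {s..t}"
proof (rule measurable_bounded_by_integrable_imp_absolutely_integrable)
  have "X \<in> borel_measurable (lebesgue_on {s..t})"
    using X by (intro continuous_imp_measurable_on_sets_lebesgue) auto
  then show "(\<lambda>r. f (X r) w (\<alpha> r)) \<in> borel_measurable (lebesgue_on {s..t})"
    using s by (intro field_measurable[OF \<alpha> _ w]) auto
  show "(\<lambda>r. M) integrable_on {s..t}" by (rule integrable_const_ivl)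
qed (use \<alpha> s w speed in \<open>auto simp: controls_def\<close>)

lemma mode_solution_iff_solves:
  assumes \<alpha>: "\<alpha> \<in> controls A" and s: "0 \<le> s" and w: "w \<in> {-1, 1}"
  shows "mode_solution f w \<alpha> s x \<xi> \<longleftrightarrow> \<xi> s = x \<and> (\<forall>T. solves (\<lambda>_. w) \<alpha> s T \<xi>)"
proof
  assume *: "mode_solution f w \<alpha> s x \<xi>"
  have int: "((\<lambda>r. f (\<xi> r) w (\<alpha> r)) has_integral (\<xi> t - x)) {s..t}" if "s \<le> t" for t
  proof -
    have "continuous_on {s..t} \<xi>"
      using * by (auto simp: mode_solution_def intro: continuous_on_subset)
    from has_integral_set_lebesgue[OF field_absolutely_integrable[OF \<alpha> s w this]] *
    show ?thesis using that by (auto simp: mode_solution_def algebra_simps)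
  qed
  have "\<xi> s = x" using has_integral_norm_le[OF int[of s], of M] \<alpha> s w speed M_pos by (auto simp: controls_def)
  then show "\<xi> s = x \<and> (\<forall>T. solves (\<lambda>_. w) \<alpha> s T \<xi>)" using int by (auto simp: solves_def)
next
  assume *: "\<xi> s = x \<and> (\<forall>T. solves (\<lambda>_. w) \<alpha> s T \<xi>)"
  have c: "continuous_on {s..t} \<xi>" for t
    using * w by (intro solves_continuous[OF _ s \<alpha>]) auto
  have "continuous_on {s..} \<xi>" by (rule continuous_on_atLeastI[OF c])
  moreover have "\<xi> t = x + (LINT r:{s..t}|lebesgue. f (\<xi> r) w (\<alpha> r))" if "s \<le> t" for t
  proof -
    have "((\<lambda>r. f (\<xi> r) w (\<alpha> r)) has_integral (\<xi> t - x)) {s..t}"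
      using conjunct2[OF *, rule_format, of t] conjunct1[OF *] that by (simp add: solves_def)
    from has_integral_unique[OF this has_integral_set_lebesgue[OF field_absolutely_integrable[OF \<alpha> s w c]]]
    show ?thesis by (simp add: algebra_simps eq_diff_eq diff_eq_eq)
  qed
  ultimately show "mode_solution f w \<alpha> s x \<xi>" by (simp add: mode_solution_def)
qed

text \<open>
  Substituting \<open>\<xi> t = x + e\<^bsup>2L(t-s)\<^esup> v t\<close> turns the integral operator into a contraction of the
  bounded continuous functions, on the whole half-line at once.
\<close>

lemma mode_solution_exists:
  assumes \<alpha>: "\<alpha> \<in> controls A" and s: "0 \<le> s" and w: "w \<in> {-1, 1}"
  shows "\<exists>\<xi>. mode_solution f w \<alpha> s x \<xi>"
proof -
  define k where "k = 2 * L"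
  have k: "k > 0" using L_pos by (simp add: k_def)
  define E where "E v r = x + exp (k * (r - s)) *\<^sub>R v r" for v :: "real \<Rightarrow> 'x" and r
  define h where "h v r = f (E v r) w (\<alpha> r)" for v :: "real \<Rightarrow> 'x" and r
  define G where "G v t = integral {s..max s t} (h v)" for v :: "real \<Rightarrow> 'x" and t
  define F where "F v t = exp (- k * (max s t - s)) *\<^sub>R G v t" for v :: "real \<Rightarrow> 'x" and t
  have contE: "continuous_on {s..t} (E v)" if "continuous_on UNIV v" for v t
    unfolding E_def using continuous_on_subset[OF that subset_UNIV] by (intro continuous_intros)
  have hint: "h v integrable_on {s..t}" if "continuous_on UNIV v" for v t
    unfolding h_def using field_absolutely_integrable[OF \<alpha> s w contE[OF that]]
    by (simp add: absolutely_integrable_on_def)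
  have hbound: "norm (h v r) \<le> M" if "s \<le> r" for v r
    unfolding h_def using that s w \<alpha> by (intro speed control_in) auto
  have G_bound: "norm (G v t) \<le> M * (max s t - s)" if "continuous_on UNIV v" for v t
    unfolding G_def using hint[OF that, of "max s t"] M_pos
    by (intro has_integral_norm_le[where h="h v"] hbound) auto
  have contG: "continuous_on UNIV (G v)" if v: "continuous_on UNIV v" for v
  proof -
    have "M-lipschitz_on {s..} (\<lambda>t. integral {s..t} (h v))"
    proof (rule lipschitz_onI)
      have *: "norm (integral {s..t'} (h v) - integral {s..t} (h v)) \<le> M * (t' - t)"
        if "s \<le> t" "t \<le> t'" for t t'
        using has_integral_Icc_diff[OF integrable_integral[OF hint[OF v]] integrable_integral[OF hint[OF v]] that] that M_pos
        by (intro has_integral_norm_le[where h="h v"] hbound) auto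
      fix t t' assume "t \<in> {s..}" "t' \<in> {s..}"
      then show "dist (integral {s..t} (h v)) (integral {s..t'} (h v)) \<le> M * dist t t'"
        using *[of t t'] *[of t' t] by (cases "t \<le> t'") (auto simp: dist_norm norm_minus_commute)
    qed (use M_pos in simp)
    from lipschitz_on_continuous_on[OF this]
    show ?thesis unfolding G_def
      by (rule continuous_on_compose2[where f="\<lambda>t. max s t"]) (auto intro!: continuous_intros)
  qed
  have FB: "F v \<in> bcontfun" if "continuous_on UNIV v" for v
  proof (rule bcontfun_normI)
    show "continuous_on UNIV (F v)"
      unfolding F_def by (intro continuous_intros contG that)
    fix t
    define d where "d = max s t - s"
    have "d \<ge> 0" by (simp add: d_def)
    have "k * d \<le> exp (k * d)" using exp_ge_add_one_self[of "k * d"] by linarith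
    then have "d * exp (- k * d) \<le> 1 / k"
      using k by (simp add: exp_minus field_simps)
    then have "M * (d * exp (- k * d)) \<le> M * (1 / k)" using M_pos by (intro mult_left_mono) auto
    moreover have "norm (F v t) \<le> exp (- k * d) * (M * d)"
      unfolding F_def d_def using G_bound[OF that, of t] by (simp add: mult_left_mono)
    ultimately show "norm (F v t) \<le> M / k" by (simp add: mult_ac)
  qed
  define \<Psi> where "\<Psi> v = Bcontfun (F (apply_bcontfun v))" for v :: "real \<Rightarrow>\<^sub>C 'x"
  have \<Psi>: "apply_bcontfun (\<Psi> v) = F (apply_bcontfun v)" for v
    unfolding \<Psi>_def by (rule Bcontfun_inverse[OF FB]) simp
  have "dist (\<Psi> v) (\<Psi> v') \<le> 1/2 * dist v v'" for v v'
  proof (rule dist_bound, unfold \<Psi>)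
    fix t
    define m where "m = max s t"
    have "s \<le> m" by (simp add: m_def)
    let ?d = "dist v v'"
    have "norm (h v r - h v' r) \<le> (L * ?d) * exp (k * (r - s))" if "r \<in> {s..m}" for r
    proof -
      have "norm (h v r - h v' r) \<le> L * norm (E v r - E v' r)"
        unfolding h_def using that s \<alpha> w by (intro lipschitz control_in) auto
      also have "E v r - E v' r = exp (k * (r - s)) *\<^sub>R (v r - v' r)"
        by (simp add: E_def algebra_simps)
      also have "L * norm \<dots> \<le> L * (exp (k * (r - s)) * ?d)"
        using dist_bounded[of v r v'] L_pos by (simp add: dist_norm)
      finally show ?thesis by (simp add: mult_ac)
    qed
    moreover have "((\<lambda>r. (L * ?d) * exp (k * (r - s))) has_integral
        ((L * ?d) * ((exp (k * (m - s)) - 1) / k))) {s..m}"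
      using \<open>s \<le> m\<close> k by (intro has_integral_mult_right has_integral_exp_shift) auto
    moreover have "(\<lambda>r. h v r - h v' r) integrable_on {s..m}"
      by (intro integrable_diff hint) auto
    ultimately have "norm (integral {s..m} (\<lambda>r. h v r - h v' r)) \<le> (L * ?d) * ((exp (k * (m - s)) - 1) / k)"
      by (metis (no_types, lifting) has_integral_iff integral_norm_bound_integral)
    also have "integral {s..m} (\<lambda>r. h v r - h v' r) = G v t - G v' t"
      unfolding G_def m_def[symmetric] by (intro integral_diff hint) auto
    also have "(L * ?d) * ((exp (k * (m - s)) - 1) / k) = ?d / 2 * (exp (k * (m - s)) - 1)"
      using L_pos by (simp add: k_def field_simps)
    also have "\<dots> \<le> ?d / 2 * exp (k * (m - s))" by (intro mult_left_mono) auto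
    finally have "norm (G v t - G v' t) \<le> ?d / 2 * exp (k * (m - s))" .
    then have "exp (- k * (m - s)) * norm (G v t - G v' t) \<le> exp (- k * (m - s)) * (?d / 2 * exp (k * (m - s)))"
      by (intro mult_left_mono) auto
    also have "\<dots> = ?d / 2" by (simp add: exp_minus)
    finally show "dist (F v t) (F v' t) \<le> 1/2 * ?d"
      by (simp add: F_def m_def dist_norm flip: scaleR_diff_right)
  qed
  then obtain v where v: "\<Psi> v = v" using banach_fix_type[of "1/2" \<Psi>] by auto
  define \<xi> where "\<xi> = E v"
  have \<xi>: "\<xi> t = x + integral {s..t} (h v)" if "s \<le> t" for t
  proof -
    have "v t = exp (- k * (t - s)) *\<^sub>R integral {s..t} (h v)"
      using fun_cong[OF \<Psi>[of v, unfolded v], of t] that by (simp add: F_def G_def max_absorb2)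
    then show ?thesis by (simp add: \<xi>_def E_def exp_minus)
  qed
  have "solves (\<lambda>_. w) \<alpha> s T \<xi>" for T
    unfolding solves_def
  proof
    fix t assume t: "t \<in> {s..T}"
    have "(h v has_integral integral {s..t} (h v)) {s..t}"
      by (intro integrable_integral hint) simp
    moreover have "h v = (\<lambda>r. f (\<xi> r) w (\<alpha> r))" by (auto simp: h_def \<xi>_def)
    moreover have "\<xi> t - \<xi> s = integral {s..t} (h v)" using \<xi>[of t] \<xi>[of s] t by simp
    ultimately show "((\<lambda>r. f (\<xi> r) w (\<alpha> r)) has_integral (\<xi> t - \<xi> s)) {s..t}" by simp
  qed
  moreover have "\<xi> s = x" using \<xi>[of s] by simp
  ultimately show ?thesis using mode_solution_iff_solves[OF \<alpha> s w] by blast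
qed

end

section \<open>Trajectories with delayed switching\<close>

lemma controls_shift:
  assumes "\<alpha> \<in> controls A" "0 \<le> s" shows "(\<lambda>t. \<alpha> (s + t)) \<in> controls A"
proof -
  have "(\<lambda>t. s + t) \<in> lebesgue \<rightarrow>\<^sub>M lebesgue"
    using lebesgue_affine_measurable[of "\<lambda>_. 1" s] by simp
  then have "(\<lambda>t. s + t) \<in> lebesgue_on {0..} \<rightarrow>\<^sub>M lebesgue_on {0..}"
    using assms(2) by (intro measurable_restrict_space3) auto
  then have "(\<lambda>t. \<alpha> (s + t)) \<in> borel_measurable (lebesgue_on {0..})"
    using assms(1) unfolding controls_def by (auto intro: measurable_compose)
  then show ?thesis using assms by (simp add: controls_def)
qed

lemma aeq_shift: "aeq T u v \<Longrightarrow> 0 \<le> s \<Longrightarrow> aeq (T - s) (\<lambda>t. u (s + t)) (\<lambda>t. v (s + t))"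
proof -
  assume "aeq T u v" "0 \<le> s"
  then obtain N where N: "negligible N" and "\<And>t. t \<in> {0..T} - N \<Longrightarrow> u t = v t" by (auto simp: aeq_def)
  moreover have "s + t \<notin> N" if "t \<notin> (+) (- s) ` N" for t
    using that by (metis add_minus_cancel image_eqI minus_minus)
  ultimately have "\<forall>t\<in>{0..T - s} - (+) (- s) ` N. u (s + t) = v (s + t)"
    using \<open>0 \<le> s\<close> by auto
  then show ?thesis unfolding aeq_def using negligible_translation[OF N] by blast
qed

context player begin

text \<open>The signed distance to the threshold at which mode \<open>w\<close> is left.\<close>

definition depth :: "int \<Rightarrow> 'x \<Rightarrow> real" where
  "depth w x = of_int w * (x \<bullet> e - \<rho> (- w))"

definition gap :: real where "gap = \<rho> 1 - \<rho> (-1)"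

lemma gap_pos: "0 < gap" using thresholds by (simp add: gap_def)

lemma e_norm: "norm e = 1" and e_nonzero: "e \<noteq> 0"
  using basis nonzero_Basis by auto

lemma closure_sector: "w \<in> {-1, 1} \<Longrightarrow> closure (sector e \<rho> w) = {x. 0 \<le> depth w x}"
  using closure_halfspace_gt[OF e_nonzero, of "\<rho> (-1)"] closure_halfspace_lt[OF e_nonzero, of "\<rho> 1"]
  by (auto simp: sector_def depth_def inner_commute)

lemma frontier_sector: "w \<in> {-1, 1} \<Longrightarrow> frontier (sector e \<rho> w) = {x. depth w x = 0}"
  using frontier_halfspace_gt[of e "\<rho> (-1)"] frontier_halfspace_lt[of e "\<rho> 1"] e_nonzero
  by (auto simp: sector_def depth_def inner_commute)

lemma depth_flip: "w \<in> {-1, 1} \<Longrightarrow> depth (- w) x = gap - depth w x"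
  by (auto simp: depth_def gap_def)

lemma depth_diff: "w \<in> {-1, 1} \<Longrightarrow> depth w x - depth w y = of_int w * ((x - y) \<bullet> e)"
  by (auto simp: depth_def inner_diff_left)

lemma depth_lipschitz:
  assumes "w \<in> {-1, 1}" shows "\<bar>depth w x - depth w y\<bar> \<le> norm (x - y)"
proof -
  have "\<bar>depth w x - depth w y\<bar> = \<bar>(x - y) \<bullet> e\<bar>" using assms by (auto simp: depth_diff)
  also have "\<dots> \<le> norm (x - y)" using Cauchy_Schwarz_ineq2[of "x - y" e] by (simp add: e_norm)
  finally show ?thesis .
qed

text \<open>
  \<open>\<xi>\<close> is the motion that keeps the mode \<open>w\<close>; the mode changes to \<open>- w\<close> just after \<open>\<tau>\<close>, which is
  the first exit time of \<open>\<xi>\<close> unless \<open>\<tau> = T\<close>, in which case there is no switching before \<open>T\<close>.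
\<close>

definition switches_at ::
  "int \<Rightarrow> (real \<Rightarrow> 'x) \<Rightarrow> (real \<Rightarrow> int) \<Rightarrow> (real \<Rightarrow> 'x) \<Rightarrow> real \<Rightarrow> real \<Rightarrow> real \<Rightarrow> bool" where
  "switches_at w X W \<xi> s T \<tau> \<longleftrightarrow> s \<le> \<tau> \<and> \<tau> \<le> T \<and>
     (\<forall>t\<in>{s..\<tau>}. X t = \<xi> t \<and> W t = w \<and> 0 \<le> depth w (\<xi> t)) \<and> (\<forall>t\<in>{\<tau><..T}. W t = - w) \<and>
     (\<tau> < T \<longrightarrow> depth w (\<xi> \<tau>) = 0 \<and> (\<forall>\<eta>. \<tau> < \<eta> \<longrightarrow> \<eta> \<le> T \<longrightarrow> (\<exists>t\<in>{\<tau><..<\<eta>}. depth w (\<xi> t) < 0)))"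

lemma switches_atD:
  assumes "switches_at w X W \<xi> s T \<tau>"
  shows "s \<le> \<tau>" "\<tau> \<le> T" "\<And>t. s \<le> t \<Longrightarrow> t \<le> \<tau> \<Longrightarrow> X t = \<xi> t \<and> W t = w \<and> 0 \<le> depth w (\<xi> t)"
    "\<And>t. \<tau> < t \<Longrightarrow> t \<le> T \<Longrightarrow> W t = - w" "\<tau> < T \<Longrightarrow> depth w (\<xi> \<tau>) = 0"
    "\<And>\<eta>. \<tau> < T \<Longrightarrow> \<tau> < \<eta> \<Longrightarrow> \<eta> \<le> T \<Longrightarrow> \<exists>t\<in>{\<tau><..<\<eta>}. depth w (\<xi> t) < 0"
  using assms by (simp_all add: switches_at_def)

text \<open>
  A description of the switching trajectories that is invariant under time shifts: on any time
  interval too short for crossing the gap between the thresholds there is at most one switching.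
\<close>

definition hybrid :: "(real \<Rightarrow> 'a) \<Rightarrow> (real \<Rightarrow> 'x) \<Rightarrow> (real \<Rightarrow> int) \<Rightarrow> bool" where
  "hybrid \<alpha> X W \<longleftrightarrow> (\<forall>t\<ge>0. W t \<in> {-1, 1} \<and> 0 \<le> depth (W t) (X t)) \<and> (\<forall>T. solves W \<alpha> 0 T X) \<and>
     (\<forall>s\<ge>0. \<forall>H>0. \<forall>\<xi>. M * H < gap \<longrightarrow> solves (\<lambda>_. W s) \<alpha> s (s + H) \<xi> \<longrightarrow> \<xi> s = X s \<longrightarrow>
        (\<exists>\<tau>. switches_at (W s) X W \<xi> s (s + H) \<tau>))"

lemma depth_speed:
  assumes "\<alpha> \<in> controls A" "0 \<le> s" "v \<in> {-1, 1}" "\<And>T. solves (\<lambda>_. v) \<alpha> s T \<xi>" "s \<le> t" "t \<le> t'" "w \<in> {-1, 1}"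
  shows "\<bar>depth w (\<xi> t') - depth w (\<xi> t)\<bar> \<le> M * (t' - t)"
  using depth_lipschitz[OF assms(7), of "\<xi> t'" "\<xi> t"] solves_speed[OF assms(4,5,6) order_refl assms(2,1)] assms(3)
  by auto

lemma exit_time_facts:
  assumes \<alpha>: "\<alpha> \<in> controls A" and s: "0 \<le> s" and w: "w \<in> {-1, 1}"
    and sol: "\<And>T. solves (\<lambda>_. w) \<alpha> s T \<xi>" and dep: "0 \<le> depth w (\<xi> s)"
  defines "E \<equiv> exit_time (closure (sector e \<rho> w)) s \<xi>"
  shows "ereal s \<le> E" "\<And>t. s \<le> t \<Longrightarrow> ereal t \<le> E \<Longrightarrow> 0 \<le> depth w (\<xi> t)"
    "\<And>\<tau>. E = ereal \<tau> \<Longrightarrow> depth w (\<xi> \<tau>) = 0"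
    "\<And>\<tau> \<eta>. E = ereal \<tau> \<Longrightarrow> \<tau> < \<eta> \<Longrightarrow> \<exists>t\<in>{\<tau><..<\<eta>}. depth w (\<xi> t) < 0"
    "ereal (s + depth w (\<xi> s) / M) \<le> E"
proof -
  define S where "S = {t. s \<le> t \<and> depth w (\<xi> t) < 0}"
  have E: "E = Inf (ereal ` S)"
    unfolding E_def exit_time_def S_def closure_sector[OF w] by (simp add: not_le)
  note lip = depth_speed[OF \<alpha> s w sol _ _ w]
  show s_E: "ereal s \<le> E" unfolding E by (rule Inf_greatest) (auto simp: S_def)
  have before: "0 \<le> depth w (\<xi> t)" if "s \<le> t" "ereal t < E" for t
  proof (rule ccontr)
    assume "\<not> ?thesis"
    then have "E \<le> ereal t" unfolding E using that(1) by (intro Inf_lower) (auto simp: S_def)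
    with that(2) show False by simp
  qed
  show in_sector: "0 \<le> depth w (\<xi> t)" if t: "s \<le> t" "ereal t \<le> E" for t
  proof (rule ccontr)
    assume neg: "\<not> ?thesis"
    then have "s < t" using dep t by (cases "s = t") auto
    define t0 where "t0 = max s (t + depth w (\<xi> t) / (2 * M))"
    have t0: "s \<le> t0" "t0 < t" using neg \<open>s < t\<close> M_pos by (auto simp: t0_def divide_neg_pos)
    then have "0 \<le> depth w (\<xi> t0)" using t less_le_trans[of "ereal t0" "ereal t" E] by (intro before) auto
    moreover have "M * (t - t0) \<le> - depth w (\<xi> t) / 2"
    proof -
      have "t - t0 \<le> - depth w (\<xi> t) / (2 * M)" by (simp add: t0_def)
      then have "M * (t - t0) \<le> M * (- depth w (\<xi> t) / (2 * M))" using M_pos by (intro mult_left_mono) auto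
      then show ?thesis using M_pos by simp
    qed
    ultimately show False using lip[of t0 t] t0 neg by auto
  qed
  show exits: "\<exists>t\<in>{\<tau><..<\<eta>}. depth w (\<xi> t) < 0" if "E = ereal \<tau>" "\<tau> < \<eta>" for \<tau> \<eta>
  proof -
    have "Inf (ereal ` S) < ereal \<eta>" using that E by simp
    then obtain t where t: "t \<in> S" "t < \<eta>" unfolding Inf_less_iff by auto
    have "E \<le> ereal t" unfolding E using t by (intro Inf_lower) auto
    then have "\<tau> \<le> t" using that by simp
    moreover have "\<tau> \<noteq> t" using in_sector[of \<tau>] t that by (auto simp: S_def)
    ultimately show ?thesis using t by (auto simp: S_def)
  qed
  show "depth w (\<xi> \<tau>) = 0" if \<tau>: "E = ereal \<tau>" for \<tau>
  proof (rule ccontr)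
    assume "depth w (\<xi> \<tau>) \<noteq> 0"
    moreover have "s \<le> \<tau>" using s_E \<tau> by simp
    ultimately have pos: "0 < depth w (\<xi> \<tau>)" using in_sector[of \<tau>] \<tau> by auto
    with exits[OF \<tau>, of "\<tau> + depth w (\<xi> \<tau>) / M"] M_pos
    obtain t where t: "\<tau> < t" "t < \<tau> + depth w (\<xi> \<tau>) / M" "depth w (\<xi> t) < 0" by auto
    then have "M * (t - \<tau>) < depth w (\<xi> \<tau>)" using M_pos by (simp add: field_simps)
    then show False using lip[of \<tau> t] t \<open>s \<le> \<tau>\<close> by auto
  qed
  show "ereal (s + depth w (\<xi> s) / M) \<le> E"
    unfolding E
  proof (rule Inf_greatest)
    fix z assume "z \<in> ereal ` S"
    then obtain t where t: "z = ereal t" "s \<le> t" "depth w (\<xi> t) < 0" by (auto simp: S_def)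
    have "depth w (\<xi> s) \<le> M * (t - s)" using lip[of s t] t by auto
    then show "ereal (s + depth w (\<xi> s) / M) \<le> z" using M_pos t by (simp add: field_simps)
  qed
qed

lemma solves_unique:
  assumes "solves W \<alpha> s T X" "solves W \<alpha> s T X'" "0 \<le> s" "\<alpha> \<in> controls A"
    "\<And>t. t \<in> {s..T} \<Longrightarrow> W t \<in> {-1, 1}" "X s = X' s" "t \<in> {s..T}"
  shows "X t = X' t"
  using solves_stability[OF assms(1,2,3,4,4,5) negligible_empty _ assms(7)] assms(6) by simp

lemma mode_exists:
  assumes "\<alpha> \<in> controls A" "0 \<le> s" "w \<in> {-1, 1}"
  obtains \<xi> where "\<xi> s = x" "\<And>T. solves (\<lambda>_. w) \<alpha> s T \<xi>"
  using mode_solution_exists[OF assms] mode_solution_iff_solves[OF assms] by metis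

lemma power_mode: "w \<in> {-1, 1} \<Longrightarrow> (-1) ^ k * w \<in> {-1, 1 :: int}"
  by (cases "even k") auto

text \<open>
  On \<open>[s, s + H]\<close> at most one switching instant of the given sequence is met: the next one comes a time
  \<open>gap / M\<close> later, since the trajectory has to cross the gap.
\<close>

lemma switching_trajectory_hybrid:
  assumes tr: "switching_trajectory f e \<rho> x w \<alpha> X W" and \<alpha>: "\<alpha> \<in> controls A" and w: "w \<in> {-1, 1}"
  shows "hybrid \<alpha> X W" "X 0 = x" "W 0 = w"
proof -
  define v where "v k = (-1) ^ k * w" for k :: nat
  have v: "v k \<in> {-1, 1}" for k unfolding v_def by (rule power_mode[OF w])
  have v_Suc: "v (Suc k) = - v k" for k by (simp add: v_def)
  have contX: "continuous_on {0..} X" and W: "\<And>t. 0 \<le> t \<Longrightarrow> W t \<in> {-1, 1}" and W0: "W 0 = w"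
    and X: "\<And>t. 0 \<le> t \<Longrightarrow> X t = x + (LINT s:{0..t}|lebesgue. f (X s) (W s) (\<alpha> s))"
    and "\<And>t. 0 \<le> t \<Longrightarrow> X t \<in> closure (sector e \<rho> (W t))"
    using tr unfolding switching_trajectory_def by auto
  then have dep: "0 \<le> depth (W t) (X t)" if "0 \<le> t" for t
    using that closure_sector[OF W] by auto
  from tr obtain \<tau> :: "nat \<Rightarrow> ereal" where \<tau>0: "\<tau> 0 = 0" and inc: "incseq \<tau>" and lim: "\<tau> \<longlonglongrightarrow> \<infinity>"
    and \<tau>: "\<And>k s. \<tau> k = ereal s \<Longrightarrow> (\<exists>\<xi>. mode_solution f (v k) \<alpha> s (X s) \<xi> \<and>
                \<tau> (Suc k) = exit_time (closure (sector e \<rho> (v k))) s \<xi>) \<and>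
           (\<forall>t. s < t \<and> ereal t \<le> \<tau> (Suc k) \<longrightarrow> W t = v k)"
    unfolding switching_trajectory_def v_def by blast
  have W_on: "W t = v k" if "\<tau> k < ereal t" "ereal t \<le> \<tau> (Suc k)" for k t
  proof -
    have "\<tau> 0 \<le> \<tau> k" using inc by (simp add: incseqD)
    with that \<tau>0 obtain s where "\<tau> k = ereal s" by (cases "\<tau> k") auto
    with \<tau>[of k s] that show ?thesis by auto
  qed
  have piece: "\<exists>k. \<tau> k < ereal t \<and> ereal t \<le> \<tau> (Suc k)" if "0 < t" for t
  proof -
    from lim have "\<forall>\<^sub>F k in sequentially. ereal t < \<tau> k" by (simp add: Lim_PInfty tendsto_PInfty)
    then obtain k0 where "ereal t \<le> \<tau> k0" by (auto simp: eventually_sequentially intro: less_imp_le)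
    then have ex: "\<exists>k. ereal t \<le> \<tau> k" by blast
    define j where "j = (LEAST k. ereal t \<le> \<tau> k)"
    have j: "ereal t \<le> \<tau> j" unfolding j_def by (rule LeastI_ex[OF ex])
    with that \<tau>0 obtain k where k: "j = Suc k" by (cases j) auto
    then have "\<not> ereal t \<le> \<tau> k" unfolding j_def using not_less_Least[of k "\<lambda>k. ereal t \<le> \<tau> k"] by auto
    with j k show ?thesis by (auto simp: not_le)
  qed
  have measW: "{t \<in> {0..T}. W t = 1} \<in> sets lebesgue" for T
  proof -
    define U where "U k = {t \<in> {0<..T}. \<tau> k < ereal t \<and> ereal t \<le> \<tau> (Suc k)}" for k
    have "U k \<in> sets borel" for k unfolding U_def by measurable
    then have un: "(\<Union>k\<in>{k. v k = 1}. U k) \<in> sets lebesgue" by (auto intro!: sets.countable_UN')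
    have eq: "{t \<in> {0..T}. W t = 1} = {t \<in> {0} \<inter> {0..T}. W t = 1} \<union> (\<Union>k\<in>{k. v k = 1}. U k)"
    proof (intro set_eqI iffI)
      fix t assume t: "t \<in> {t \<in> {0..T}. W t = 1}"
      show "t \<in> {t \<in> {0} \<inter> {0..T}. W t = 1} \<union> (\<Union>k\<in>{k. v k = 1}. U k)"
      proof (cases "t = 0")
        case False
        with t piece[of t] obtain k where "\<tau> k < ereal t" "ereal t \<le> \<tau> (Suc k)" by auto
        with W_on[OF this] t False show ?thesis by (auto simp: U_def)
      qed (use t in auto)
    qed (auto simp: U_def dest: W_on)
    have "{t \<in> {0} \<inter> {0..T}. W t = 1} \<in> sets lebesgue"
      by (rule negligible_imp_sets[OF negligible_subset[OF negligible_sing[of 0]]]) auto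
    then show ?thesis unfolding eq using un by (rule sets.Un)
  qed
  have int: "((\<lambda>r. f (X r) (W r) (\<alpha> r)) has_integral (X t - x)) {0..t}" if "0 \<le> t" for t
  proof -
    have cX: "continuous_on {0..t} X" by (rule continuous_on_subset[OF contX]) auto
    have mX: "X \<in> borel_measurable (lebesgue_on {0..t})"
      using cX by (intro continuous_imp_measurable_on_sets_lebesgue) auto
    have "{r \<in> space (lebesgue_on {0..t}). W r = 1} \<in> sets (lebesgue_on {0..t})"
      using measW[of t] by (auto simp: sets_restrict_space_iff)
    then have "(\<lambda>r. if W r = 1 then f (X r) 1 (\<alpha> r) else f (X r) (-1) (\<alpha> r)) \<in> borel_measurable (lebesgue_on {0..t})"
      using field_measurable[OF \<alpha> _ _ mX] by (intro measurable_If) auto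
    also have "?this \<longleftrightarrow> (\<lambda>r. f (X r) (W r) (\<alpha> r)) \<in> borel_measurable (lebesgue_on {0..t})"
      by (rule measurable_cong) (use W in force)
    finally have "(\<lambda>r. f (X r) (W r) (\<alpha> r)) absolutely_integrable_on {0..t}"
      using integrable_const_ivl[of M 0 t] \<alpha> W speed
      by (intro measurable_bounded_by_integrable_imp_absolutely_integrable[where g="\<lambda>_. M"])
        (auto simp: controls_def)
    from has_integral_set_lebesgue[OF this] show ?thesis
      using X[OF \<open>0 \<le> t\<close>] by simp
  qed
  show X0: "X 0 = x"
    using has_integral_norm_le[OF int[of 0], of M] \<alpha> W[of 0] speed M_pos by (auto simp: controls_def)
  have solvesX: "solves W \<alpha> 0 T X" for T
    unfolding solves_def using int X0 by auto
  show "W 0 = w" by (rule W0)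
  have "\<exists>\<tau>'. switches_at (W s) X W \<xi> s (s + H) \<tau>'"
    if s: "0 \<le> s" and H: "0 < H" "M * H < gap" and \<xi>: "solves (\<lambda>_. W s) \<alpha> s (s + H) \<xi>" "\<xi> s = X s" for s H \<xi>
  proof -
    obtain k \<sigma> where k: "W s = v k" "\<tau> k = ereal \<sigma>" "0 \<le> \<sigma>" "\<sigma> \<le> s" "ereal s \<le> \<tau> (Suc k)"
    proof (cases "s = 0")
      case True
      have "0 \<le> \<tau> (Suc 0)" using incseqD[OF inc, of 0 "Suc 0"] \<tau>0 by simp
      then show ?thesis using that[of 0 0] True W0 \<tau>0 by (simp add: v_def zero_ereal_def)
    next
      case False
      with s piece[of s] obtain k where k: "\<tau> k < ereal s" "ereal s \<le> \<tau> (Suc k)" by auto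
      have "0 \<le> \<tau> k" using incseqD[OF inc, of 0 k] \<tau>0 by simp
      with k obtain \<sigma> where "\<tau> k = ereal \<sigma>" "0 \<le> \<sigma>" by (cases "\<tau> k") auto
      with that[of k \<sigma>] k W_on[OF k] show ?thesis by simp
    qed
    from \<tau>[OF k(2)] obtain \<xi>k where "mode_solution f (v k) \<alpha> \<sigma> (X \<sigma>) \<xi>k"
      and exit: "\<tau> (Suc k) = exit_time (closure (sector e \<rho> (v k))) \<sigma> \<xi>k"
      and Wk: "\<And>t. \<sigma> < t \<Longrightarrow> ereal t \<le> \<tau> (Suc k) \<Longrightarrow> W t = v k" by blast
    then have \<xi>k: "\<xi>k \<sigma> = X \<sigma>" and sol: "\<And>T. solves (\<lambda>_. v k) \<alpha> \<sigma> T \<xi>k"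
      using mode_solution_iff_solves[OF \<alpha> k(3) v] by auto
    have dep\<sigma>: "0 \<le> depth (v k) (\<xi>k \<sigma>)"
    proof (cases "k = 0")
      case True
      then show ?thesis using k(2) \<tau>0 dep[of 0] W0 \<xi>k by (simp add: v_def zero_ereal_def)
    next
      case False
      show ?thesis
      proof (cases "\<sigma> = s")
        case True
        then show ?thesis using dep[of s] k \<xi>k by simp
      next
        case False
        \<comment> \<open>No exit can have happened at \<open>\<sigma>\<close> itself, as the next exit comes later than \<open>\<sigma> < s\<close>.\<close>
        show ?thesis
        proof (rule ccontr)
          assume "\<not> ?thesis"
          then have "\<xi>k \<sigma> \<notin> closure (sector e \<rho> (v k))" using closure_sector[OF v] by auto
          then have "\<tau> (Suc k) \<le> ereal \<sigma>"
            unfolding exit exit_time_def by (intro Inf_lower) auto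
          with k(5) have "s \<le> \<sigma>" by (metis ereal_less_eq(3) order_trans)
          with False k(4) show False by simp
        qed
      qed
    qed
    note exitf = exit_time_facts[OF \<alpha> k(3) v sol dep\<sigma>, folded exit]
    have X_\<xi>k: "X t = \<xi>k t" if t: "\<sigma> \<le> t" "ereal t \<le> \<tau> (Suc k)" for t
    proof (rule solves_unique[where W="\<lambda>_. v k" and \<alpha>=\<alpha> and s=\<sigma> and T=t])
      show "solves (\<lambda>_. v k) \<alpha> \<sigma> t X"
      proof (rule solves_cong[OF solves_sub[OF solvesX[of t] k(3) order_refl] negligible_sing[of \<sigma>]])
        fix r assume "r \<in> {\<sigma>..t} - {\<sigma>}"
        then show "W r = v k \<and> \<alpha> r = \<alpha> r"
          using Wk[of r] t(2) order_trans[of "ereal r" "ereal t" "\<tau> (Suc k)"] by auto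
      qed simp
    qed (use sol k \<alpha> v \<xi>k t in auto)
    have \<xi>_\<xi>k: "\<xi> t = \<xi>k t" if t: "t \<in> {s..s + H}" for t
    proof (rule solves_unique[where W="\<lambda>_. v k" and \<alpha>=\<alpha> and s=s and T="s + H"])
      show "solves (\<lambda>_. v k) \<alpha> s (s + H) \<xi>" using \<xi>(1) k(1) by simp
      show "solves (\<lambda>_. v k) \<alpha> s (s + H) \<xi>k" by (rule solves_sub[OF sol k(4) order_refl])
      show "\<xi> s = \<xi>k s" using \<xi>(2) X_\<xi>k[OF k(4,5)] by simp
    qed (use s \<alpha> v t in auto)
    have W_upto: "W t = v k" if "s \<le> t" "ereal t \<le> \<tau> (Suc k)" for t
      using Wk[of t] that k by (cases "\<sigma> = t") auto
    show ?thesis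
    proof (cases "ereal (s + H) \<le> \<tau> (Suc k)")
      case True
      have "switches_at (W s) X W \<xi> s (s + H) (s + H)"
        unfolding switches_at_def
      proof (intro conjI ballI impI)
        fix t assume t: "t \<in> {s..s + H}"
        then have "ereal t \<le> ereal (s + H)" by simp
        then have tk: "ereal t \<le> \<tau> (Suc k)" using True by (rule order_trans)
        show "X t = \<xi> t" using X_\<xi>k[of t] \<xi>_\<xi>k[OF t] tk t k by auto
        show "W t = W s" using W_upto[of t] tk t k by auto
        show "0 \<le> depth (W s) (\<xi> t)" using exitf(2)[of t] \<xi>_\<xi>k[OF t] tk t k by auto
      qed (use H in auto)
      then show ?thesis by blast
    next
      case False
      then obtain \<tau>' where \<tau>': "\<tau> (Suc k) = ereal \<tau>'" using k(5) by (cases "\<tau> (Suc k)") auto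
      have le: "s \<le> \<tau>'" "\<tau>' < s + H" using False k(5) \<tau>' by auto
      have zero: "depth (v k) (\<xi>k \<tau>') = 0" by (rule exitf(3)[OF \<tau>'])
      have X\<tau>': "X \<tau>' = \<xi>k \<tau>'" using X_\<xi>k[of \<tau>'] le k \<tau>' by auto
      have "0 \<le> \<tau>'" using le s by simp
      from \<tau>[OF \<tau>'] obtain \<xi>' where "mode_solution f (v (Suc k)) \<alpha> \<tau>' (X \<tau>') \<xi>'"
        and exit': "\<tau> (Suc (Suc k)) = exit_time (closure (sector e \<rho> (v (Suc k)))) \<tau>' \<xi>'" by blast
      then have \<xi>': "\<xi>' \<tau>' = X \<tau>'" "\<And>T. solves (\<lambda>_. v (Suc k)) \<alpha> \<tau>' T \<xi>'"
        using mode_solution_iff_solves[OF \<alpha> \<open>0 \<le> \<tau>'\<close> v] by auto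
      have full: "depth (v (Suc k)) (\<xi>' \<tau>') = gap"
        using zero \<xi>' X\<tau>' depth_flip[OF v, of k] by (simp add: v_Suc)
      have "ereal (\<tau>' + gap / M) \<le> \<tau> (Suc (Suc k))"
        using exit_time_facts(5)[OF \<alpha> \<open>0 \<le> \<tau>'\<close> v \<xi>'(2)] full gap_pos unfolding exit' by auto
      moreover have "H < gap / M" using H M_pos by (simp add: field_simps)
      then have "ereal (s + H) \<le> ereal (\<tau>' + gap / M)" using le by simp
      ultimately have late: "ereal (s + H) \<le> \<tau> (Suc (Suc k))" by (rule order_trans[rotated])
      have "switches_at (W s) X W \<xi> s (s + H) \<tau>'"
        unfolding switches_at_def
      proof (intro conjI ballI impI allI)
        show "s \<le> \<tau>'" "\<tau>' \<le> s + H" using le by auto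
        fix t assume t: "t \<in> {s..\<tau>'}"
        then have t': "t \<in> {s..s + H}" "ereal t \<le> \<tau> (Suc k)" using le \<tau>' by auto
        show "X t = \<xi> t" using X_\<xi>k[of t] \<xi>_\<xi>k[of t] t' k by auto
        show "W t = W s" using W_upto[of t] t' k by auto
        show "0 \<le> depth (W s) (\<xi> t)" using exitf(2)[of t] \<xi>_\<xi>k[of t] t' k by auto
      next
        fix t assume t: "t \<in> {\<tau>'<..s + H}"
        then have "ereal t \<le> ereal (s + H)" by simp
        then have "ereal t \<le> \<tau> (Suc (Suc k))" using late by (rule order_trans)
        with W_on[of "Suc k" t] t \<tau>' k show "W t = - W s" by (simp add: v_Suc)
      next
        show "depth (W s) (\<xi> \<tau>') = 0" using zero \<xi>_\<xi>k[of \<tau>'] le k by auto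
      next
        fix \<eta> assume \<eta>: "\<tau>' < \<eta>" "\<eta> \<le> s + H"
        from exitf(4)[OF \<tau>' this(1)] obtain t where t: "t \<in> {\<tau>'<..<\<eta>}" "depth (v k) (\<xi>k t) < 0" by blast
        with \<xi>_\<xi>k[of t] \<eta> le k show "\<exists>t\<in>{\<tau>'<..<\<eta>}. depth (W s) (\<xi> t) < 0" by (intro bexI[of _ t]) auto
      qed
      then show ?thesis by blast
    qed
  qed
  then show "hybrid \<alpha> X W" using W dep solvesX unfolding hybrid_def by auto
qed

text \<open>
  The pieces between consecutive exit times are glued. The switching times diverge because of the
  dwell time \<open>gap / M\<close>; only the first switching may be immediate.
\<close>

lemma switching_trajectory_exists:
  assumes \<alpha>: "\<alpha> \<in> controls A" and w: "w \<in> {-1, 1}" and x: "0 \<le> depth w x"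
  shows "\<exists>X W. switching_trajectory f e \<rho> x w \<alpha> X W"
proof -
  define v where "v k = (-1) ^ k * w" for k :: nat
  have v: "v k \<in> {-1, 1}" for k unfolding v_def by (rule power_mode[OF w])
  have v_Suc: "v (Suc k) = - v k" and v_0: "v 0 = w" for k by (simp_all add: v_def)
  define sol where "sol k s p = (SOME \<xi>. mode_solution f (v k) \<alpha> s p \<xi>)" for k s p
  define C where "C k = closure (sector e \<rho> (v k))" for k
  define nxt where "nxt k z = (if fst z = \<infinity> then z else
      let \<xi> = sol k (real_of_ereal (fst z)) (snd z); E = exit_time (C k) (real_of_ereal (fst z)) \<xi>
      in (E, \<xi> (real_of_ereal E)))" for k and z :: "ereal \<times> 'x"
  define st where "st = rec_nat (0, x) nxt"
  define \<tau> where "\<tau> k = fst (st k)" for k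
  define p where "p k = snd (st k)" for k
  define \<xi> where "\<xi> k = sol k (real_of_ereal (\<tau> k)) (p k)" for k
  have st_Suc: "st (Suc k) = nxt k (st k)" and st_0: "st 0 = (0, x)" for k by (simp_all add: st_def)
  have \<tau>0: "\<tau> 0 = 0" and p0: "p 0 = x" by (simp_all add: \<tau>_def p_def st_0)
  have sol: "mode_solution f (v k) \<alpha> s q (sol k s q)" if "0 \<le> s" for k s q
    unfolding sol_def by (rule someI_ex[OF mode_solution_exists[OF \<alpha> that v]])
  have \<tau>_inf: "\<tau> (Suc k) = \<infinity>" if "\<tau> k = \<infinity>" for k
    using that by (simp add: \<tau>_def st_Suc nxt_def)
  have \<tau>_fin: "\<tau> (Suc k) = exit_time (C k) s (\<xi> k)" "p (Suc k) = \<xi> k (real_of_ereal (\<tau> (Suc k)))"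
    if "\<tau> k = ereal s" for k s
    using that by (simp_all add: \<tau>_def p_def st_Suc nxt_def \<xi>_def Let_def)
  have \<xi>: "\<xi> k s = p k" "\<And>T. solves (\<lambda>_. v k) \<alpha> s T (\<xi> k)" "mode_solution f (v k) \<alpha> s (p k) (\<xi> k)"
    if "\<tau> k = ereal s" "0 \<le> s" for k s
  proof -
    show m: "mode_solution f (v k) \<alpha> s (p k) (\<xi> k)"
      using sol[OF that(2)] that by (simp add: \<xi>_def)
    show "\<xi> k s = p k" "\<And>T. solves (\<lambda>_. v k) \<alpha> s T (\<xi> k)"
      using m mode_solution_iff_solves[OF \<alpha> that(2) v] by auto
  qed
  \<comment> \<open>After the first switching the thresholds are a full gap apart, so \<open>gap / M\<close> is a dwell time.\<close>
  have inv: "0 \<le> \<tau> k \<and> (\<forall>s. \<tau> k = ereal s \<longrightarrow> 0 \<le> depth (v k) (p k) \<and> (k > 0 \<longrightarrow> depth (v k) (p k) = gap))" for k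
  proof (induction k)
    case 0
    then show ?case using x by (simp add: \<tau>0 p0 v_0)
  next
    case (Suc k)
    show ?case
    proof (cases "\<tau> k")
      case (real s)
      then have "0 \<le> s" using Suc by simp
      note fin = \<tau>_fin[OF real] and \<xi>' = \<xi>[OF real \<open>0 \<le> s\<close>]
      have "0 \<le> depth (v k) (\<xi> k s)" using Suc real \<xi>' by simp
      note ex = exit_time_facts[OF \<alpha> \<open>0 \<le> s\<close> v \<xi>'(2) this, folded C_def, folded fin(1)]
      have "0 \<le> \<tau> (Suc k)" using ex(1) \<open>0 \<le> s\<close> by (metis ereal_less_eq(5) order_trans)
      moreover have "depth (v (Suc k)) (p (Suc k)) = gap" if "\<tau> (Suc k) = ereal t" for t
        using ex(3)[OF that] fin(2) that depth_flip[OF v, of k] by (simp add: v_Suc)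
      ultimately show ?thesis using gap_pos by auto
    qed (use Suc \<tau>_inf in auto)
  qed
  have ex: "ereal s \<le> \<tau> (Suc k)" "\<And>t. s \<le> t \<Longrightarrow> ereal t \<le> \<tau> (Suc k) \<Longrightarrow> 0 \<le> depth (v k) (\<xi> k t)"
    "ereal (s + depth (v k) (p k) / M) \<le> \<tau> (Suc k)" "0 \<le> s" if k: "\<tau> k = ereal s" for k s
  proof -
    show s: "0 \<le> s" using inv[of k] k by simp
    note \<xi>' = \<xi>[OF k s]
    have "0 \<le> depth (v k) (\<xi> k s)" using inv[of k] k \<xi>' by simp
    note ex = exit_time_facts[OF \<alpha> s v \<xi>'(2) this, folded C_def, folded \<tau>_fin(1)[OF k]]
    show "ereal s \<le> \<tau> (Suc k)" "\<And>t. s \<le> t \<Longrightarrow> ereal t \<le> \<tau> (Suc k) \<Longrightarrow> 0 \<le> depth (v k) (\<xi> k t)"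
      "ereal (s + depth (v k) (p k) / M) \<le> \<tau> (Suc k)"
      using ex \<xi>' by auto
  qed
  have inc: "incseq \<tau>"
  proof (rule incseq_SucI)
    fix k show "\<tau> k \<le> \<tau> (Suc k)"
      using ex(1)[of k] \<tau>_inf[of k] inv[of k] by (cases "\<tau> k") auto
  qed
  have grow: "ereal (k * (gap / M)) \<le> \<tau> (Suc k)" for k
  proof (induction k)
    case (Suc k)
    show ?case
    proof (cases "\<tau> (Suc k)")
      case (real s)
      with ex(3)[OF real] inv[of "Suc k"] have "ereal (s + gap / M) \<le> \<tau> (Suc (Suc k))" by simp
      moreover have "ereal (Suc k * (gap / M)) \<le> ereal (s + gap / M)"
        using Suc real by (simp add: algebra_simps add_divide_distrib)
      ultimately show ?thesis by (rule order_trans[rotated])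
    qed (use Suc \<tau>_inf in auto)
  qed (use inv[of "Suc 0"] in \<open>simp add: zero_ereal_def\<close>)
  have unb: "\<exists>k. ereal t \<le> \<tau> (Suc k)" for t
  proof -
    obtain k :: nat where "t / (gap / M) \<le> k" using real_arch_simple by blast
    then have "ereal t \<le> ereal (k * (gap / M))" using gap_pos M_pos by (simp add: field_simps)
    with grow[of k] show ?thesis by (meson order_trans)
  qed
  have lim: "\<tau> \<longlonglongrightarrow> \<infinity>"
    unfolding Lim_PInfty
  proof
    fix r
    obtain k where "ereal r \<le> \<tau> (Suc k)" using unb by blast
    then show "\<exists>N. \<forall>n\<ge>N. ereal r \<le> \<tau> n"
      using incseqD[OF inc] by (intro exI[of _ "Suc k"]) (meson order_trans)
  qed
  define n where "n t = (LEAST k. ereal t \<le> \<tau> (Suc k))" for t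
  define X where "X t = \<xi> (n t) t" for t
  define W where "W t = v (n t)" for t
  have n_eq: "n t = k" if "\<tau> k < ereal t" "ereal t \<le> \<tau> (Suc k)" for t k
    unfolding n_def
  proof (rule Least_equality)
    fix j assume j: "ereal t \<le> \<tau> (Suc j)"
    show "k \<le> j"
    proof (rule ccontr)
      assume "\<not> k \<le> j"
      then have "\<tau> (Suc j) \<le> \<tau> k" using incseqD[OF inc] by simp
      with j that(1) show False by (meson leD order_trans)
    qed
  qed (rule that(2))
  have n_0: "n t = 0" if "ereal t \<le> \<tau> (Suc 0)" for t
    unfolding n_def using that by (intro Least_equality) auto
  have n_fin: "\<exists>s. \<tau> (n t) = ereal s \<and> s \<le> t \<and> (n t > 0 \<longrightarrow> s < t) \<and> ereal t \<le> \<tau> (Suc (n t))" if "0 \<le> t" for t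
  proof -
    have le: "ereal t \<le> \<tau> (Suc (n t))" unfolding n_def by (rule LeastI_ex[OF unb])
    show ?thesis
    proof (cases "n t")
      case 0
      then show ?thesis using that le \<tau>0 by (intro exI[of _ 0]) (auto simp: zero_ereal_def)
    next
      case (Suc j)
      then have "\<not> ereal t \<le> \<tau> (Suc j)" unfolding n_def
        using not_less_Least[of j "\<lambda>k. ereal t \<le> \<tau> (Suc k)"] by auto
      then have "\<tau> (n t) < ereal t" using Suc by simp
      then obtain s where "\<tau> (n t) = ereal s" "s < t" using inv[of "n t"] by (cases "\<tau> (n t)") auto
      then show ?thesis using le by auto
    qed
  qed
  have X_\<xi>: "X t = \<xi> k t" if "\<tau> k = ereal s" "s \<le> t" "ereal t \<le> \<tau> (Suc k)" for k s t
    using that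
  proof (induction k arbitrary: s t)
    case 0
    then show ?case using n_0[of t] by (simp add: X_def)
  next
    case (Suc k)
    show ?case
    proof (cases "s = t")
      case False
      then show ?thesis using Suc.prems n_eq[of "Suc k" t] by (simp add: X_def)
    next
      case True
      obtain r where r: "\<tau> k = ereal r" using Suc.prems(1) inv[of k] \<tau>_inf[of k] by (cases "\<tau> k") auto
      have "r \<le> s" using ex(1)[OF r] Suc.prems(1) by simp
      then have "X s = \<xi> k s" using Suc.IH[OF r, of s] Suc.prems(1) by simp
      also have "\<dots> = p (Suc k)" using \<tau>_fin(2)[OF r] Suc.prems(1) by simp
      also have "\<dots> = \<xi> (Suc k) s" using \<xi>(1)[OF Suc.prems(1)] ex(4)[OF Suc.prems(1)] by simp
      finally show ?thesis using True by simp
    qed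
  qed
  have solves_piece: "solves W \<alpha> s T X" if s: "\<tau> k = ereal s" and T: "ereal T \<le> \<tau> (Suc k)" for k s T
  proof (rule solves_cong[OF \<xi>(2)[OF s] negligible_sing[of s]])
    show "0 \<le> s" using ex(4)[OF s] .
    fix t assume t: "t \<in> {s..T}"
    then have tT: "ereal t \<le> \<tau> (Suc k)" using T by (auto intro: order_trans[of "ereal t" "ereal T"])
    then show "\<xi> k t = X t" using X_\<xi>[OF s] t by simp
  next
    fix t assume t: "t \<in> {s..T} - {s}"
    then have "ereal t \<le> \<tau> (Suc k)" using T by (auto intro: order_trans[of "ereal t" "ereal T"])
    then show "v k = W t \<and> \<alpha> t = \<alpha> t" using n_eq[of k t] s t by (simp add: W_def)
  qed
  have solves_upto: "solves W \<alpha> 0 T X" if "ereal T \<le> \<tau> (Suc k)" for T k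
    using that
  proof (induction k arbitrary: T)
    case 0
    then show ?case using solves_piece[of 0 0] \<tau>0 by (simp add: zero_ereal_def)
  next
    case (Suc k)
    show ?case
    proof (cases "ereal T \<le> \<tau> (Suc k)")
      case False
      then obtain s where s: "\<tau> (Suc k) = ereal s" using inv[of "Suc k"] by (cases "\<tau> (Suc k)") auto
      show ?thesis
        by (rule solves_join[OF Suc.IH[of s] solves_piece[OF s Suc.prems] ex(4)[OF s]]) (use s in simp)
    qed (rule Suc.IH)
  qed
  have solves: "solves W \<alpha> 0 T X" for T using unb[of T] solves_upto by blast
  have WV: "W t \<in> {-1, 1}" for t unfolding W_def by (rule v)
  have dep: "X t \<in> closure (sector e \<rho> (W t))" if t: "0 \<le> t" for t
  proof -
    obtain s where "\<tau> (n t) = ereal s" "s \<le> t" "ereal t \<le> \<tau> (Suc (n t))" using n_fin[OF t] by blast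
    from ex(2)[OF this] show ?thesis using closure_sector[OF WV] by (simp add: X_def W_def)
  qed
  have left: "continuous (at_left t) W" if t: "0 < t" for t
  proof -
    obtain s where s: "\<tau> (n t) = ereal s" "s < t" "ereal t \<le> \<tau> (Suc (n t))"
      using n_fin[of t] t \<tau>0 by (cases "n t = 0") (auto simp: zero_ereal_def)
    have "W r = W t" if "s < r" "r < t" for r
    proof -
      have "ereal r \<le> ereal t" using that by simp
      then have "ereal r \<le> \<tau> (Suc (n t))" using s(3) by (rule order_trans)
      then show ?thesis using n_eq[of "n t" r] s(1) that by (simp add: W_def)
    qed
    then have "\<forall>\<^sub>F r in at_left t. W r = W t"
      using s(2) unfolding eventually_at_left_field by blast
    then show ?thesis unfolding continuous_within by (rule tendsto_eventually)
  qed
  have "switching_trajectory f e \<rho> x w \<alpha> X W"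
    unfolding switching_trajectory_def
  proof (intro conjI allI impI exI[of _ \<tau>])
    show "continuous_on {0..} X"
      by (intro continuous_on_atLeastI solves_continuous[OF solves _ \<alpha>] WV) simp
    fix t :: real assume t: "0 \<le> t"
    have "((\<lambda>r. f (X r) (W r) (\<alpha> r)) has_integral (X t - X 0)) {0..t}"
      using solves[of t] t by (auto simp: solves_def)
    moreover have "(\<lambda>r. f (X r) (W r) (\<alpha> r)) absolutely_integrable_on {0..t}"
      using calculation \<alpha> WV speed
      by (intro absolutely_integrable_integrable_bound[where g="\<lambda>_. M"]) (auto simp: controls_def)
    ultimately have "X t - X 0 = (LINT r:{0..t}|lebesgue. f (X r) (W r) (\<alpha> r))"
      by (metis has_integral_set_lebesgue has_integral_unique)
    moreover have "X 0 = x" using X_\<xi>[of 0 0 0] \<xi>(1)[of 0 0] \<tau>0 ex(1)[of 0 0] p0 by (simp add: zero_ereal_def)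
    ultimately show "X t = x + (LINT r:{0..t}|lebesgue. f (X r) (W r) (\<alpha> r))" by (simp add: algebra_simps)
  next
    show "W 0 = w" using n_0[of 0] ex(1)[of 0 0] \<tau>0 by (simp add: W_def v_0 zero_ereal_def)
  next
    fix k s assume k: "\<tau> k = ereal s"
    have "X s = p k" using X_\<xi>[OF k order_refl ex(1)[OF k]] \<xi>(1)[OF k ex(4)[OF k]] by simp
    then have "mode_solution f ((- 1) ^ k * w) \<alpha> s (X s) (\<xi> k)"
      using \<xi>(3)[OF k ex(4)[OF k]] unfolding v_def by simp
    moreover have "\<tau> (Suc k) = exit_time (closure (sector e \<rho> ((- 1) ^ k * w))) s (\<xi> k)"
      using \<tau>_fin(1)[OF k] unfolding v_def C_def .
    ultimately show "\<exists>\<xi>. mode_solution f ((- 1) ^ k * w) \<alpha> s (X s) \<xi> \<and>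
        \<tau> (Suc k) = exit_time (closure (sector e \<rho> ((- 1) ^ k * w))) s \<xi>" by blast
    fix t assume "s < t \<and> ereal t \<le> \<tau> (Suc k)"
    then show "W t = (- 1) ^ k * w" using n_eq[of k t] k by (simp add: W_def v_def)
  qed (use WV dep left \<tau>0 inc lim in auto)
  then show ?thesis by blast
qed

definition pos :: "'x \<Rightarrow> int \<Rightarrow> (real \<Rightarrow> 'a) \<Rightarrow> real \<Rightarrow> 'x" where
  "pos x w \<alpha> = fst (trajectory f e \<rho> x w \<alpha>)"

definition mode :: "'x \<Rightarrow> int \<Rightarrow> (real \<Rightarrow> 'a) \<Rightarrow> real \<Rightarrow> int" where
  "mode x w \<alpha> = snd (trajectory f e \<rho> x w \<alpha>)"

lemma trajectory_hybrid:
  assumes "\<alpha> \<in> controls A" "w \<in> {-1, 1}" "0 \<le> depth w x"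
  shows "hybrid \<alpha> (pos x w \<alpha>) (mode x w \<alpha>)" "pos x w \<alpha> 0 = x" "mode x w \<alpha> 0 = w"
proof -
  have "\<exists>z. case_prod (switching_trajectory f e \<rho> x w \<alpha>) z"
    using switching_trajectory_exists[OF assms] by auto
  then have "case_prod (switching_trajectory f e \<rho> x w \<alpha>) (trajectory f e \<rho> x w \<alpha>)"
    unfolding trajectory_def by (rule someI_ex)
  then have "switching_trajectory f e \<rho> x w \<alpha> (pos x w \<alpha>) (mode x w \<alpha>)"
    by (simp add: pos_def mode_def case_prod_beta)
  from switching_trajectory_hybrid[OF this assms(1,2)]
  show "hybrid \<alpha> (pos x w \<alpha>) (mode x w \<alpha>)" "pos x w \<alpha> 0 = x" "mode x w \<alpha> 0 = w" .
qed

lemma hybridD: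
  assumes "hybrid \<alpha> X W"
  shows "0 \<le> t \<Longrightarrow> W t \<in> {-1, 1}" "0 \<le> t \<Longrightarrow> 0 \<le> depth (W t) (X t)" "solves W \<alpha> 0 T X"
    "\<lbrakk>0 \<le> s; 0 < H; M * H < gap; solves (\<lambda>_. W s) \<alpha> s (s + H) \<xi>; \<xi> s = X s\<rbrakk>
       \<Longrightarrow> \<exists>\<tau>. switches_at (W s) X W \<xi> s (s + H) \<tau>"
  using assms unfolding hybrid_def by auto

lemma hybrid_speed:
  assumes "hybrid \<alpha> X W" "\<alpha> \<in> controls A" "0 \<le> t" "0 \<le> t'"
  shows "norm (X t' - X t) \<le> M * \<bar>t' - t\<bar>"
  using solves_speed[OF hybridD(3)[OF assms(1)] assms(3) _ order_refl order_refl assms(2) hybridD(1)[OF assms(1)], of t']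
    solves_speed[OF hybridD(3)[OF assms(1)] assms(4) _ order_refl order_refl assms(2) hybridD(1)[OF assms(1)], of t]
  by (cases "t \<le> t'") (auto simp: norm_minus_commute)

lemma hybrid_shift:
  assumes h: "hybrid \<alpha> X W" and c: "0 \<le> c"
  shows "hybrid (\<lambda>t. \<alpha> (c + t)) (\<lambda>t. X (c + t)) (\<lambda>t. W (c + t))"
  unfolding hybrid_def
proof (intro conjI allI impI)
  fix t :: real assume "0 \<le> t"
  then show "W (c + t) \<in> {-1, 1}" "0 \<le> depth (W (c + t)) (X (c + t))" using hybridD(1,2)[OF h, of "c + t"] c by auto
next
  fix T
  have "solves W \<alpha> c (c + T) X" by (rule solves_sub[OF hybridD(3)[OF h] c order_refl])
  from solves_shift[OF this, of c] show "solves (\<lambda>t. W (c + t)) (\<lambda>t. \<alpha> (c + t)) 0 T (\<lambda>t. X (c + t))" by simp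
next
  fix s H \<xi>
  assume s: "0 \<le> s" "0 < H" "M * H < gap"
    and \<xi>: "solves (\<lambda>_. W (c + s)) (\<lambda>t. \<alpha> (c + t)) s (s + H) \<xi>" "\<xi> s = X (c + s)"
  have "solves (\<lambda>_. W (c + s)) \<alpha> (c + s) (c + s + H) (\<lambda>t. \<xi> (t - c))"
    using solves_shift[OF \<xi>(1), of "- c"] by (simp add: algebra_simps)
  from hybridD(4)[OF h _ s(2,3) this] s c \<xi>(2)
  obtain \<tau> where "switches_at (W (c + s)) X W (\<lambda>t. \<xi> (t - c)) (c + s) (c + s + H) \<tau>" by auto
  note \<tau> = switches_atD[OF this]
  have "switches_at (W (c + s)) (\<lambda>t. X (c + t)) (\<lambda>t. W (c + t)) \<xi> s (s + H) (\<tau> - c)"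
    unfolding switches_at_def
  proof (intro conjI ballI allI impI)
    fix t assume "t \<in> {s..\<tau> - c}"
    then show "X (c + t) = \<xi> t" "W (c + t) = W (c + s)" "0 \<le> depth (W (c + s)) (\<xi> t)"
      using \<tau>(3)[of "c + t"] by auto
  next
    fix t assume "t \<in> {\<tau> - c<..s + H}"
    then show "W (c + t) = - W (c + s)" using \<tau>(4)[of "c + t"] by auto
  next
    fix \<eta> assume "\<tau> - c < s + H" "\<tau> - c < \<eta>" "\<eta> \<le> s + H"
    then obtain t where "\<tau> < t" "t < \<eta> + c" "depth (W (c + s)) (\<xi> (t - c)) < 0"
      using \<tau>(6)[of "\<eta> + c"] by auto
    then show "\<exists>t\<in>{\<tau> - c<..<\<eta>}. depth (W (c + s)) (\<xi> t) < 0" by (intro bexI[of _ "t - c"]) auto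
  qed (use \<tau>(1,2,5) in auto)
  then show "\<exists>\<tau>. switches_at (W (c + s)) (\<lambda>t. X (c + t)) (\<lambda>t. W (c + t)) \<xi> s (s + H) \<tau>" by blast
qed

lemma hybrid_cong:
  assumes h: "hybrid \<alpha> X W" and eq: "\<And>t. 0 \<le> t \<Longrightarrow> \<alpha> t = \<alpha>' t"
  shows "hybrid \<alpha>' X W"
proof -
  have *: "solves V \<alpha> s T Y \<longleftrightarrow> solves V \<alpha>' s T Y" if "0 \<le> s" for V s T Y
    using solves_cong[of V \<alpha> s T Y "{}" V \<alpha>' Y] solves_cong[of V \<alpha>' s T Y "{}" V \<alpha> Y] eq that by auto
  show ?thesis using h unfolding hybrid_def by (auto simp: *)
qed

text \<open>
  The past up to \<open>t\<close> does not tell whether the trajectory exits at \<open>t\<close> itself. This does not matter, as the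
  mode still has its old value at a switching instant.
\<close>

lemma hybrid_causal_short:
  assumes h: "hybrid \<alpha>1 X1 W1" "hybrid \<alpha>2 X2 W2" and \<alpha>: "\<alpha>1 \<in> controls A" "\<alpha>2 \<in> controls A"
    and init: "X1 0 = X2 0" "W1 0 = W2 0" and eq: "aeq H \<alpha>1 \<alpha>2" and H: "0 < H" "M * H < gap"
    and t: "0 \<le> t" "t \<le> H"
  shows "X1 t = X2 t \<and> W1 t = W2 t"
proof -
  let ?w = "W1 0"
  have w: "?w \<in> {-1, 1}" using hybridD(1)[OF h(1)] by simp
  obtain \<xi>1 where \<xi>1: "\<xi>1 0 = X1 0" "\<And>T. solves (\<lambda>_. ?w) \<alpha>1 0 T \<xi>1" using mode_exists[OF \<alpha>(1) order_refl w] by blast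
  obtain \<xi>2 where \<xi>2: "\<xi>2 0 = X1 0" "\<And>T. solves (\<lambda>_. ?w) \<alpha>2 0 T \<xi>2" using mode_exists[OF \<alpha>(2) order_refl w] by blast
  obtain N where N: "negligible N" "\<And>t. t \<in> {0..H} - N \<Longrightarrow> \<alpha>1 t = \<alpha>2 t" using eq unfolding aeq_def by blast
  have \<xi>: "\<xi>1 r = \<xi>2 r" if "r \<in> {0..H}" for r
    using solves_stability[OF \<xi>1(2) \<xi>2(2) order_refl \<alpha> _ N that] w \<xi>1 \<xi>2 by simp
  obtain \<tau>1 where \<tau>1: "switches_at ?w X1 W1 \<xi>1 0 (0 + H) \<tau>1"
    using hybridD(4)[OF h(1) order_refl H \<xi>1(2,1)] by blast
  obtain \<tau>2 where \<tau>2: "switches_at ?w X2 W2 \<xi>2 0 (0 + H) \<tau>2"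
    using hybridD(4)[OF h(2) order_refl H, of \<xi>2] \<xi>2 init by auto
  note \<tau>1 = switches_atD[OF \<tau>1] and \<tau>2 = switches_atD[OF \<tau>2]
  have "\<not> \<tau>1 < \<tau>2"
  proof
    assume less: "\<tau>1 < \<tau>2"
    then have "\<exists>r\<in>{\<tau>1<..<\<tau>2}. depth ?w (\<xi>1 r) < 0" using \<tau>2(2) by (intro \<tau>1(6)) auto
    then obtain r where r: "\<tau>1 < r" "r < \<tau>2" "depth ?w (\<xi>1 r) < 0" by auto
    moreover have "0 \<le> r" "r \<le> H" using r \<tau>1(1) \<tau>2(2) by auto
    ultimately show False using \<tau>2(3)[of r] \<xi>[of r] by fastforce
  qed
  moreover have "\<not> \<tau>2 < \<tau>1"
  proof
    assume less: "\<tau>2 < \<tau>1"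
    then have "\<exists>r\<in>{\<tau>2<..<\<tau>1}. depth ?w (\<xi>2 r) < 0" using \<tau>1(2) by (intro \<tau>2(6)) auto
    then obtain r where r: "\<tau>2 < r" "r < \<tau>1" "depth ?w (\<xi>2 r) < 0" by auto
    moreover have "0 \<le> r" "r \<le> H" using r \<tau>2(1) \<tau>1(2) by auto
    ultimately show False using \<tau>1(3)[of r] \<xi>[of r] by fastforce
  qed
  ultimately have "\<tau>1 = \<tau>2" by simp
  have W: "W1 r = W2 r" if "0 \<le> r" "r \<le> H" for r
  proof (cases "r \<le> \<tau>2")
    case True
    then show ?thesis using \<tau>1(3)[of r] \<tau>2(3)[of r] that \<open>\<tau>1 = \<tau>2\<close> by metis
  next
    case False
    then show ?thesis using \<tau>1(4)[of r] \<tau>2(4)[of r] that \<open>\<tau>1 = \<tau>2\<close> by simp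
  qed
  have "solves W1 \<alpha>2 0 H X2"
    by (rule solves_cong[OF hybridD(3)[OF h(2)] negligible_empty]) (use W in auto)
  from solves_stability[OF hybridD(3)[OF h(1)] this order_refl \<alpha> _ N, of t] t init hybridD(1)[OF h(1)]
  have "X1 t = X2 t" by simp
  with W[OF t] show ?thesis by simp
qed

lemma hybrid_causal:
  assumes h: "hybrid \<alpha>1 X1 W1" "hybrid \<alpha>2 X2 W2" and \<alpha>: "\<alpha>1 \<in> controls A" "\<alpha>2 \<in> controls A"
    and init: "X1 0 = X2 0" "W1 0 = W2 0" and eq: "aeq T \<alpha>1 \<alpha>2" and t: "0 \<le> t" "t \<le> T"
  shows "X1 t = X2 t \<and> W1 t = W2 t"
proof -
  define H where "H = gap / (2 * M)"
  have H: "0 < H" "M * H < gap" using gap_pos M_pos by (auto simp: H_def)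
  have step: "X1 t = X2 t \<and> W1 t = W2 t"
    if s: "0 \<le> s" "X1 s = X2 s" "W1 s = W2 s" and t: "s < t" "t \<le> s + H" "t \<le> T" for s t
  proof -
    have "aeq (t - s) (\<lambda>r. \<alpha>1 (s + r)) (\<lambda>r. \<alpha>2 (s + r))"
      using aeq_shift[OF aeq_mono[OF eq t(3)] s(1)] .
    moreover have "M * (t - s) < gap"
    proof -
      have "M * (t - s) \<le> M * H" using t M_pos by (intro mult_left_mono) auto
      with H show ?thesis by simp
    qed
    ultimately show ?thesis
      using hybrid_causal_short[OF hybrid_shift[OF h(1) s(1)] hybrid_shift[OF h(2) s(1)]
          controls_shift[OF \<alpha>(1) s(1)] controls_shift[OF \<alpha>(2) s(1)], of "t - s" "t - s"] s t by simp
  qed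
  have "\<forall>t. 0 \<le> t \<longrightarrow> t \<le> T \<longrightarrow> t \<le> n * H \<longrightarrow> X1 t = X2 t \<and> W1 t = W2 t" for n :: nat
  proof (induction n)
    case (Suc n)
    show ?case
    proof (intro allI impI)
      fix t assume t: "0 \<le> t" "t \<le> T" "t \<le> Suc n * H"
      show "X1 t = X2 t \<and> W1 t = W2 t"
      proof (cases "t \<le> n * H")
        case False
        have "t \<le> n * H + H" using t(3) by (simp add: algebra_simps)
        moreover have "0 \<le> n * H" using H by simp
        ultimately show ?thesis using Suc.IH False t by (intro step[of "n * H"]) auto
      qed (use Suc.IH t in auto)
    qed
  qed (use init in auto)
  moreover obtain n :: nat where "t / H \<le> n" using real_arch_simple by blast
  then have "t \<le> n * H" using H by (simp add: field_simps)
  ultimately show ?thesis using t by blast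
qed

end

section \<open>Inserting pieces of control\<close>

definition ins :: "real \<Rightarrow> real \<Rightarrow> 'a \<Rightarrow> (real \<Rightarrow> 'a) \<Rightarrow> real \<Rightarrow> 'a" where
  "ins s \<theta> a \<alpha> = (\<lambda>t. if t < s then \<alpha> t else if t < s + \<theta> then a else \<alpha> (t - \<theta>))"

definition conc :: "real \<Rightarrow> (real \<Rightarrow> 'a) \<Rightarrow> (real \<Rightarrow> 'a) \<Rightarrow> real \<Rightarrow> 'a" where
  "conc H \<beta> \<gamma> = (\<lambda>t. if t < H then \<beta> t else \<gamma> (t - H))"

lemma conc_controls:
  assumes \<beta>: "\<beta> \<in> controls A" and \<gamma>: "\<gamma> \<in> controls A" and H: "0 \<le> H"
  shows "conc H \<beta> \<gamma> \<in> controls A"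
proof -
  define \<gamma>' where "\<gamma>' = (\<lambda>t. if 0 \<le> t then \<gamma> t else \<gamma> 0)"
  have "\<gamma>' \<in> borel_measurable lebesgue"
    unfolding \<gamma>'_def using \<gamma>
    by (subst measurable_If_restrict_space_iff) (auto simp: controls_def atLeast_def)
  moreover have "(\<lambda>t. - H + t) \<in> lebesgue \<rightarrow>\<^sub>M lebesgue"
    using lebesgue_affine_measurable[of "\<lambda>_. 1" "- H"] by simp
  ultimately have "(\<lambda>t. \<gamma>' (- H + t)) \<in> borel_measurable lebesgue" by (rule measurable_compose[rotated])
  then have "(\<lambda>t. \<gamma>' (- H + t)) \<in> borel_measurable (lebesgue_on {0..})" by (rule measurable_restrict_space1)
  moreover have "{t \<in> space (lebesgue_on {0..}). t < H} \<in> sets (lebesgue_on {0..})"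
    by (auto simp: sets_restrict_space_iff Int_def)
  ultimately have "(\<lambda>t. if t < H then \<beta> t else \<gamma>' (- H + t)) \<in> borel_measurable (lebesgue_on {0..})"
    using \<beta> by (intro measurable_If) (auto simp: controls_def)
  moreover have "conc H \<beta> \<gamma> = (\<lambda>t. if t < H then \<beta> t else \<gamma>' (- H + t))"
    by (auto simp: conc_def \<gamma>'_def)
  ultimately show ?thesis using \<beta> \<gamma> H by (auto simp: controls_def conc_def \<gamma>'_def)
qed

lemma ins_controls:
  assumes "\<alpha> \<in> controls A" "a \<in> A" "0 \<le> s" "0 \<le> \<theta>"
  shows "ins s \<theta> a \<alpha> \<in> controls A"
proof -
  have "conc (s + \<theta>) (conc s \<alpha> (\<lambda>_. a)) (\<lambda>t. \<alpha> (s + t)) \<in> controls A"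
    by (rule conc_controls[OF conc_controls[OF assms(1) _ assms(3)] controls_shift[OF assms(1,3)]])
      (use assms in \<open>auto simp: controls_def\<close>)
  moreover have "conc (s + \<theta>) (conc s \<alpha> (\<lambda>_. a)) (\<lambda>t. \<alpha> (s + t)) = ins s \<theta> a \<alpha>"
    using assms(4) by (auto simp: conc_def ins_def)
  ultimately show ?thesis by simp
qed

lemma aeq_conc:
  assumes "aeq s \<beta>1 \<beta>2" "H \<le> s" "aeq T \<gamma>1 \<gamma>2" "0 \<le> H"
  shows "aeq (H + T) (conc H \<beta>1 \<gamma>1) (conc H \<beta>2 \<gamma>2)"
proof -
  obtain N1 where N1: "negligible N1" "\<And>t. t \<in> {0..s} - N1 \<Longrightarrow> \<beta>1 t = \<beta>2 t" using assms(1) by (auto simp: aeq_def)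
  obtain N2 where N2: "negligible N2" "\<And>t. t \<in> {0..T} - N2 \<Longrightarrow> \<gamma>1 t = \<gamma>2 t" using assms(3) by (auto simp: aeq_def)
  have "conc H \<beta>1 \<gamma>1 t = conc H \<beta>2 \<gamma>2 t" if t: "t \<in> {0..H + T} - (N1 \<union> (+) H ` N2)" for t
  proof (cases "t < H")
    case True
    then show ?thesis using t N1(2)[of t] assms(2) by (simp add: conc_def)
  next
    case False
    have "t - H \<notin> N2" using t by (auto simp: image_iff)
    then show ?thesis using t N2(2)[of "t - H"] False by (simp add: conc_def)
  qed
  then show ?thesis unfolding aeq_def
    using negligible_Un[OF N1(1) negligible_translation[OF N2(1), of H]] by blast
qed

lemma ins_as_conc: "0 \<le> \<theta> \<Longrightarrow> ins s \<theta> a \<alpha> = conc s \<alpha> (conc \<theta> (\<lambda>_. a) (\<lambda>t. \<alpha> (s + t)))"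
  by (auto simp: conc_def ins_def algebra_simps)

lemma aeq_ins:
  assumes "aeq T \<alpha>1 \<alpha>2" "0 \<le> s" "s \<le> T" "0 \<le> \<theta>"
  shows "aeq (T + \<theta>) (ins s \<theta> a \<alpha>1) (ins s \<theta> a \<alpha>2)"
proof -
  have "aeq (\<theta> + (T - s)) (conc \<theta> (\<lambda>_. a) (\<lambda>t. \<alpha>1 (s + t))) (conc \<theta> (\<lambda>_. a) (\<lambda>t. \<alpha>2 (s + t)))"
    by (rule aeq_conc[OF aeq_refl order_refl aeq_shift[OF assms(1,2)] assms(4)])
  from aeq_conc[OF assms(1,3) this assms(2)] show ?thesis
    using assms(4) by (simp add: ins_as_conc algebra_simps)
qed

text \<open>
  An insertion may have length zero, so the number of insertions is only an upper bound.
\<close>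

inductive inserted :: "'a set \<Rightarrow> real \<Rightarrow> (real \<Rightarrow> 'a) \<Rightarrow> nat \<Rightarrow> (real \<Rightarrow> 'a) \<Rightarrow> bool"
  for A :: "'a set" and \<kappa> :: real and \<alpha> :: "real \<Rightarrow> 'a" where
  none: "inserted A \<kappa> \<alpha> 0 \<alpha>"
| one: "inserted A \<kappa> \<alpha> m \<beta> \<Longrightarrow> 0 \<le> s \<Longrightarrow> 0 \<le> \<theta> \<Longrightarrow> \<theta> \<le> \<kappa> \<Longrightarrow> a \<in> A \<Longrightarrow> inserted A \<kappa> \<alpha> (Suc m) (ins s \<theta> a \<beta>)"

lemma inserted_mono: "inserted A \<kappa> \<alpha> m \<beta> \<Longrightarrow> \<kappa> \<le> \<kappa>' \<Longrightarrow> inserted A \<kappa>' \<alpha> m \<beta>"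
  by (induction rule: inserted.induct) (auto intro: inserted.intros)

lemma inserted_trans:
  "inserted A \<kappa> \<beta> m' \<gamma> \<Longrightarrow> inserted A \<kappa> \<alpha> m \<beta> \<Longrightarrow> inserted A \<kappa> \<alpha> (m' + m) \<gamma>"
  by (induction rule: inserted.induct) (auto intro: inserted.intros)

lemma ins_0: "ins s 0 a \<alpha> = \<alpha>"
  by (auto simp: ins_def)

lemma inserted_conc:
  assumes "inserted A \<kappa> (\<lambda>t. \<beta> (H + t)) m \<gamma>" "0 \<le> H"
  shows "inserted A \<kappa> \<beta> m (conc H \<beta> \<gamma>)"
  using assms
proof (induction rule: inserted.induct)
  case none
  have "conc H \<beta> (\<lambda>t. \<beta> (H + t)) = \<beta>" by (auto simp: conc_def)
  then show ?case by (simp add: inserted.none)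
next
  case (one m \<gamma> s \<theta> a)
  have "conc H \<beta> (ins s \<theta> a \<gamma>) = ins (H + s) \<theta> a (conc H \<beta> \<gamma>)"
    using one by (auto simp: conc_def ins_def algebra_simps)
  then show ?case using one by (auto intro: inserted.one)
qed

section \<open>Tracking a trajectory with a delay\<close>

lemma integral_bump_le:
  fixes g :: "real \<Rightarrow> real"
  assumes g: "g integrable_on {a..b}" and \<theta>: "0 \<le> \<theta>"
    and le: "\<And>t. t \<in> {a..b} \<Longrightarrow> g t \<le> 2" and zero: "\<And>t. t \<in> {a..b} \<Longrightarrow> t \<notin> {u..u + \<theta>} \<Longrightarrow> g t \<le> 0"
  shows "integral {a..b} g \<le> 2 * \<theta>"
proof -
  let ?i = "\<lambda>t. if t \<in> {u..u + \<theta>} then 2 else 0 :: real"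
  have eq: "{u..u + \<theta>} \<inter> {a..b} = {max u a..min (u + \<theta>) b}" by auto
  have i: "?i integrable_on {a..b}"
    by (subst integrable_restrict_Int) (simp add: eq integrable_const_ivl)
  have "integral {a..b} g \<le> integral {a..b} ?i"
    by (rule integral_le[OF g i]) (use le zero in auto)
  also have "\<dots> = integral {max u a..min (u + \<theta>) b} (\<lambda>_. 2)"
    by (subst integral_restrict_Int) (simp add: eq)
  also have "\<dots> \<le> 2 * \<theta>" using \<theta> by (auto simp: content_real_if)
  finally show ?thesis .
qed

context player begin

lemma hybrid_flip:
  assumes "hybrid \<alpha> X W" "\<alpha> \<in> controls A" "0 < H" "M * H < gap"
  obtains \<tau> where "0 \<le> \<tau>" "\<tau> \<le> H" "\<And>t. 0 \<le> t \<Longrightarrow> t \<le> \<tau> \<Longrightarrow> W t = W 0"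
    "\<And>t. \<tau> < t \<Longrightarrow> t \<le> H \<Longrightarrow> W t = - W 0" "\<tau> < H \<Longrightarrow> depth (W 0) (X \<tau>) = 0"
proof -
  have w: "W 0 \<in> {-1, 1}" using hybridD(1)[OF assms(1)] by simp
  obtain \<xi> where \<xi>: "\<xi> 0 = X 0" "\<And>T. solves (\<lambda>_. W 0) \<alpha> 0 T \<xi>" using mode_exists[OF assms(2) order_refl w] by blast
  obtain \<tau> where "switches_at (W 0) X W \<xi> 0 (0 + H) \<tau>"
    using hybridD(4)[OF assms(1) order_refl assms(3,4) \<xi>(2,1)] by blast
  note \<tau> = switches_atD[OF this]
  show thesis
  proof (rule that)
    show "depth (W 0) (X \<tau>) = 0" if "\<tau> < H" using \<tau>(1,5) \<tau>(3)[of \<tau>] that by simp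
    show "W t = W 0" if "0 \<le> t" "t \<le> \<tau>" for t using \<tau>(3)[of t] that by blast
    show "W t = - W 0" if "\<tau> < t" "t \<le> H" for t using \<tau>(4)[of t] that by simp
  qed (use \<tau>(1,2) in auto)
qed

lemma mode_integrable:
  assumes h: "hybrid \<alpha> X W" and \<alpha>: "\<alpha> \<in> controls A" and s: "0 \<le> s"
  shows "(\<lambda>t. real_of_int (W t)) absolutely_integrable_on {s..T}"
proof -
  define H where "H = gap / (2 * M)"
  have H: "0 < H" "M * H < gap" using gap_pos M_pos by (auto simp: H_def)
  have short: "(\<lambda>t. real_of_int (W t)) integrable_on {0..H}" if h: "hybrid \<alpha> X W" and \<alpha>: "\<alpha> \<in> controls A" for \<alpha> X W
  proof -
    obtain \<tau> where \<tau>: "0 \<le> \<tau>" "\<tau> \<le> H" "\<And>t. 0 \<le> t \<Longrightarrow> t \<le> \<tau> \<Longrightarrow> W t = W 0"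
      "\<And>t. \<tau> < t \<Longrightarrow> t \<le> H \<Longrightarrow> W t = - W 0" using hybrid_flip[OF h \<alpha> H] by metis
    have "real_of_int (W t) = real_of_int (W 0)" if "t \<in> {0..\<tau>} - {}" for t
      using \<tau>(3)[of t] that by simp
    from integrable_spike[OF integrable_const_ivl negligible_empty this]
    have "(\<lambda>t. real_of_int (W t)) integrable_on {0..\<tau>}" .
    moreover have "real_of_int (W t) = real_of_int (- W 0)" if "t \<in> {\<tau>..H} - {\<tau>}" for t
      using \<tau>(4)[of t] that by simp
    from integrable_spike[OF integrable_const_ivl negligible_sing this]
    have "(\<lambda>t. real_of_int (W t)) integrable_on {\<tau>..H}" .
    ultimately show ?thesis using \<tau>(1,2) by (metis Henstock_Kurzweil_Integration.integrable_combine)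
  qed
  have "(\<lambda>t. real_of_int (W t)) integrable_on {0..n * H}" for n :: nat
  proof (induction n)
    case (Suc n)
    have nH: "0 \<le> n * H" using H by simp
    have "(\<lambda>t. real_of_int (W (n * H + t))) integrable_on {0..H}"
      by (rule short[OF hybrid_shift[OF h nH] controls_shift[OF \<alpha> nH]])
    then have "(\<lambda>t. real_of_int (W t)) integrable_on {0 + n * H..H + n * H}"
      by (subst integrable_on_shift_Icc_real[symmetric]) (simp add: o_def)
    then show ?case
      using Henstock_Kurzweil_Integration.integrable_combine[OF nH _ Suc, of "Suc n * H"] H
      by (simp add: algebra_simps)
  qed (use integrable_on_refl[of _ "0 :: real"] in simp)
  moreover obtain n :: nat where "T / H \<le> n" using real_arch_simple by blast
  then have "T \<le> n * H" using H by (simp add: field_simps)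
  ultimately have "(\<lambda>t. real_of_int (W t)) integrable_on {s..T}"
    using s by (meson integrable_subinterval_real atLeastatMost_subset_iff)
  then show ?thesis
  proof (rule absolutely_integrable_integrable_bound[where g="\<lambda>_. 1", rotated])
    show "norm (real_of_int (W t)) \<le> 1" if "t \<in> {s..T}" for t
      using hybridD(1)[OF h, of t] that s by auto
  qed (rule integrable_const_ivl)
qed

text \<open>
  As a function of time the mode has bounded variation, so it is Lipschitz under translations in
  the mean.
\<close>

lemma mode_translation:
  fixes n :: nat and h \<theta> :: real
  assumes "hybrid \<alpha> X W" "\<alpha> \<in> controls A" "0 < h" "0 \<le> \<theta>" "M * (h + \<theta>) < gap"
  shows "(\<lambda>t. \<bar>real_of_int (W (t + \<theta>)) - real_of_int (W t)\<bar>) integrable_on {0..n * h}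
    \<and> integral {0..n * h} (\<lambda>t. \<bar>real_of_int (W (t + \<theta>)) - real_of_int (W t)\<bar>) \<le> 2 * \<theta> * n"
  using assms(1,2)
proof (induction n arbitrary: \<alpha> X W)
  case (Suc n)
  let ?g = "\<lambda>t :: real. \<bar>real_of_int (W (t + \<theta>)) - real_of_int (W t)\<bar>"
  have int: "?g integrable_on {0..T}" for T
  proof -
    have "(\<lambda>t. real_of_int (W (\<theta> + t))) absolutely_integrable_on {0..T}"
      by (rule mode_integrable[OF hybrid_shift[OF Suc.prems(1) assms(4)] controls_shift[OF Suc.prems(2) assms(4)]]) simp
    then have "(\<lambda>t. real_of_int (W (t + \<theta>)) - real_of_int (W t)) absolutely_integrable_on {0..T}"
      using mode_integrable[OF Suc.prems, of 0 T] by (simp add: add.commute set_integral_diff)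
    then show ?thesis by (simp add: absolutely_integrable_on_def)
  qed
  have H: "0 < h + \<theta>" using assms(3,4) by simp
  obtain \<tau> where \<tau>: "0 \<le> \<tau>" "\<tau> \<le> h + \<theta>" "\<And>t. 0 \<le> t \<Longrightarrow> t \<le> \<tau> \<Longrightarrow> W t = W 0"
      "\<And>t. \<tau> < t \<Longrightarrow> t \<le> h + \<theta> \<Longrightarrow> W t = - W 0" using hybrid_flip[OF Suc.prems H assms(5)] by metis
  have w: "W t \<in> {-1, 1}" if "0 \<le> t" for t using hybridD(1)[OF Suc.prems(1) that] .
  have 1: "integral {0..h} ?g \<le> 2 * \<theta>"
  proof (rule integral_bump_le[OF int assms(4), of h "\<tau> - \<theta>"])
    fix t assume t: "t \<in> {0..h}"
    then show "?g t \<le> 2" using w[of t] w[of "t + \<theta>"] assms(4) by auto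
    assume "t \<notin> {\<tau> - \<theta>..\<tau> - \<theta> + \<theta>}"
    then consider "t + \<theta> \<le> \<tau>" "t \<le> \<tau>" | "\<tau> < t" "\<tau> < t + \<theta>" using assms(4) by fastforce
    then have "W (t + \<theta>) = W t"
    proof cases
      case 1
      then show ?thesis using \<tau>(3)[of t] \<tau>(3)[of "t + \<theta>"] t assms(4) by simp
    next
      case 2
      then show ?thesis using \<tau>(4)[of t] \<tau>(4)[of "t + \<theta>"] t assms(4) by simp
    qed
    then show "?g t \<le> 0" by simp
  qed
  have h0: "0 \<le> h" using assms(3) by simp
  let ?g' = "\<lambda>t :: real. \<bar>real_of_int (W (h + (t + \<theta>))) - real_of_int (W (h + t))\<bar>"
  have "integral {0..n * h} ?g' \<le> 2 * \<theta> * n"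
    using Suc.IH[OF hybrid_shift[OF Suc.prems(1) h0] controls_shift[OF Suc.prems(2) h0]] by blast
  moreover have "integral {0..n * h} ?g' = integral {h..Suc n * h} ?g"
    using integral_shift_Icc_real[of 0 "n * h" ?g h] by (simp add: o_def algebra_simps)
  moreover have "integral {0..h} ?g + integral {h..Suc n * h} ?g = integral {0..Suc n * h} ?g"
    by (rule Henstock_Kurzweil_Integration.integral_combine) (use h0 int in \<open>auto simp: algebra_simps\<close>)
  ultimately show ?case using 1 int by (simp add: algebra_simps)
qed (use integrable_on_refl[of _ "0 :: real"] in simp)

text \<open>
  Controllability is only assumed pointwise on the switching hyperplanes. On bounded sets it extends
  to a neighbourhood with a uniform rate, by compactness.
\<close>

definition uniform :: "real \<Rightarrow> real \<Rightarrow> real \<Rightarrow> bool" where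
  "uniform R c r \<longleftrightarrow> 0 < c \<and> 0 < r \<and>
     (\<forall>w\<in>{-1, 1}. \<forall>\<sigma>\<in>{-1, 1 :: real}. \<forall>y. norm y \<le> R \<longrightarrow> \<bar>depth w y\<bar> \<le> r \<longrightarrow>
        (\<exists>a\<in>A. c \<le> \<sigma> * (of_int w * (f y w a \<bullet> e))))"

lemma uniform_sign:
  assumes w: "w \<in> {-1, 1}" and \<sigma>: "\<sigma> \<in> {-1, 1 :: real}"
  shows "\<exists>d>0. \<forall>y. norm y \<le> R \<longrightarrow> \<bar>depth w y\<bar> \<le> d \<longrightarrow> (\<exists>a\<in>A. d \<le> \<sigma> * (of_int w * (f y w a \<bullet> e)))"
proof (rule ccontr)
  assume "\<not> ?thesis"
  then have "\<exists>y. norm y \<le> R \<and> \<bar>depth w y\<bar> \<le> inverse (real (Suc n)) \<and>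
      (\<forall>a\<in>A. \<sigma> * (of_int w * (f y w a \<bullet> e)) < inverse (real (Suc n)))" for n
    by (metis inverse_positive_iff_positive not_le of_nat_0_less_iff zero_less_Suc)
  then obtain y where y: "\<And>n. norm (y n) \<le> R" "\<And>n. \<bar>depth w (y n)\<bar> \<le> inverse (real (Suc n))"
      "\<And>n a. a \<in> A \<Longrightarrow> \<sigma> * (of_int w * (f (y n) w a \<bullet> e)) < inverse (real (Suc n))" by metis
  have "seq_compact (cball (0 :: 'x) R)" by (simp add: compact_imp_seq_compact)
  then obtain y0 r where r: "strict_mono r" "(y \<circ> r) \<longlonglongrightarrow> y0"
    using y(1) unfolding seq_compact_def by (metis mem_cball_0)
  have inv: "(\<lambda>n. inverse (real (Suc (r n)))) \<longlonglongrightarrow> 0"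
    using LIMSEQ_subseq_LIMSEQ[OF LIMSEQ_inverse_real_of_nat r(1)] by (simp add: o_def)
  have dist: "(\<lambda>n. norm (y (r n) - y0)) \<longlonglongrightarrow> 0"
    using r(2) by (simp add: o_def LIM_zero tendsto_norm_zero)
  have "\<bar>depth w y0\<bar> \<le> inverse (real (Suc (r n))) + norm (y (r n) - y0)" for n
    using y(2)[of "r n"] depth_lipschitz[OF w, of "y (r n)" y0] by linarith
  then have "\<bar>depth w y0\<bar> \<le> 0 + 0"
    by (intro LIMSEQ_le_const[OF tendsto_add[OF inv dist]]) auto
  then have "y0 \<in> frontier (sector e \<rho> w)" using frontier_sector[OF w] by simp
  then obtain a where a: "a \<in> A" "0 < \<sigma> * (of_int w * (f y0 w a \<bullet> e))"
  proof -
    obtain a1 a2 where "a1 \<in> A" "a2 \<in> A" "f y0 w a1 \<bullet> e < 0" "0 < f y0 w a2 \<bullet> e"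
      using ctrl w \<open>y0 \<in> _\<close> unfolding controllable_def by blast
    then show thesis using that[of a1] that[of a2] w \<sigma> by auto
  qed
  have "\<sigma> * (of_int w * (f y0 w a \<bullet> e)) \<le> inverse (real (Suc (r n))) + L * norm (y (r n) - y0)" for n
  proof -
    have "\<bar>(f y0 w a - f (y (r n)) w a) \<bullet> e\<bar> \<le> norm (f y0 w a - f (y (r n)) w a)"
      using Cauchy_Schwarz_ineq2[of _ e] by (simp add: e_norm)
    also have "\<dots> \<le> L * norm (y (r n) - y0)"
      using lipschitz[OF w a(1), of y0 "y (r n)"] by (simp add: norm_minus_commute)
    finally have "\<bar>f y0 w a \<bullet> e - f (y (r n)) w a \<bullet> e\<bar> \<le> L * norm (y (r n) - y0)" by (simp add: inner_diff_left)
    with y(3)[OF a(1), of "r n"] w \<sigma> show ?thesis by auto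
  qed
  then have "\<sigma> * (of_int w * (f y0 w a \<bullet> e)) \<le> 0 + L * 0"
    by (intro LIMSEQ_le_const[OF tendsto_add[OF inv tendsto_mult_left[OF dist]]]) auto
  with a(2) show False by simp
qed

lemma uniform_exists: "\<exists>c r. uniform R c r"
proof -
  have "\<forall>z\<in>{-1, 1} \<times> {-1, 1 :: real}. \<exists>d>0. \<forall>y. norm y \<le> R \<longrightarrow> \<bar>depth (fst z) y\<bar> \<le> d \<longrightarrow>
      (\<exists>a\<in>A. d \<le> snd z * (of_int (fst z) * (f y (fst z) a \<bullet> e)))"
  proof
    fix z :: "int \<times> real" assume "z \<in> {-1, 1} \<times> {-1, 1}"
    then have "fst z \<in> {-1, 1}" "snd z \<in> {-1, 1}" by auto
    then show "\<exists>d>0. \<forall>y. norm y \<le> R \<longrightarrow> \<bar>depth (fst z) y\<bar> \<le> d \<longrightarrow>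
      (\<exists>a\<in>A. d \<le> snd z * (of_int (fst z) * (f y (fst z) a \<bullet> e)))" by (rule uniform_sign)
  qed
  then obtain d where d: "\<And>z. z \<in> {-1, 1} \<times> {-1, 1 :: real} \<Longrightarrow> d z > 0 \<and> (\<forall>y. norm y \<le> R \<longrightarrow>
      \<bar>depth (fst z) y\<bar> \<le> d z \<longrightarrow> (\<exists>a\<in>A. d z \<le> snd z * (of_int (fst z) * (f y (fst z) a \<bullet> e))))"
    by metis
  define c where "c = Min (d ` ({-1, 1} \<times> {-1, 1}))"
  have c: "c \<le> d z" if "z \<in> {-1, 1} \<times> {-1, 1}" for z unfolding c_def by (rule Min_le) (use that in auto)
  have "c > 0" unfolding c_def by (subst Min_gr_iff) (use d in blast)+
  moreover have "\<exists>a\<in>A. c \<le> \<sigma> * (of_int w * (f y w a \<bullet> e))"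
    if "w \<in> {-1, 1}" "\<sigma> \<in> {-1, 1}" "norm y \<le> R" "\<bar>depth w y\<bar> \<le> c" for w \<sigma> y
  proof -
    have z: "(w, \<sigma>) \<in> {-1, 1} \<times> {-1, 1}" using that(1,2) by blast
    have "\<bar>depth (fst (w, \<sigma>)) y\<bar> \<le> d (w, \<sigma>)" using that(4) c[OF z] by simp
    with d[OF z] that(3) obtain a where "a \<in> A" "d (w, \<sigma>) \<le> \<sigma> * (of_int w * (f y w a \<bullet> e))" by auto
    with c[OF z] show ?thesis by (intro bexI[of _ a]) auto
  qed
  ultimately show ?thesis unfolding uniform_def by blast
qed

lemma A_nonempty: "A \<noteq> {}"
proof -
  have "\<rho> (-1) *\<^sub>R e \<in> frontier (sector e \<rho> 1)"
    by (simp add: frontier_sector depth_def inner_same_Basis basis)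
  then show ?thesis using ctrl unfolding controllable_def by blast
qed

text \<open>
  A control value that drives the state into (\<open>\<sigma> = 1\<close>) or out of (\<open>\<sigma> = -1\<close>) the sector of mode \<open>w\<close> at rate \<open>c\<close>,
  if there is one; an arbitrary one far from the threshold, where no push is needed.
\<close>

definition push :: "real \<Rightarrow> real \<Rightarrow> int \<Rightarrow> 'x \<Rightarrow> 'a" where
  "push \<sigma> c w y = (SOME a. a \<in> A \<and>
     ((\<exists>a'\<in>A. c \<le> \<sigma> * (of_int w * (f y w a' \<bullet> e))) \<longrightarrow> c \<le> \<sigma> * (of_int w * (f y w a \<bullet> e))))"

lemma push_in: "push \<sigma> c w y \<in> A"
  and push_rate: "a' \<in> A \<Longrightarrow> c \<le> \<sigma> * (of_int w * (f y w a' \<bullet> e)) \<Longrightarrow> c \<le> \<sigma> * (of_int w * (f y w (push \<sigma> c w y) \<bullet> e))"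
proof -
  have "\<exists>a. a \<in> A \<and> ((\<exists>a'\<in>A. c \<le> \<sigma> * (of_int w * (f y w a' \<bullet> e))) \<longrightarrow> c \<le> \<sigma> * (of_int w * (f y w a \<bullet> e)))"
    using A_nonempty by blast
  from someI_ex[OF this]
  show "push \<sigma> c w y \<in> A"
    "a' \<in> A \<Longrightarrow> c \<le> \<sigma> * (of_int w * (f y w a' \<bullet> e)) \<Longrightarrow> c \<le> \<sigma> * (of_int w * (f y w (push \<sigma> c w y) \<bullet> e))"
    unfolding push_def by blast+
qed

text \<open>
  The control value is chosen at the initial point only. During the short time \<open>p\<close> the rate cannot drop
  below \<open>c / 2\<close>.
\<close>

lemma push_effect:
  assumes u: "uniform R c r" and w: "w \<in> {-1, 1}" and \<sigma>: "\<sigma> \<in> {-1, 1 :: real}"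
    and y: "norm (\<xi> s) \<le> R" "\<bar>depth w (\<xi> s)\<bar> \<le> r"
    and sol: "solves (\<lambda>_. w) (\<lambda>_. push \<sigma> c w (\<xi> s)) s (s + p) \<xi>" and s: "0 \<le> s"
    and p: "L * M * p \<le> c / 2" and t: "s \<le> t" "t \<le> s + p"
  shows "c / 2 * (t - s) \<le> \<sigma> * (depth w (\<xi> t) - depth w (\<xi> s))"
proof -
  define a where "a = push \<sigma> c w (\<xi> s)"
  have a: "a \<in> A" unfolding a_def by (rule push_in)
  have rate: "c \<le> \<sigma> * (of_int w * (f (\<xi> s) w a \<bullet> e))"
    using u w \<sigma> y unfolding uniform_def a_def by (metis push_rate)
  have ac: "(\<lambda>_. a) \<in> controls A" using a by (simp add: controls_def)
  have int: "((\<lambda>r. f (\<xi> r) w a) has_integral (\<xi> t - \<xi> s)) {s..t}"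
    using sol t unfolding solves_def a_def by auto
  have "((\<lambda>r. \<sigma> * (of_int w * (f (\<xi> r) w a \<bullet> e))) has_integral \<sigma> * (of_int w * ((\<xi> t - \<xi> s) \<bullet> e))) {s..t}"
    using has_integral_linear[OF int bounded_linear_inner_left[of e]]
    by (intro has_integral_mult_right) (simp add: o_def)
  moreover have "((\<lambda>_. c / 2) has_integral (c / 2 * (t - s))) {s..t}"
    using has_integral_const_real[of "c / 2" s t] t by (simp add: mult.commute)
  moreover have "c / 2 \<le> \<sigma> * (of_int w * (f (\<xi> r) w a \<bullet> e))" if r: "r \<in> {s..t}" for r
  proof -
    have "\<bar>(f (\<xi> r) w a - f (\<xi> s) w a) \<bullet> e\<bar> \<le> norm (f (\<xi> r) w a - f (\<xi> s) w a)"
      using Cauchy_Schwarz_ineq2[of _ e] by (simp add: e_norm)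
    also have "\<dots> \<le> L * norm (\<xi> r - \<xi> s)" by (rule lipschitz[OF w a])
    also have "\<dots> \<le> L * (M * p)"
    proof (rule mult_left_mono)
      have "norm (\<xi> r - \<xi> s) \<le> M * (r - s)"
        using solves_speed[OF sol[folded a_def] order_refl _ _ s ac] r t w by auto
      also have "\<dots> \<le> M * p" using r t M_pos by (intro mult_left_mono) auto
      finally show "norm (\<xi> r - \<xi> s) \<le> M * p" .
    qed (use L_pos in simp)
    finally have "\<bar>f (\<xi> r) w a \<bullet> e - f (\<xi> s) w a \<bullet> e\<bar> \<le> c / 2" using p by (simp add: inner_diff_left mult.assoc)
    then have "f (\<xi> r) w a \<bullet> e - f (\<xi> s) w a \<bullet> e \<le> c / 2" "f (\<xi> s) w a \<bullet> e - f (\<xi> r) w a \<bullet> e \<le> c / 2"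
      by linarith+
    with rate w \<sigma> show ?thesis by auto
  qed
  ultimately have "c / 2 * (t - s) \<le> \<sigma> * (of_int w * ((\<xi> t - \<xi> s) \<bullet> e))"
    by (meson has_integral_le)
  then show ?thesis by (simp add: depth_diff[OF w])
qed


definition flip_time :: "(real \<Rightarrow> int) \<Rightarrow> real \<Rightarrow> real" where
  "flip_time W h = Sup {t \<in> {0..h}. W t = W 0}"

lemma flip_time:
  assumes "hybrid \<alpha> X W" "\<alpha> \<in> controls A" "0 < h" "M * h < gap"
  defines "\<tau> \<equiv> flip_time W h"
  shows "0 \<le> \<tau>" "\<tau> \<le> h" "\<And>t. 0 \<le> t \<Longrightarrow> t \<le> \<tau> \<Longrightarrow> W t = W 0"
    "\<And>t. \<tau> < t \<Longrightarrow> t \<le> h \<Longrightarrow> W t = - W 0" "\<tau> < h \<Longrightarrow> depth (W 0) (X \<tau>) = 0"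
proof -
  obtain \<tau>' where \<tau>': "0 \<le> \<tau>'" "\<tau>' \<le> h" "\<And>t. 0 \<le> t \<Longrightarrow> t \<le> \<tau>' \<Longrightarrow> W t = W 0"
    "\<And>t. \<tau>' < t \<Longrightarrow> t \<le> h \<Longrightarrow> W t = - W 0" "\<tau>' < h \<Longrightarrow> depth (W 0) (X \<tau>') = 0"
    using hybrid_flip[OF assms(1-4)] by metis
  have "- W 0 \<noteq> W 0" using hybridD(1)[OF assms(1), of 0] by auto
  then have "W t = W 0 \<longleftrightarrow> t \<le> \<tau>'" if "0 \<le> t" "t \<le> h" for t
    using \<tau>'(3)[of t] \<tau>'(4)[of t] that by (cases "t \<le> \<tau>'") simp_all
  then have "{t \<in> {0..h}. W t = W 0} = {0..\<tau>'}"
    using \<tau>'(1,2) by auto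
  then have "\<tau> = \<tau>'" unfolding \<tau>_def flip_time_def using \<tau>'(1) by simp
  show "0 \<le> \<tau>" "\<tau> \<le> h" "\<And>t. 0 \<le> t \<Longrightarrow> t \<le> \<tau> \<Longrightarrow> W t = W 0"
    "\<And>t. \<tau> < t \<Longrightarrow> t \<le> h \<Longrightarrow> W t = - W 0" "\<tau> < h \<Longrightarrow> depth (W 0) (X \<tau>) = 0"
    unfolding \<open>\<tau> = \<tau>'\<close> by (fact \<tau>')+
qed

text \<open>
  The tracking control over one step: a push of length \<open>p\<close> into the sector, then the given control;
  if the tracked trajectory switches at \<open>\<tau>\<close>, a push of length \<open>q\<close> out of the sector is inserted at the
  corresponding time.
\<close>

definition step :: "real \<Rightarrow> real \<Rightarrow> real \<Rightarrow> real \<Rightarrow> 'x \<Rightarrow> int \<Rightarrow> real \<Rightarrow> (real \<Rightarrow> 'a) \<Rightarrow> real \<Rightarrow> 'a" where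
  "step p q h c x' w' \<tau> \<alpha> =
     (let \<beta> = ins 0 p (push 1 c w' x') \<alpha>
      in if \<tau> < h then ins (p + \<tau>) q (push (-1) c w' (pos x' w' \<beta> (p + \<tau>))) \<beta> else \<beta>)"

definition duration :: "real \<Rightarrow> real \<Rightarrow> real \<Rightarrow> real \<Rightarrow> real" where
  "duration p q h \<tau> = (if \<tau> < h then p + q + h else p + h)"

text \<open>
  If the tracking error is \<open>E\<close>, the pushes inwards and outwards have lengths \<open>k1 c * E\<close> and \<open>k2 c * E\<close>. At rate
  \<open>c / 2\<close>, they outweigh the error together with its growth during the step. The error at the end of the
  step is at most \<open>k3 c * E\<close>.
\<close>

definition k1 :: "real \<Rightarrow> real" where "k1 c = 16 / c"
definition k2 :: "real \<Rightarrow> real" where "k2 c = 24 * (1 + M * k1 c) / c"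
definition k3 :: "real \<Rightarrow> real" where "k3 c = 6 * (6 * (1 + M * k1 c) + M * k2 c)"

primrec follow :: "real \<Rightarrow> real \<Rightarrow> nat \<Rightarrow> real \<Rightarrow> 'x \<Rightarrow> int \<Rightarrow> 'x \<Rightarrow> int \<Rightarrow> (real \<Rightarrow> 'a) \<Rightarrow> real \<Rightarrow> 'a" where
  "follow c h 0 E x w x' w' \<alpha> = \<alpha>"
| "follow c h (Suc n) E x w x' w' \<alpha> =
     (let \<tau> = flip_time (mode x w \<alpha>) h;
          \<beta> = step (k1 c * E) (k2 c * E) h c x' w' \<tau> \<alpha>;
          H = duration (k1 c * E) (k2 c * E) h \<tau>
      in conc H \<beta> (follow c h n (k3 c * E) (pos x w \<alpha> h) (mode x w \<alpha> h)
           (pos x' w' \<beta> H) (mode x' w' \<beta> H) (\<lambda>t. \<beta> (H + t))))"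

lemma k_nonneg: "0 < c \<Longrightarrow> 0 \<le> k1 c" "0 < c \<Longrightarrow> 0 \<le> k2 c" "0 < c \<Longrightarrow> 0 < k3 c"
  using M_pos by (auto simp: k1_def k2_def k3_def intro!: add_pos_nonneg)

lemma step_controls:
  assumes "\<alpha> \<in> controls A" "0 \<le> p" "0 \<le> q" "0 \<le> \<tau>"
  shows "step p q h c x' w' \<tau> \<alpha> \<in> controls A"
  using assms unfolding step_def Let_def by (auto intro!: ins_controls push_in)

lemma step_resumes:
  assumes "0 \<le> p" "0 \<le> q" "0 \<le> \<tau>" "\<tau> \<le> h" "0 \<le> t"
  shows "step p q h c x' w' \<tau> \<alpha> (duration p q h \<tau> + t) = \<alpha> (h + t)"
  using assms by (auto simp: step_def duration_def Let_def ins_def algebra_simps)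

lemma follow_controls:
  assumes c: "0 < c" and h: "0 < h" "M * h < gap"
  shows "\<lbrakk>\<alpha> \<in> controls A; 0 \<le> E; w \<in> {-1, 1}; 0 \<le> depth w x; w' \<in> {-1, 1}; 0 \<le> depth w' x'\<rbrakk>
    \<Longrightarrow> follow c h n E x w x' w' \<alpha> \<in> controls A"
proof (induction n arbitrary: E x w x' w' \<alpha>)
  case (Suc n)
  define p q \<tau> where "p = k1 c * E" and "q = k2 c * E" and "\<tau> = flip_time (mode x w \<alpha>) h"
  define \<beta> H where "\<beta> = step p q h c x' w' \<tau> \<alpha>" and "H = duration p q h \<tau>"
  have pq: "0 \<le> p" "0 \<le> q" using k_nonneg[OF c] Suc.prems by (auto simp: p_def q_def)
  note tr = trajectory_hybrid[OF Suc.prems(1,3,4)]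
  note \<tau> = flip_time[OF tr(1) Suc.prems(1) h, folded \<tau>_def]
  have H: "0 \<le> H" using pq h by (simp add: H_def duration_def)
  have \<beta>: "\<beta> \<in> controls A" unfolding \<beta>_def by (rule step_controls[OF Suc.prems(1) pq \<tau>(1)])
  note tr' = trajectory_hybrid[OF \<beta> Suc.prems(5,6)]
  have h0: "0 \<le> h" using h by simp
  have "follow c h n (k3 c * E) (pos x w \<alpha> h) (mode x w \<alpha> h) (pos x' w' \<beta> H) (mode x' w' \<beta> H)
      (\<lambda>t. \<beta> (H + t)) \<in> controls A"
    using k_nonneg[OF c] Suc.prems(2) hybridD(1,2)[OF tr(1) h0] hybridD(1,2)[OF tr'(1) H]
    by (intro Suc.IH controls_shift[OF \<beta> H]) auto
  from conc_controls[OF \<beta> this H]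
  show ?case by (simp add: Let_def p_def q_def \<tau>_def \<beta>_def H_def)
qed simp

text \<open>
  Where the outward push is inserted depends on a switching of the tracked trajectory, which shows only
  immediately after it happens. The initial push has delayed the replay by \<open>p\<close>, so the information comes
  early enough.
\<close>

lemma step_causal:
  fixes c :: real
  assumes \<alpha>: "\<alpha>1 \<in> controls A" "\<alpha>2 \<in> controls A" and eq: "aeq t \<alpha>1 \<alpha>2" and t: "0 \<le> t"
    and w: "w \<in> {-1, 1}" "0 \<le> depth w x" and w': "w' \<in> {-1, 1}" "0 \<le> depth w' x'"
    and h: "0 < h" "M * h < gap" and pq: "0 \<le> p" "0 \<le> q"
  defines "\<tau>1 \<equiv> flip_time (mode x w \<alpha>1) h" and "\<tau>2 \<equiv> flip_time (mode x w \<alpha>2) h"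
  defines "\<beta>1 \<equiv> step p q h c x' w' \<tau>1 \<alpha>1" and "\<beta>2 \<equiv> step p q h c x' w' \<tau>2 \<alpha>2"
  shows "t < h \<Longrightarrow> aeq (t + p) \<beta>1 \<beta>2"
    and "h \<le> t \<Longrightarrow> \<tau>1 = \<tau>2 \<and> aeq (duration p q h \<tau>1 + (t - h)) \<beta>1 \<beta>2"
proof -
  note tr1 = trajectory_hybrid[OF \<alpha>(1) w] and tr2 = trajectory_hybrid[OF \<alpha>(2) w]
  note \<tau>1 = flip_time[OF tr1(1) \<alpha>(1) h, folded \<tau>1_def] and \<tau>2 = flip_time[OF tr2(1) \<alpha>(2) h, folded \<tau>2_def]
  have same: "pos x w \<alpha>1 r = pos x w \<alpha>2 r \<and> mode x w \<alpha>1 r = mode x w \<alpha>2 r" if "0 \<le> r" "r \<le> t" for r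
    by (rule hybrid_causal[OF tr1(1) tr2(1) \<alpha> _ _ eq that]) (use tr1(2,3) tr2(2,3) in simp_all)
  have ww: "- w \<noteq> w" using w by auto
  have flips: "\<tau>1 = \<tau>2 \<or> (t \<le> \<tau>1 \<and> t \<le> \<tau>2)"
  proof (rule ccontr)
    assume neg: "\<not> ?thesis"
    define r where "r = min (max \<tau>1 \<tau>2) t"
    have r: "0 \<le> r" "r \<le> t" "r \<le> h" using \<tau>1(1,2) \<tau>2(1,2) t by (auto simp: r_def)
    have "(\<tau>1 < \<tau>2 \<and> \<tau>1 < t) \<or> (\<tau>2 < \<tau>1 \<and> \<tau>2 < t)" using neg by linarith
    then have "(\<tau>1 < r \<and> r \<le> \<tau>2) \<or> (\<tau>2 < r \<and> r \<le> \<tau>1)" by (auto simp: r_def)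
    then consider "\<tau>1 < r" "r \<le> \<tau>2" | "\<tau>2 < r" "r \<le> \<tau>1" by blast
    then show False
    proof cases
      case 1
      have "mode x w \<alpha>1 r = - w" using \<tau>1(4)[OF 1(1) r(3)] tr1(3) by simp
      moreover have "mode x w \<alpha>2 r = w" using \<tau>2(3)[OF r(1) 1(2)] tr2(3) by simp
      ultimately show False using same[OF r(1,2)] ww by simp
    next
      case 2
      have "mode x w \<alpha>2 r = - w" using \<tau>2(4)[OF 2(1) r(3)] tr2(3) by simp
      moreover have "mode x w \<alpha>1 r = w" using \<tau>1(3)[OF r(1) 2(2)] tr1(3) by simp
      ultimately show False using same[OF r(1,2)] ww by simp
    qed
  qed
  define \<gamma>1 \<gamma>2 where "\<gamma>1 = ins 0 p (push 1 c w' x') \<alpha>1" and "\<gamma>2 = ins 0 p (push 1 c w' x') \<alpha>2"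
  have \<gamma>: "aeq (t + p) \<gamma>1 \<gamma>2" unfolding \<gamma>1_def \<gamma>2_def by (rule aeq_ins[OF eq order_refl t pq(1)])
  have c\<gamma>: "\<gamma>1 \<in> controls A" "\<gamma>2 \<in> controls A"
    unfolding \<gamma>1_def \<gamma>2_def using \<alpha> pq by (auto intro!: ins_controls push_in)
  note tr\<gamma>1 = trajectory_hybrid[OF c\<gamma>(1) w'] and tr\<gamma>2 = trajectory_hybrid[OF c\<gamma>(2) w']
  have \<beta>_eq: "\<beta>1 = (if \<tau>1 < h then ins (p + \<tau>1) q (push (-1) c w' (pos x' w' \<gamma>1 (p + \<tau>1))) \<gamma>1 else \<gamma>1)"
    "\<beta>2 = (if \<tau>2 < h then ins (p + \<tau>2) q (push (-1) c w' (pos x' w' \<gamma>2 (p + \<tau>2))) \<gamma>2 else \<gamma>2)"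
    by (simp_all add: \<beta>1_def \<beta>2_def step_def Let_def \<gamma>1_def \<gamma>2_def)
  have early: "aeq (t + p + q) \<beta>1 \<beta>2" if "\<tau>1 = \<tau>2" "\<tau>1 \<le> t" "\<tau>1 < h"
  proof -
    have "pos x' w' \<gamma>1 (p + \<tau>1) = pos x' w' \<gamma>2 (p + \<tau>1)"
      by (rule conjunct1[OF hybrid_causal[OF tr\<gamma>1(1) tr\<gamma>2(1) c\<gamma> _ _ \<gamma>]])
        (use tr\<gamma>1(2,3) tr\<gamma>2(2,3) pq(1) \<tau>1(1) that in simp_all)
    moreover have "aeq (t + p + q) (ins (p + \<tau>1) q a \<gamma>1) (ins (p + \<tau>1) q a \<gamma>2)" for a
      by (rule aeq_ins[OF \<gamma>]) (use that pq \<tau>1(1) in auto)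
    ultimately show ?thesis unfolding \<beta>_eq using that by simp
  qed
  show "aeq (t + p) \<beta>1 \<beta>2" if "t < h"
  proof (cases "\<tau>1 = \<tau>2 \<and> \<tau>1 \<le> t")
    case True
    then have "aeq (t + p + q) \<beta>1 \<beta>2" using that by (intro early) auto
    then show ?thesis by (rule aeq_mono) (use pq in simp)
  next
    case False
    then have le: "t \<le> \<tau>1" "t \<le> \<tau>2" using flips by auto
    have "aeq (t + p) \<beta>1 \<gamma>1" "aeq (t + p) \<gamma>2 \<beta>2"
      unfolding aeq_def \<beta>_eq using le
      by (auto simp: ins_def intro!: exI[of _ "{t + p}"])
    with \<gamma> show ?thesis by (blast intro: aeq_trans)
  qed
  show "\<tau>1 = \<tau>2 \<and> aeq (duration p q h \<tau>1 + (t - h)) \<beta>1 \<beta>2" if "h \<le> t"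
  proof -
    have "\<tau>1 = \<tau>2" using flips \<tau>1(2) \<tau>2(2) that by auto
    moreover have "aeq (duration p q h \<tau>1 + (t - h)) \<beta>1 \<beta>2"
    proof (cases "\<tau>1 < h")
      case True
      then have "aeq (t + p + q) \<beta>1 \<beta>2" using \<open>\<tau>1 = \<tau>2\<close> that by (intro early) auto
      then show ?thesis using True by (simp add: duration_def algebra_simps)
    next
      case False
      then show ?thesis using \<gamma> \<open>\<tau>1 = \<tau>2\<close> by (simp add: \<beta>_eq duration_def algebra_simps)
    qed
    ultimately show ?thesis ..
  qed
qed

text \<open>
  The delay is gained in the first step, by the push at its beginning, and is never lost.
\<close>

lemma follow_causal:
  assumes c: "0 < c" and h: "0 < h" "M * h < gap"
  shows "\<lbrakk>\<alpha>1 \<in> controls A; \<alpha>2 \<in> controls A; aeq t \<alpha>1 \<alpha>2; 0 \<le> t; 0 \<le> E;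
      w \<in> {-1, 1}; 0 \<le> depth w x; w' \<in> {-1, 1}; 0 \<le> depth w' x'\<rbrakk>
    \<Longrightarrow> aeq (if n = 0 then t else t + k1 c * E) (follow c h n E x w x' w' \<alpha>1) (follow c h n E x w x' w' \<alpha>2)"
proof (induction n arbitrary: t E x w x' w' \<alpha>1 \<alpha>2)
  case (Suc n)
  define p q where "p = k1 c * E" and "q = k2 c * E"
  define \<tau> where "\<tau> \<alpha> = flip_time (mode x w \<alpha>) h" for \<alpha>
  define \<beta> where "\<beta> \<alpha> = step p q h c x' w' (\<tau> \<alpha>) \<alpha>" for \<alpha>
  define H where "H \<alpha> = duration p q h (\<tau> \<alpha>)" for \<alpha>
  define F where "F \<alpha> = follow c h n (k3 c * E) (pos x w \<alpha> h) (mode x w \<alpha> h)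
    (pos x' w' (\<beta> \<alpha>) (H \<alpha>)) (mode x' w' (\<beta> \<alpha>) (H \<alpha>)) (\<lambda>t. \<beta> \<alpha> (H \<alpha> + t))" for \<alpha>
  have follow: "follow c h (Suc n) E x w x' w' \<alpha> = conc (H \<alpha>) (\<beta> \<alpha>) (F \<alpha>)" for \<alpha>
    by (simp add: Let_def p_def q_def \<tau>_def \<beta>_def H_def F_def)
  have pq: "0 \<le> p" "0 \<le> q" using k_nonneg[OF c] Suc.prems(5) by (auto simp: p_def q_def)
  have H: "0 \<le> H \<alpha>" "p + h \<le> H \<alpha>" for \<alpha> using pq h by (auto simp: H_def duration_def)
  have h0: "0 \<le> h" using h by simp
  have \<beta>: "\<beta> \<alpha> \<in> controls A" if "\<alpha> \<in> controls A" for \<alpha>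
    unfolding \<beta>_def using flip_time(1)[OF trajectory_hybrid(1)[OF that Suc.prems(6,7)] that h]
    by (intro step_controls[OF that pq]) (simp add: \<tau>_def)
  note causal = step_causal[OF Suc.prems(1-4,6-9) h pq, of c, folded \<tau>_def, folded \<beta>_def, folded H_def]
  have "aeq (t + p) (conc (H \<alpha>1) (\<beta> \<alpha>1) (F \<alpha>1)) (conc (H \<alpha>2) (\<beta> \<alpha>2) (F \<alpha>2))"
  proof (cases "t < h")
    case True
    have "aeq (t + p) (conc (H \<alpha>) (\<beta> \<alpha>) (F \<alpha>)) (\<beta> \<alpha>)" for \<alpha>
      using True H(2)[of \<alpha>] by (intro aeq_eqI) (simp add: conc_def)
    then show ?thesis using causal(1)[OF True] by (blast intro: aeq_trans aeq_sym)
  next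
    case False
    then have ht: "h \<le> t" by simp
    from causal(2)[OF ht] have \<tau>: "\<tau> \<alpha>1 = \<tau> \<alpha>2" and eq: "aeq (H \<alpha>1 + (t - h)) (\<beta> \<alpha>1) (\<beta> \<alpha>2)" by auto
    have HH: "H \<alpha>1 = H \<alpha>2" using \<tau> by (simp add: H_def)
    note tr1 = trajectory_hybrid[OF Suc.prems(1,6,7)] and tr2 = trajectory_hybrid[OF Suc.prems(2,6,7)]
    note tr1' = trajectory_hybrid[OF \<beta>[OF Suc.prems(1)] Suc.prems(8,9)]
      and tr2' = trajectory_hybrid[OF \<beta>[OF Suc.prems(2)] Suc.prems(8,9)]
    have 1: "pos x w \<alpha>1 h = pos x w \<alpha>2 h \<and> mode x w \<alpha>1 h = mode x w \<alpha>2 h"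
      by (rule hybrid_causal[OF tr1(1) tr2(1) Suc.prems(1,2) _ _ Suc.prems(3) h0 ht]) (use tr1(2,3) tr2(2,3) in simp_all)
    have 2: "pos x' w' (\<beta> \<alpha>1) (H \<alpha>1) = pos x' w' (\<beta> \<alpha>2) (H \<alpha>1) \<and>
        mode x' w' (\<beta> \<alpha>1) (H \<alpha>1) = mode x' w' (\<beta> \<alpha>2) (H \<alpha>1)"
      by (rule hybrid_causal[OF tr1'(1) tr2'(1) \<beta>[OF Suc.prems(1)] \<beta>[OF Suc.prems(2)] _ _ eq])
        (use tr1'(2,3) tr2'(2,3) H(1) ht in simp_all)
    have shift: "aeq (t - h) (\<lambda>t. \<beta> \<alpha>1 (H \<alpha>1 + t)) (\<lambda>t. \<beta> \<alpha>2 (H \<alpha>2 + t))"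
      using aeq_shift[OF eq H(1)[of \<alpha>1]] by (simp add: HH)
    have E3: "0 \<le> k3 c * E" using k_nonneg(3)[OF c] Suc.prems(5) by simp
    have "aeq (if n = 0 then t - h else t - h + k1 c * (k3 c * E)) (F \<alpha>1) (F \<alpha>2)"
      unfolding F_def using 1 2 HH ht E3
      using hybridD(1,2)[OF tr2(1) h0] hybridD(1,2)[OF tr2'(1) H(1)]
        Suc.IH[OF controls_shift[OF \<beta>[OF Suc.prems(1)] H(1)] controls_shift[OF \<beta>[OF Suc.prems(2)] H(1)] shift, of "k3 c * E"]
      by simp
    then have "aeq (t - h) (F \<alpha>1) (F \<alpha>2)"
      by (rule aeq_mono) (use k_nonneg(1)[OF c] E3 in simp)
    then have "aeq (H \<alpha>1 + (t - h)) (conc (H \<alpha>1) (\<beta> \<alpha>1) (F \<alpha>1)) (conc (H \<alpha>1) (\<beta> \<alpha>2) (F \<alpha>2))"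
      using ht by (intro aeq_conc[OF eq _ _ H(1)]) auto
    then show ?thesis using H(2)[of \<alpha>1] unfolding HH by (elim aeq_mono) simp
  qed
  then show ?case unfolding follow p_def by simp
qed simp

text \<open>
  The length \<open>h\<close> of a step is such that errors grow by a factor of at most \<open>6\<close>, that the drift caused by an
  inward push of length \<open>p\<close> costs at most \<open>c p / 4\<close> of the gain \<open>c p / 2\<close>, and that a trajectory starting
  farther than \<open>r\<close> from the threshold does not reach it. In \<open>small\<close>, the pushes are so short that they keep
  the rate \<open>c / 2\<close> and that the outward one starts within \<open>r\<close> of the threshold.
\<close>

definition admissible :: "real \<Rightarrow> real \<Rightarrow> real \<Rightarrow> bool" where
  "admissible c r h \<longleftrightarrow> 0 < h \<and> 2 * L * h \<le> 1 \<and> 24 * L * h * M \<le> c \<and> M * h \<le> r / 4 \<and>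
     M * h \<le> gap / 4 \<and> M * h \<le> 1"

definition small :: "real \<Rightarrow> real \<Rightarrow> real \<Rightarrow> bool" where
  "small c r E \<longleftrightarrow> 0 < E \<and> L * M * (k1 c * E) \<le> c / 2 \<and> L * M * (k2 c * E) \<le> c / 2 \<and>
     M * (k1 c * E + k2 c * E) \<le> gap / 4 \<and> M * (k1 c * E) \<le> r / 4 \<and>
     6 * (E + M * (k1 c * E)) \<le> r \<and> 6 * (E + M * (k1 c * E)) \<le> 1"

lemma admissible_exists: "0 < c \<Longrightarrow> 0 < r \<Longrightarrow> \<exists>h. admissible c r h"
proof -
  assume c: "0 < c" and r: "0 < r"
  define S where "S = 2 * L + 24 * L * M + M"
  define b where "b = Min {1, c, r / 4, gap / 4}"
  have S: "0 < S" using L_pos M_pos by (simp add: S_def add_pos_pos)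
  have b: "0 < b" "b \<le> 1" "b \<le> c" "b \<le> r / 4" "b \<le> gap / 4" using c r gap_pos by (auto simp: b_def)
  define h where "h = b / S"
  have h: "0 < h" using b(1) S by (simp add: h_def)
  have *: "K * h \<le> b" if "K \<le> S" for K
    using mult_right_mono[OF that, of h] h S by (simp add: h_def)
  have n: "0 < L * M" using L_pos M_pos by simp
  have "2 * L * h \<le> b" by (rule *) (use n L_pos M_pos in \<open>simp add: S_def\<close>)
  moreover have "24 * L * M * h \<le> b" by (rule *) (use n L_pos M_pos in \<open>simp add: S_def\<close>)
  moreover have "M * h \<le> b" by (rule *) (use n L_pos M_pos in \<open>simp add: S_def\<close>)
  moreover have "24 * L * M * h = 24 * L * h * M" by simp
  ultimately have "admissible c r h"
    unfolding admissible_def using b h by linarith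
  then show ?thesis ..
qed

lemma small_exists: "0 < c \<Longrightarrow> 0 < r \<Longrightarrow> \<exists>E. small c r E"
proof -
  assume c: "0 < c" and r: "0 < r"
  define S where "S = 1 + L * M * k1 c + L * M * k2 c + M * (k1 c + k2 c) + 6 * (1 + M * k1 c)"
  define b where "b = Min {1, c / 2, r / 4, gap / 4}"
  have k: "0 \<le> k1 c" "0 \<le> k2 c" using k_nonneg[OF c] by auto
  have n: "0 \<le> L * M * k1 c" "0 \<le> L * M * k2 c" "0 \<le> M * k1 c" "0 \<le> M * k2 c"
    using k L_pos M_pos by simp_all
  have S: "0 < S" using n by (simp add: S_def distrib_left)
  have b: "0 < b" "b \<le> 1" "b \<le> c / 2" "b \<le> r / 4" "b \<le> gap / 4" using c r gap_pos by (auto simp: b_def)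
  define E where "E = b / S"
  have E: "0 < E" using b(1) S by (simp add: E_def)
  have *: "K * E \<le> b" if "K \<le> S" for K
    using mult_right_mono[OF that, of E] E S by (simp add: E_def)
  have "L * M * k1 c * E \<le> b" by (rule *) (use n in \<open>simp add: S_def distrib_left\<close>)
  moreover have "L * M * k2 c * E \<le> b" by (rule *) (use n in \<open>simp add: S_def distrib_left\<close>)
  moreover have "M * (k1 c + k2 c) * E \<le> b" by (rule *) (use n in \<open>simp add: S_def distrib_left\<close>)
  moreover have "M * k1 c * E \<le> b" by (rule *) (use n in \<open>simp add: S_def distrib_left\<close>)
  moreover have "6 * (1 + M * k1 c) * E \<le> b" by (rule *) (use n in \<open>simp add: S_def distrib_left\<close>)
  moreover have "L * M * k1 c * E = L * M * (k1 c * E)" "L * M * k2 c * E = L * M * (k2 c * E)"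
    "M * (k1 c + k2 c) * E = M * (k1 c * E + k2 c * E)" "M * k1 c * E = M * (k1 c * E)"
    "6 * (1 + M * k1 c) * E = 6 * (E + M * (k1 c * E))"
    by (simp_all add: algebra_simps)
  ultimately have "small c r E"
    unfolding small_def using b r E by linarith
  then show ?thesis ..
qed

lemma small_mono:
  assumes "0 < c" "small c r E'" "0 < E" "E \<le> E'" shows "small c r E"
proof -
  have "k1 c * E \<le> k1 c * E'" "k2 c * E \<le> k2 c * E'"
    using k_nonneg[OF assms(1)] assms by (auto intro: mult_left_mono)
  then have "M * (k1 c * E) \<le> M * (k1 c * E')" "M * (k1 c * E + k2 c * E) \<le> M * (k1 c * E' + k2 c * E')"
    "L * M * (k1 c * E) \<le> L * M * (k1 c * E')" "L * M * (k2 c * E) \<le> L * M * (k2 c * E')"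
    using L_pos M_pos by (auto intro!: mult_left_mono)
  then show ?thesis using assms unfolding small_def by (auto intro: order_trans)
qed


lemma stability_short:
  assumes "solves (\<lambda>_. w) \<alpha> 0 T X" "solves (\<lambda>_. w) \<alpha> 0 T X'" "\<alpha> \<in> controls A" "w \<in> {-1, 1}"
    and "0 \<le> t" "t \<le> T" "t \<le> h" "2 * L * h \<le> 1"
  shows "norm (X t - X' t) \<le> 6 * norm (X 0 - X' 0)"
proof -
  have "2 * L * t \<le> 2 * L * h" using assms(7) L_pos by simp
  then have "exp (2 * L * t) \<le> exp 1" using assms(8) by simp
  also have "\<dots> \<le> 3" by (rule exp_le)
  finally have "2 * exp (2 * L * t) * norm (X 0 - X' 0) \<le> 6 * norm (X 0 - X' 0)"
    by (intro mult_right_mono) auto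
  moreover have "norm (X t - X' t) \<le> 2 * exp (2 * L * (t - 0)) * norm (X 0 - X' 0)"
    by (rule solves_stability[OF assms(1,2) order_refl assms(3,3) _ negligible_empty]) (use assms in auto)
  then have "norm (X t - X' t) \<le> 2 * exp (2 * L * t) * norm (X 0 - X' 0)" by simp
  ultimately show ?thesis by linarith
qed

text \<open>
  During the initial push the tracking trajectory gains more depth than it can lose to the tracked one
  in the rest of the step, so it cannot leave the sector first. When the tracked trajectory switches,
  the tracking one is close to the threshold, and the outward push makes it switch too; afterwards both
  are far from the threshold of the new mode.
\<close>

lemma step_tracking:
  assumes u: "uniform (R + 2) c r" and ad: "admissible c r h" and sm: "small c r E"
    and \<alpha>: "\<alpha> \<in> controls A" and hyb: "hybrid \<alpha> X W" and w: "W 0 = w"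
    and R: "norm (X 0) \<le> R" and E: "norm (X 0 - x') \<le> E" and x': "0 \<le> depth w x'"
  defines "p \<equiv> k1 c * E" and "q \<equiv> k2 c * E" and "\<tau> \<equiv> flip_time W h"
  defines "\<beta> \<equiv> step p q h c x' w \<tau> \<alpha>" and "H \<equiv> duration p q h \<tau>"
  defines "X' \<equiv> pos x' w \<beta>" and "W' \<equiv> mode x' w \<beta>"
  shows "norm (X h - X' H) \<le> k3 c * E" "W' H = W h"
    "\<And>t. 0 \<le> t \<Longrightarrow> t \<le> h \<Longrightarrow> norm (X' t - X t) \<le> k3 c * E + M * (p + q)"
    "integral {0..h} (\<lambda>t. \<bar>real_of_int (W' t) - real_of_int (W t)\<bar>) \<le> 2 * (p + q)"
proof -
  have c: "0 < c" and r: "0 < r" using u by (auto simp: uniform_def)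
  have h: "0 < h" "2 * L * h \<le> 1" "24 * L * h * M \<le> c" "M * h \<le> r / 4" "M * h \<le> gap / 4" "M * h \<le> 1"
    using ad by (auto simp: admissible_def)
  define D where "D = E + M * p"
  have E_pos: "0 < E" and s: "L * M * p \<le> c / 2" "L * M * q \<le> c / 2" "M * (p + q) \<le> gap / 4" "M * p \<le> r / 4"
    "6 * D \<le> r" "6 * D \<le> 1"
    using sm by (auto simp: small_def p_def q_def D_def)
  have pq: "0 \<le> p" "0 \<le> q" using k_nonneg[OF c] E_pos by (auto simp: p_def q_def)
  have D: "E \<le> D" "0 < D" using E_pos pq M_pos by (auto simp: D_def add_pos_nonneg)
  have cp: "c * p = 16 * E" using c by (simp add: p_def k1_def)
  have cq: "c * q = 24 * D" using c by (simp add: q_def k2_def D_def p_def field_simps)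
  have k3: "k3 c * E = 6 * (6 * D + M * q)"
    by (simp add: k3_def D_def p_def q_def algebra_simps)
  have wm: "w \<in> {-1, 1}" using hybridD(1)[OF hyb, of 0] w by simp
  have hg: "M * h < gap" using h(5) gap_pos by linarith
  note \<tau> = flip_time[OF hyb \<alpha> h(1) hg, folded \<tau>_def, unfolded w]
  define T where "T = p + q + h"
  have T: "0 < T" "M * T < gap"
    using pq h(1) s(3) h(5) gap_pos by (auto simp: T_def distrib_left)
  have \<beta>: "\<beta> \<in> controls A" unfolding \<beta>_def by (rule step_controls[OF \<alpha> pq \<tau>(1)])
  note tr = trajectory_hybrid[OF \<beta> wm x', folded X'_def W'_def]
  obtain \<xi> where \<xi>0: "\<xi> 0 = x'" and \<xi>: "\<And>T. solves (\<lambda>_. w) \<beta> 0 T \<xi>"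
    using mode_exists[OF \<beta> order_refl wm] by blast
  have \<xi>_speed: "norm (\<xi> t' - \<xi> t) \<le> M * (t' - t)" if "0 \<le> t" "t \<le> t'" for t t'
    using solves_speed[OF \<xi> that order_refl order_refl \<beta>] wm by simp
  have \<xi>_depth: "\<bar>depth w (\<xi> t') - depth w (\<xi> t)\<bar> \<le> M * (t' - t)" if "0 \<le> t" "t \<le> t'" for t t'
    using depth_lipschitz[OF wm, of "\<xi> t'" "\<xi> t"] \<xi>_speed[OF that] by linarith
  have X_speed: "norm (X t' - X t) \<le> M * \<bar>t' - t\<bar>" if "0 \<le> t" "0 \<le> t'" for t t'
    by (rule hybrid_speed[OF hyb \<alpha> that])
  have X'_speed: "norm (X' t' - X' t) \<le> M * \<bar>t' - t\<bar>" if "0 \<le> t" "0 \<le> t'" for t t'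
    by (rule hybrid_speed[OF tr(1) \<beta> that])
  define a where "a = push 1 c w x'"
  define \<gamma> where "\<gamma> = ins 0 p a \<alpha>"
  have \<beta>1: "\<beta> t = a" if "0 \<le> t" "t < p" for t
    using that pq \<tau>(1) by (simp add: \<beta>_def step_def Let_def ins_def a_def)
  have \<beta>2: "\<beta> (p + t) = \<alpha> t" if "0 \<le> t" "t < \<tau>" for t
    using that pq by (simp add: \<beta>_def step_def Let_def ins_def)
  have \<beta>\<gamma>: "\<beta> t = \<gamma> t" if "0 \<le> t" "t < p + \<tau>" for t
    using that by (simp add: \<beta>_def step_def Let_def ins_def a_def \<gamma>_def)

  have start: "norm (\<xi> p - X 0) \<le> D"
    using \<xi>_speed[of 0 p] pq \<xi>0 E norm_triangle_ineq[of "\<xi> p - x'" "x' - X 0"]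
    by (simp add: D_def norm_minus_commute)
  have solX: "solves (\<lambda>_. w) \<alpha> 0 \<tau> X"
    by (rule solves_cong[OF hybridD(3)[OF hyb, of \<tau>] negligible_empty]) (use \<tau>(3) in simp_all)
  have sol\<xi>: "solves (\<lambda>_. w) \<alpha> 0 \<tau> (\<lambda>t. \<xi> (p + t))"
  proof (rule solves_cong[OF _ negligible_sing[of \<tau>]])
    show "solves (\<lambda>_. w) (\<lambda>t. \<beta> (p + t)) 0 \<tau> (\<lambda>t. \<xi> (p + t))"
      using solves_shift[OF solves_sub[OF \<xi>[of "p + \<tau>"] pq(1) order_refl], of p] by simp
    show "w = w \<and> \<beta> (p + t) = \<alpha> t" if "t \<in> {0..\<tau>} - {\<tau>}" for t using \<beta>2[of t] that by auto
  qed simp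
  have near: "norm (\<xi> (p + t) - X t) \<le> 6 * D" if "0 \<le> t" "t \<le> \<tau>" for t
    using stability_short[OF sol\<xi> solX \<alpha> wm that _ h(2)] that \<tau>(2) start by simp
  have in_sector: "0 \<le> depth w (\<xi> t)" if t: "0 \<le> t" "t \<le> p + \<tau>" for t
  proof (cases "depth w x' \<le> r")
    case False
    have "M * t \<le> M * (p + h)" using t \<tau>(2) M_pos by simp
    then have "M * t \<le> r / 2" using s(4) h(4) by (simp add: distrib_left)
    with \<xi>_depth[of 0 t] t False \<xi>0 r show ?thesis by simp
  next
    case True
    have "norm (\<xi> 0) \<le> R + 2"
      using R E D s(6) norm_triangle_ineq[of "X 0" "x' - X 0"] \<xi>0 by (simp add: norm_minus_commute)
    moreover have "\<bar>depth w (\<xi> 0)\<bar> \<le> r" using True x' \<xi>0 by simp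
    moreover have "solves (\<lambda>_. w) (\<lambda>_. push 1 c w (\<xi> 0)) 0 (0 + p) \<xi>"
      by (rule solves_cong[OF \<xi> negligible_sing[of p]]) (use \<beta>1 \<xi>0 in \<open>auto simp: a_def\<close>)
    ultimately have gain: "c / 2 * t \<le> depth w (\<xi> t) - depth w x'" if "0 \<le> t" "t \<le> p" for t
      using push_effect[OF u wm, of 1 \<xi> 0 p t] s(1) that \<xi>0 by simp
    show ?thesis
    proof (cases "t \<le> p")
      case True
      then have "0 \<le> c / 2 * t" using c t by simp
      with gain[OF t(1) True] x' show ?thesis by linarith
    next
      case False
      define d where "d = t - p"
      have d: "0 \<le> d" "d \<le> \<tau>" "t = p + d" using False t by (auto simp: d_def)
      have "norm ((\<xi> (p + d) - \<xi> (p + 0)) - (X d - X 0)) \<le> (L * (6 * D)) * (d - 0)"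
      proof (rule has_integral_norm_le)
        show "((\<lambda>t. f (\<xi> (p + t)) w (\<alpha> t) - f (X t) w (\<alpha> t)) has_integral
            ((\<xi> (p + d) - \<xi> (p + 0)) - (X d - X 0))) {0..d}"
          using sol\<xi> solX d unfolding solves_def by (intro has_integral_diff) auto
        show "norm (f (\<xi> (p + t)) w (\<alpha> t) - f (X t) w (\<alpha> t)) \<le> L * (6 * D)" if "t \<in> {0..d}" for t
        proof -
          have "norm (f (\<xi> (p + t)) w (\<alpha> t) - f (X t) w (\<alpha> t)) \<le> L * norm (\<xi> (p + t) - X t)"
            by (rule lipschitz[OF wm control_in[OF \<alpha>]]) (use that in simp)
          also have "\<dots> \<le> L * (6 * D)" using near[of t] that d L_pos by simp
          finally show ?thesis .
        qed
      qed (use d L_pos D in auto)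
      also have "\<dots> \<le> (L * (6 * D)) * h" using d \<tau>(2) L_pos D by (intro mult_left_mono) auto
      also have "\<dots> = 3 * (2 * L * h) * E + (24 * L * h * M) * p / 4" by (simp add: D_def algebra_simps)
      also have "\<dots> \<le> 3 * 1 * E + c * p / 4"
        using h(2,3) E_pos pq by (intro add_mono mult_right_mono divide_right_mono mult_left_mono) auto
      also have "\<dots> = 7 * E" using cp by simp
      finally have drift: "norm ((\<xi> (p + d) - \<xi> p) - (X d - X 0)) \<le> 7 * E" by simp
      have "\<bar>(depth w (\<xi> (p + d)) - depth w (\<xi> p)) - (depth w (X d) - depth w (X 0))\<bar>
          = \<bar>((\<xi> (p + d) - \<xi> p) - (X d - X 0)) \<bullet> e\<bar>"
        using wm by (auto simp: depth_diff[OF wm] inner_diff_left)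
      also have "\<dots> \<le> norm ((\<xi> (p + d) - \<xi> p) - (X d - X 0))"
        using Cauchy_Schwarz_ineq2[of _ e] by (simp add: e_norm)
      finally have 1: "\<bar>(depth w (\<xi> (p + d)) - depth w (\<xi> p)) - (depth w (X d) - depth w (X 0))\<bar> \<le> 7 * E"
        using drift by linarith
      have 2: "8 * E \<le> depth w (\<xi> p) - depth w x'" using gain[of p] pq cp by simp
      have 3: "\<bar>depth w (X 0) - depth w x'\<bar> \<le> E" using depth_lipschitz[OF wm, of "X 0" x'] E by linarith
      have 4: "0 \<le> depth w (X d)" using hybridD(2)[OF hyb d(1)] \<tau>(3)[OF d(1,2)] by simp
      from 1 2 3 4 show ?thesis unfolding d(3) by linarith
    qed
  qed

  have \<xi>0': "\<xi> 0 = X' 0" using \<xi>0 tr(2) by simp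
  obtain \<tau>' where "switches_at (W' 0) X' W' \<xi> 0 (0 + T) \<tau>'"
    using hybridD(4)[OF tr(1) order_refl T, of \<xi>] \<xi> \<xi>0' unfolding tr(3) by blast
  note \<tau>' = switches_atD[OF this[unfolded tr(3)]]
  have \<tau>'_ge: "p + \<tau> \<le> \<tau>'"
  proof (rule ccontr)
    assume neg: "\<not> ?thesis"
    moreover have "p + \<tau> \<le> 0 + T" using \<tau>(2) pq by (simp add: T_def)
    ultimately have "\<exists>t\<in>{\<tau>'<..<p + \<tau>}. depth w (\<xi> t) < 0" by (intro \<tau>'(6)) auto
    then obtain t where "\<tau>' < t" "t < p + \<tau>" "depth w (\<xi> t) < 0" by auto
    with in_sector[of t] \<tau>'(1) show False by simp
  qed
  have X'\<xi>: "X' t = \<xi> t" "W' t = w" if "0 \<le> t" "t \<le> p + \<tau>" for t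
    using \<tau>'(3)[of t] that \<tau>'_ge by auto
  have upto: "norm (X' (p + t) - X t) \<le> 6 * D" if "0 \<le> t" "t \<le> \<tau>" for t
    using near[OF that] X'\<xi>(1)[of "p + t"] that pq by simp

  have k3_ge: "6 * D \<le> k3 c * E" using D pq M_pos unfolding k3 by simp
  have result: "norm (X h - X' H) \<le> k3 c * E \<and> W' H = W h \<and>
      (\<forall>t. \<tau> < t \<longrightarrow> t \<le> h \<longrightarrow> norm (X' (p + q + t) - X t) \<le> k3 c * E) \<and> \<tau>' \<le> p + q + \<tau>"
  proof (cases "\<tau> < h")
    case False
    then have \<tau>h: "\<tau> = h" using \<tau>(2) by simp
    have H: "H = p + h" by (simp add: H_def duration_def \<tau>h)
    have "W' H = w" using X'\<xi>(2)[of H] pq h(1) by (simp add: H \<tau>h)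
    moreover have "W h = w" using \<tau>(3)[of h] h(1) \<tau>h by simp
    moreover have "norm (X h - X' H) \<le> k3 c * E"
      using upto[of h] k3_ge h(1) unfolding H \<tau>h by (simp add: norm_minus_commute)
    moreover have "\<tau>' \<le> p + q + \<tau>" using \<tau>'(2) by (simp add: T_def \<tau>h)
    ultimately show ?thesis using \<tau>h by simp
  next
    case True
    have H: "H = p + q + h" using True by (simp add: H_def duration_def)
    define y where "y = \<xi> (p + \<tau>)"
    have p\<tau>: "0 \<le> p + \<tau>" using pq \<tau>(1) by simp
    have \<gamma>c: "\<gamma> \<in> controls A" unfolding \<gamma>_def a_def by (rule ins_controls[OF \<alpha> push_in order_refl pq(1)])
    note tr\<gamma> = trajectory_hybrid[OF \<gamma>c wm x']
    have agree: "aeq (p + \<tau>) \<gamma> \<beta>"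
      unfolding aeq_def using \<beta>\<gamma> by (intro exI[of _ "{p + \<tau>}"]) auto
    have "pos x' w \<gamma> (p + \<tau>) = X' (p + \<tau>)"
      by (rule conjunct1[OF hybrid_causal[OF tr\<gamma>(1) tr(1) \<gamma>c \<beta> _ _ agree]]) (use tr\<gamma>(2,3) tr(2,3) p\<tau> in simp_all)
    then have y: "pos x' w \<gamma> (p + \<tau>) = y" using X'\<xi>(1)[of "p + \<tau>"] p\<tau> by (simp add: y_def)
    have \<beta>_out: "\<beta> t = push (-1) c w y" if "p + \<tau> \<le> t" "t < p + \<tau> + q" for t
      using that True y by (simp add: \<beta>_def step_def Let_def ins_def[of "p + \<tau>"] a_def \<gamma>_def)
    have \<beta>_rest: "\<beta> (p + q + t) = \<alpha> t" if "\<tau> \<le> t" for t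
      using that True pq \<tau>(1) by (simp add: \<beta>_def step_def Let_def ins_def algebra_simps)
    have y_near: "norm (y - X \<tau>) \<le> 6 * D" unfolding y_def using near[of \<tau>] \<tau>(1) by simp
    have y_depth: "0 \<le> depth w y" "depth w y \<le> 6 * D"
      using in_sector[of "p + \<tau>"] p\<tau> depth_lipschitz[OF wm, of y "X \<tau>"] y_near \<tau>(5)[OF True]
      by (auto simp: y_def)
    have "M * \<tau> \<le> M * h" using \<tau>(2) M_pos by simp
    then have "norm (X \<tau> - X 0) \<le> 1" using X_speed[of 0 \<tau>] \<tau>(1) h(6) by simp
    then have y_norm: "norm y \<le> R + 2"
      using y_near s(6) R norm_triangle_ineq[of "X 0" "X \<tau> - X 0"] norm_triangle_ineq[of "X \<tau>" "y - X \<tau>"] by simp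
    have "solves (\<lambda>_. w) (\<lambda>_. push (-1) c w y) (p + \<tau>) (p + \<tau> + q) \<xi>"
      by (rule solves_cong[OF solves_sub[OF \<xi> p\<tau> order_refl] negligible_sing[of "p + \<tau> + q"]]) (use \<beta>_out in auto)
    then have loss: "c / 2 * q \<le> - (depth w (\<xi> (p + \<tau> + q)) - depth w y)"
      using push_effect[OF u wm, of "-1" \<xi> "p + \<tau>" q "p + \<tau> + q"] y_norm y_depth s(2,5) p\<tau> pq by (simp add: y_def)
    have out: "depth w (\<xi> (p + \<tau> + q)) < 0" using loss cq y_depth D by simp
    have \<tau>'_less: "\<tau>' < p + \<tau> + q"
    proof (rule ccontr)
      assume "\<not> ?thesis"
      then have "0 \<le> depth w (\<xi> (p + \<tau> + q))" using \<tau>'(3)[of "p + \<tau> + q"] p\<tau> pq by simp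
      with out show False by simp
    qed
    have W'_after: "W' t = - w" if "p + \<tau> + q \<le> t" "t \<le> T" for t using \<tau>'(4)[of t] that \<tau>'_less by simp
    have W_after: "W t = - w" if "\<tau> < t" "t \<le> h" for t by (rule \<tau>(4)[OF that])
    have nw: "- w \<in> {-1, 1}" using wm by auto
    have \<tau>0: "0 \<le> \<tau>" by (rule \<tau>(1))
    have "solves (\<lambda>_. - w) \<alpha> \<tau> h X"
      by (rule solves_cong[OF solves_sub[OF hybridD(3)[OF hyb] \<tau>0 order_refl] negligible_sing[of \<tau>]]) (use W_after in auto)
    from solves_shift[OF this, of \<tau>]
    have 1: "solves (\<lambda>_. - w) (\<lambda>t. \<alpha> (\<tau> + t)) 0 (h - \<tau>) (\<lambda>t. X (\<tau> + t))" by simp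
    have "solves W' \<beta> (p + q + \<tau>) T X'" using pq \<tau>0 by (intro solves_sub[OF hybridD(3)[OF tr(1)]]) auto
    from solves_shift[OF this, of "p + q + \<tau>"]
    have "solves (\<lambda>t. W' (p + q + \<tau> + t)) (\<lambda>t. \<beta> (p + q + \<tau> + t)) 0 (h - \<tau>) (\<lambda>t. X' (p + q + \<tau> + t))"
      by (simp add: T_def algebra_simps)
    then have 2: "solves (\<lambda>_. - w) (\<lambda>t. \<alpha> (\<tau> + t)) 0 (h - \<tau>) (\<lambda>t. X' (p + q + \<tau> + t))"
    proof (rule solves_cong[OF _ negligible_empty])
      fix t assume t: "t \<in> {0..h - \<tau>} - {}"
      have "\<beta> (p + q + (\<tau> + t)) = \<alpha> (\<tau> + t)" by (rule \<beta>_rest) (use t in simp)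
      then show "W' (p + q + \<tau> + t) = - w \<and> \<beta> (p + q + \<tau> + t) = \<alpha> (\<tau> + t)"
        using W'_after[of "p + q + \<tau> + t"] t by (simp add: T_def add.assoc)
    qed simp
    have entry: "norm (X' (p + q + \<tau>) - X \<tau>) \<le> 6 * D + M * q"
    proof -
      have "norm (X' (p + q + \<tau>) - X' (p + \<tau>)) \<le> M * q"
        using X'_speed[of "p + \<tau>" "p + q + \<tau>"] p\<tau> pq by simp
      moreover have "norm (X' (p + \<tau>) - X \<tau>) \<le> 6 * D" by (rule upto[OF \<tau>0 order_refl])
      ultimately show ?thesis
        using norm_triangle_ineq[of "X' (p + q + \<tau>) - X' (p + \<tau>)" "X' (p + \<tau>) - X \<tau>"] by simp
    qed
    have after: "norm (X' (p + q + t) - X t) \<le> k3 c * E" if "\<tau> \<le> t" "t \<le> h" for t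
    proof -
      have "norm (X' (p + q + \<tau> + (t - \<tau>)) - X (\<tau> + (t - \<tau>))) \<le> 6 * norm (X' (p + q + \<tau> + 0) - X (\<tau> + 0))"
        by (rule stability_short[OF 2 1 controls_shift[OF \<alpha> \<tau>0] nw _ _ _ h(2)]) (use that \<tau>0 in auto)
      also have "\<dots> \<le> k3 c * E" using entry unfolding k3 by simp
      finally show ?thesis by (simp add: algebra_simps)
    qed
    have "W' H = - w" using W'_after[of H] True by (simp add: H T_def)
    moreover have "W h = - w" by (rule W_after[OF True order_refl])
    moreover have "norm (X h - X' H) \<le> k3 c * E"
      using after[OF \<tau>(2) order_refl] by (simp add: H norm_minus_commute)
    ultimately show ?thesis using after \<tau>'_less by (auto simp: algebra_simps)
  qed
  then show "norm (X h - X' H) \<le> k3 c * E" "W' H = W h" by blast+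

  show "norm (X' t - X t) \<le> k3 c * E + M * (p + q)" if t: "0 \<le> t" "t \<le> h" for t
  proof (cases "t \<le> \<tau>")
    case True
    have "norm (X' t - X' (p + t)) \<le> M * p" using X'_speed[of "p + t" t] t pq by simp
    moreover have "M * p \<le> M * (p + q)" using pq M_pos by simp
    ultimately show ?thesis
      using upto[OF t(1) True] k3_ge norm_triangle_ineq[of "X' t - X' (p + t)" "X' (p + t) - X t"] by simp
  next
    case False
    then have "norm (X' (p + q + t) - X t) \<le> k3 c * E" using result t by simp
    moreover have "norm (X' t - X' (p + q + t)) \<le> M * (p + q)" using X'_speed[of "p + q + t" t] t pq by (simp add: add.commute)
    ultimately show ?thesis
      using norm_triangle_ineq[of "X' t - X' (p + q + t)" "X' (p + q + t) - X t"] by simp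
  qed
  show "integral {0..h} (\<lambda>t. \<bar>real_of_int (W' t) - real_of_int (W t)\<bar>) \<le> 2 * (p + q)"
  proof (rule integral_bump_le[where u=\<tau>])
    have "(\<lambda>t. real_of_int (W' t) - real_of_int (W t)) absolutely_integrable_on {0..h}"
      using mode_integrable[OF tr(1) \<beta> order_refl] mode_integrable[OF hyb \<alpha> order_refl] by (rule set_integral_diff(1))
    then show "(\<lambda>t. \<bar>real_of_int (W' t) - real_of_int (W t)\<bar>) integrable_on {0..h}"
      by (simp add: absolutely_integrable_on_def)
    fix t assume t: "t \<in> {0..h}"
    show "\<bar>real_of_int (W' t) - real_of_int (W t)\<bar> \<le> 2"
      using hybridD(1)[OF tr(1), of t] hybridD(1)[OF hyb, of t] t by auto
    assume "t \<notin> {\<tau>..\<tau> + (p + q)}"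
    then consider "t < \<tau>" | "\<tau> + (p + q) < t" by fastforce
    then have "W' t = W t"
    proof cases
      case 1
      then show ?thesis using \<tau>(3)[of t] X'\<xi>(2)[of t] t pq by simp
    next
      case 2
      have "t \<le> 0 + T" using t pq by (simp add: T_def)
      then have "W' t = - w" using \<tau>'(4)[of t] 2 result by simp
      then show ?thesis using \<tau>(4)[of t] 2 t pq by simp
    qed
    then show "\<bar>real_of_int (W' t) - real_of_int (W t)\<bar> \<le> 0" by simp
  qed (use pq in simp)
qed

lemma mode_diff_integrable:
  assumes "hybrid \<alpha> X W" "\<alpha> \<in> controls A" "hybrid \<alpha>' X' W'" "\<alpha>' \<in> controls A" "0 \<le> s"
  shows "(\<lambda>t. \<bar>real_of_int (W' t) - real_of_int (W t)\<bar>) integrable_on {s..T}"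
proof -
  have "(\<lambda>t. real_of_int (W' t) - real_of_int (W t)) absolutely_integrable_on {s..T}"
    using mode_integrable[OF assms(3-5)] mode_integrable[OF assms(1,2,5)] by (rule set_integral_diff(1))
  then show ?thesis by (simp add: absolutely_integrable_on_def)
qed

lemma flip_time_cong: "(\<And>t. 0 \<le> t \<Longrightarrow> W t = W' t) \<Longrightarrow> flip_time W h = flip_time W' h"
  unfolding flip_time_def by (rule arg_cong[where f=Sup]) auto

lemma step_inserted:
  assumes "0 \<le> p" "0 \<le> q" "p \<le> \<kappa>" "q \<le> \<kappa>" "0 \<le> \<tau>"
  shows "inserted A \<kappa> \<alpha> 2 (step p q h c x' w \<tau> \<alpha>)"
proof -
  define \<beta> where "\<beta> = ins 0 p (push 1 c w x') \<alpha>"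
  define a where "a = push (-1) c w (pos x' w \<beta> (p + \<tau>))"
  have "inserted A \<kappa> \<alpha> (Suc 0) \<beta>"
    unfolding \<beta>_def using assms by (intro inserted.one inserted.none push_in) auto
  moreover have "a \<in> A" unfolding a_def by (rule push_in)
  ultimately have "inserted A \<kappa> \<alpha> (Suc (Suc 0)) (ins (p + \<tau>) q a \<beta>)" "inserted A \<kappa> \<alpha> (Suc (Suc 0)) (ins 0 0 a \<beta>)"
    using assms by (auto intro!: inserted.one)
  then show ?thesis
    unfolding ins_0 by (simp add: step_def Let_def \<beta>_def a_def numeral_2_eq_2)
qed

text \<open>
  Induction on the number of steps: after the first one, the tracking trajectory lags behind by the
  inserted time \<open>\<theta>\<close>, and the induction hypothesis applies to the shifted trajectories with the error
  \<open>k3 c * E\<close>. The lag contributes \<open>M \<theta>\<close> to the distance of the states and, by \<open>mode_translation\<close>, a multiple of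
  \<open>\<theta>\<close> to that of the modes.
\<close>

theorem tracking:
  assumes u: "uniform (R + 2) c r" and ad: "admissible c r h"
  shows "\<exists>C\<ge>0. \<exists>E0>0. \<forall>E x x' w \<alpha> X W X' W'. 0 < E \<longrightarrow> E \<le> E0 \<longrightarrow> w \<in> {-1, 1} \<longrightarrow>
      norm x + M * (real n * h) \<le> R \<longrightarrow> norm (x - x') \<le> E \<longrightarrow> 0 \<le> depth w x \<longrightarrow> 0 \<le> depth w x' \<longrightarrow>
      \<alpha> \<in> controls A \<longrightarrow> hybrid \<alpha> X W \<longrightarrow> X 0 = x \<longrightarrow> W 0 = w \<longrightarrow>
      hybrid (follow c h n E x w x' w \<alpha>) X' W' \<longrightarrow> X' 0 = x' \<longrightarrow> W' 0 = w \<longrightarrow>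
      (\<forall>t\<in>{0..real n * h}. norm (X' t - X t) \<le> C * E) \<and>
      integral {0..real n * h} (\<lambda>t. \<bar>real_of_int (W' t) - real_of_int (W t)\<bar>) \<le> C * E \<and>
      inserted A (C * E) \<alpha> (2 * n) (follow c h n E x w x' w \<alpha>)"
    (is "\<exists>C\<ge>0. \<exists>E0>0. ?P n C E0")
proof (induction n)
  case 0
  have "?P 0 1 1" by (auto simp: norm_minus_commute intro: inserted.none)
  then show ?case by (intro exI[of _ 1] conjI) auto
next
  case (Suc n)
  then obtain C E0 where C: "0 \<le> C" and E0: "0 < E0" and IH: "?P n C E0" by blast
  have c: "0 < c" and r: "0 < r" using u by (auto simp: uniform_def)
  have h: "0 < h" "M * h \<le> gap / 4" using ad by (auto simp: admissible_def)
  have hg: "M * h < gap" using h(2) gap_pos by linarith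
  have h0: "0 \<le> h" using h by simp
  obtain E1 where E1: "small c r E1" using small_exists[OF c r] by blast
  have E1_pos: "0 < E1" using E1 by (simp add: small_def)
  define K where "K = k1 c + k2 c"
  have k: "0 \<le> k1 c" "0 \<le> k2 c" "0 < k3 c" "0 \<le> K" using k_nonneg[OF c] by (auto simp: K_def)
  define C' where "C' = k3 c + (M + 3 + 2 * n) * K + C * k3 c"
  define E0' where "E0' = min E1 (E0 / k3 c)"
  have "?P (Suc n) C' E0'"
  proof (intro allI impI)
    fix E x x' w \<alpha> X W X' W'
    assume E: "0 < E" "E \<le> E0'" and w: "w \<in> {-1, 1}" and R: "norm x + M * (real (Suc n) * h) \<le> R"
      and xx': "norm (x - x') \<le> E" and dep: "0 \<le> depth w x" "0 \<le> depth w x'"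
      and \<alpha>: "\<alpha> \<in> controls A" and hyb: "hybrid \<alpha> X W" and init: "X 0 = x" "W 0 = w"
      and hyb': "hybrid (follow c h (Suc n) E x w x' w \<alpha>) X' W'" and init': "X' 0 = x'" "W' 0 = w"
    have sm: "small c r E" using small_mono[OF c E1 E(1)] E(2) by (simp add: E0'_def)
    have kE: "0 < k3 c * E" "k3 c * E \<le> E0" using E k by (auto simp: E0'_def field_simps)
    define p q \<tau> where "p = k1 c * E" and "q = k2 c * E" and "\<tau> = flip_time W h"
    define \<beta> H where "\<beta> = step p q h c x' w \<tau> \<alpha>" and "H = duration p q h \<tau>"
    define X1 W1 where "X1 = pos x' w \<beta>" and "W1 = mode x' w \<beta>"
    define G where "G = follow c h n (k3 c * E) (X h) (W h) (X1 H) (W1 H) (\<lambda>t. \<beta> (H + t))"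
    define F where "F = follow c h (Suc n) E x w x' w \<alpha>"
    have pq: "0 \<le> p" "0 \<le> q" "p + q = K * E" using k E by (auto simp: p_def q_def K_def algebra_simps)
    have pqg: "M * (p + q) \<le> gap / 4" using sm by (simp add: small_def p_def q_def)
    note \<tau> = flip_time[OF hyb \<alpha> h(1) hg, folded \<tau>_def]
    define \<theta> where "\<theta> = H - h"
    have \<theta>: "0 \<le> \<theta>" "\<theta> \<le> p + q" "H = h + \<theta>" using pq by (auto simp: \<theta>_def H_def duration_def)
    have H0: "0 \<le> H" using \<theta> h0 by simp
    have \<beta>: "\<beta> \<in> controls A" unfolding \<beta>_def by (rule step_controls[OF \<alpha> pq(1,2) \<tau>(1)])
    note tr = trajectory_hybrid[OF \<alpha> w dep(1)] and tr1 = trajectory_hybrid[OF \<beta> w dep(2), folded X1_def W1_def]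
    have same: "pos x w \<alpha> t = X t \<and> mode x w \<alpha> t = W t" if "0 \<le> t" for t
      by (rule hybrid_causal[OF tr(1) hyb \<alpha> \<alpha> _ _ aeq_refl that order_refl]) (use tr init in simp_all)
    have flip: "flip_time (mode x w \<alpha>) h = \<tau>" unfolding \<tau>_def by (rule flip_time_cong) (use same in simp)
    have F: "F = conc H \<beta> G"
      using same[OF h0] by (simp add: F_def G_def Let_def flip p_def q_def \<beta>_def H_def X1_def W1_def)
    have Fc: "F \<in> controls A"
      unfolding F_def by (rule follow_controls[OF c h(1) hg \<alpha> _ w dep(1) w dep(2)]) (use E in simp)
    have hybF: "hybrid F X' W'" using hyb' by (simp add: F_def)
    have agree: "aeq H F \<beta>" unfolding aeq_def F conc_def by (intro exI[of _ "{H}"]) auto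
    have X'1: "X' t = X1 t \<and> W' t = W1 t" if "0 \<le> t" "t \<le> H" for t
      by (rule hybrid_causal[OF hybF tr1(1) Fc \<beta> _ _ agree that]) (use init' tr1 in simp_all)
    have Rx: "norm (X 0) \<le> R"
    proof -
      have "0 \<le> M * (real (Suc n) * h)" using M_pos h0 by simp
      then show ?thesis unfolding init(1) using R by linarith
    qed
    have "norm (X 0 - x') \<le> E" using xx' init by simp
    note step = step_tracking[OF u ad sm \<alpha> hyb init(2) Rx this dep(2),
        folded p_def q_def \<tau>_def, folded \<beta>_def H_def, folded X1_def W1_def]

    have W1H: "W1 H = W h" by (rule step(2))
    have hybX: "hybrid (\<lambda>t. \<beta> (H + t)) (\<lambda>t. X (h + t)) (\<lambda>t. W (h + t))"
    proof (rule hybrid_cong[OF hybrid_shift[OF hyb h0]])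
      fix t :: real assume "0 \<le> t"
      then show "\<alpha> (h + t) = \<beta> (H + t)"
        unfolding \<beta>_def H_def by (rule step_resumes[OF pq(1,2) \<tau>(1,2), symmetric])
    qed
    have hybX': "hybrid (follow c h n (k3 c * E) (X h) (W h) (X1 H) (W h) (\<lambda>t. \<beta> (H + t))) (\<lambda>t. X' (H + t)) (\<lambda>t. W' (H + t))"
    proof (rule hybrid_cong[OF hybrid_shift[OF hybF H0]])
      show "F (H + t) = follow c h n (k3 c * E) (X h) (W h) (X1 H) (W h) (\<lambda>t. \<beta> (H + t)) t" if "0 \<le> t" for t
        using that by (simp add: F conc_def G_def W1H)
    qed
    have Rh: "norm (X h) + M * (real n * h) \<le> R"
    proof -
      have "norm (X h - X 0) \<le> M * h" using hybrid_speed[OF hyb \<alpha> order_refl h0] h0 by simp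
      then have "norm (X h) \<le> norm x + M * h" using init norm_triangle_ineq[of "X h - X 0" "X 0"] by simp
      then show ?thesis using R by (simp add: algebra_simps)
    qed
    have "(\<forall>t\<in>{0..real n * h}. norm (X' (H + t) - X (h + t)) \<le> C * (k3 c * E)) \<and>
      integral {0..real n * h} (\<lambda>t. \<bar>real_of_int (W' (H + t)) - real_of_int (W (h + t))\<bar>) \<le> C * (k3 c * E) \<and>
      inserted A (C * (k3 c * E)) (\<lambda>t. \<beta> (H + t)) (2 * n)
        (follow c h n (k3 c * E) (X h) (W h) (X1 H) (W h) (\<lambda>t. \<beta> (H + t)))"
    proof (rule IH[rule_format, of "k3 c * E" "W h" "X h" "X1 H" "\<lambda>t. \<beta> (H + t)"
          "\<lambda>t. X (h + t)" "\<lambda>t. W (h + t)" "\<lambda>t. X' (H + t)" "\<lambda>t. W' (H + t)"])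
      show "W h \<in> {-1, 1}" "0 \<le> depth (W h) (X h)" using hybridD(1,2)[OF hyb h0] by auto
      show "0 \<le> depth (W h) (X1 H)" using hybridD(2)[OF tr1(1) H0] W1H by simp
      show "X' (H + 0) = X1 H" "W' (H + 0) = W h" using X'1[OF H0 order_refl] W1H by simp_all
      show "(\<lambda>t. \<beta> (H + t)) \<in> controls A" by (rule controls_shift[OF \<beta> H0])
    qed (use kE Rh step(1) hybX hybX' in simp_all)
    then have far: "\<And>t. 0 \<le> t \<Longrightarrow> t \<le> real n * h \<Longrightarrow> norm (X' (H + t) - X (h + t)) \<le> C * (k3 c * E)"
      and far_mode: "integral {0..real n * h} (\<lambda>t. \<bar>real_of_int (W' (H + t)) - real_of_int (W (h + t))\<bar>) \<le> C * (k3 c * E)"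
      and far_ins: "inserted A (C * (k3 c * E)) (\<lambda>t. \<beta> (H + t)) (2 * n) G"
      by (auto simp: G_def W1H)

    have C'E: "C' * E = k3 c * E + M * (p + q) + 3 * (p + q) + 2 * real n * (p + q) + C * (k3 c * E)"
      unfolding pq(3) by (simp add: C'_def algebra_simps)
    have ge: "k3 c * E + M * (p + q) \<le> C' * E" "M * (p + q) + C * (k3 c * E) \<le> C' * E"
      "2 * (p + q) + (C * (k3 c * E) + 2 * real n * (p + q)) \<le> C' * E"
      "p \<le> C' * E" "q \<le> C' * E" "C * (k3 c * E) \<le> C' * E"
    proof -
      define a1 a2 a3 a4 where "a1 = k3 c * E" and "a2 = M * (p + q)" and "a3 = 2 * real n * (p + q)"
        and "a4 = C * (k3 c * E)"
      have "0 \<le> a1" "0 \<le> a2" "0 \<le> a3" "0 \<le> a4"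
        using pq(1,2) M_pos C kE(1) by (simp_all add: a1_def a2_def a3_def a4_def)
      moreover have "C' * E = a1 + a2 + 3 * (p + q) + a3 + a4"
        unfolding C'E a1_def a2_def a3_def a4_def ..
      ultimately show "k3 c * E + M * (p + q) \<le> C' * E" "M * (p + q) + C * (k3 c * E) \<le> C' * E"
        "2 * (p + q) + (C * (k3 c * E) + 2 * real n * (p + q)) \<le> C' * E"
        "p \<le> C' * E" "q \<le> C' * E" "C * (k3 c * E) \<le> C' * E"
        unfolding a4_def[symmetric] unfolding a1_def[symmetric] a2_def[symmetric] a3_def[symmetric]
        using pq(1,2) by auto
    qed
    have close: "norm (X' t - X t) \<le> C' * E" if t: "t \<in> {0..real (Suc n) * h}" for t
    proof (cases "t \<le> h")
      case True
      have "norm (X1 t - X t) \<le> k3 c * E + M * (p + q)" using step(3)[of t] True t by simp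
      moreover have "X' t = X1 t" using X'1[of t] True t \<theta> by simp
      ultimately have "norm (X' t - X t) \<le> k3 c * E + M * (p + q)" by simp
      then show ?thesis using ge(1) by (rule order_trans)
    next
      case False
      have "norm (X' (H + (t - h)) - X (h + (t - h))) \<le> C * (k3 c * E)"
        using False t by (intro far) (auto simp: algebra_simps)
      then have "norm (X' (t + \<theta>) - X t) \<le> C * (k3 c * E)" by (simp add: \<theta>(3) algebra_simps)
      moreover have "norm (X' t - X' (t + \<theta>)) \<le> M * (p + q)"
      proof -
        have "norm (X' t - X' (t + \<theta>)) \<le> M * \<bar>t - (t + \<theta>)\<bar>"
          by (rule hybrid_speed[OF hybF Fc]) (use t \<theta>(1) in auto)
        also have "\<dots> \<le> M * (p + q)" using \<theta>(1,2) M_pos by simp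
        finally show ?thesis .
      qed
      ultimately show ?thesis
        using norm_triangle_ineq[of "X' t - X' (t + \<theta>)" "X' (t + \<theta>) - X t"] ge(2) by simp
    qed
    let ?g = "\<lambda>t. \<bar>real_of_int (W' t) - real_of_int (W t)\<bar>"
    have g: "?g integrable_on {s..T}" if "0 \<le> s" for s T
      by (rule mode_diff_integrable[OF hyb \<alpha> hybF Fc that])
    have first: "integral {0..h} ?g \<le> 2 * (p + q)"
    proof -
      have "integral {0..h} ?g = integral {0..h} (\<lambda>t. \<bar>real_of_int (W1 t) - real_of_int (W t)\<bar>)"
        by (rule integral_cong) (use X'1 \<theta> in auto)
      with step(4) show ?thesis by simp
    qed
    have rest: "integral {h..real (Suc n) * h} ?g \<le> C * (k3 c * E) + 2 * real n * (p + q)"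
    proof -
      let ?a = "\<lambda>t. \<bar>real_of_int (W' (H + t)) - real_of_int (W (h + t))\<bar>"
      let ?b = "\<lambda>t. \<bar>real_of_int (W' (h + (t + \<theta>))) - real_of_int (W' (h + t))\<bar>"
      have "M * \<theta> \<le> M * (p + q)" using \<theta>(2) M_pos by simp
      then have "M * (h + \<theta>) < gap" using pqg h(2) gap_pos by (simp add: distrib_left)
      from mode_translation[OF hybrid_shift[OF hybF h0] controls_shift[OF Fc h0] h(1) \<theta>(1) this, of n]
      have b: "?b integrable_on {0..real n * h}" "integral {0..real n * h} ?b \<le> 2 * \<theta> * n" by auto
      have a: "?a integrable_on {0..real n * h}"
        by (rule mode_diff_integrable[OF hybrid_shift[OF hyb h0] controls_shift[OF \<alpha> h0]
              hybrid_shift[OF hybF H0] controls_shift[OF Fc H0] order_refl])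
      have "integral {h..real (Suc n) * h} ?g = integral {0..real n * h} (\<lambda>t. ?g (h + t))"
        using integral_shift_Icc_real[of 0 "real n * h" ?g h] by (simp add: o_def algebra_simps)
      also have "\<dots> \<le> integral {0..real n * h} (\<lambda>t. ?a t + ?b t)"
      proof (rule integral_le)
        have "?g integrable_on {0 + h..real n * h + h}" using h0 by (intro g) simp
        then show "(\<lambda>t. ?g (h + t)) integrable_on {0..real n * h}"
          by (subst (asm) integrable_on_shift_Icc_real[symmetric]) (simp add: o_def)
        show "(\<lambda>t. ?a t + ?b t) integrable_on {0..real n * h}" by (rule integrable_add[OF a b(1)])
        show "?g (h + t) \<le> ?a t + ?b t" for t by (simp add: \<theta>(3) add_ac)
      qed
      also have "\<dots> = integral {0..real n * h} ?a + integral {0..real n * h} ?b" by (rule integral_add[OF a b(1)])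
      also have "\<dots> \<le> C * (k3 c * E) + 2 * \<theta> * n" using far_mode b(2) by linarith
      also have "\<dots> \<le> C * (k3 c * E) + 2 * real n * (p + q)"
        using mult_left_mono[OF \<theta>(2), of "2 * real n"] by (simp add: algebra_simps)
      finally show ?thesis .
    qed
    have "integral {0..h} ?g + integral {h..real (Suc n) * h} ?g = integral {0..real (Suc n) * h} ?g"
      by (rule Henstock_Kurzweil_Integration.integral_combine) (use h0 g in \<open>auto simp: algebra_simps\<close>)
    then have modes: "integral {0..real (Suc n) * h} ?g \<le> C' * E"
      using order_trans[OF add_mono[OF first rest] ge(3)] by simp
    have "inserted A (C' * E) \<alpha> 2 \<beta>"
      unfolding \<beta>_def by (rule step_inserted[OF pq(1,2) ge(4,5) \<tau>(1)])
    moreover have "inserted A (C' * E) (\<lambda>t. \<beta> (H + t)) (2 * n) G"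
      by (rule inserted_mono[OF far_ins ge(6)])
    then have "inserted A (C' * E) \<beta> (2 * n) F" unfolding F by (rule inserted_conc[OF _ H0])
    ultimately have "inserted A (C' * E) \<alpha> (2 * n + 2) F" by (rule inserted_trans[rotated])
    then show "(\<forall>t\<in>{0..real (Suc n) * h}. norm (X' t - X t) \<le> C' * E) \<and>
      integral {0..real (Suc n) * h} ?g \<le> C' * E \<and>
      inserted A (C' * E) \<alpha> (2 * Suc n) (follow c h (Suc n) E x w x' w \<alpha>)"
      using close modes unfolding F_def by simp
  qed
  moreover have "0 \<le> C'" using k C M_pos unfolding C'_def by simp
  moreover have "0 < E0'" using E1_pos E0 k by (simp add: E0'_def)
  ultimately show ?case by blast
qed

end

section \<open>The cost of a delay\<close>

lemma integral_abs_le_const: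
  fixes g :: "real \<Rightarrow> real"
  assumes "g integrable_on {a..b}" "a \<le> b" "\<And>t. t \<in> {a..b} \<Longrightarrow> \<bar>g t\<bar> \<le> C" "0 \<le> C"
  shows "\<bar>integral {a..b} g\<bar> \<le> C * (b - a)"
  using has_integral_norm_le[OF integrable_integral[OF assms(1)] assms(2) _ assms(4)] assms(3) by simp

lemma integral_split3:
  fixes g :: "real \<Rightarrow> real"
  assumes "g integrable_on {a..d}" "a \<le> b" "b \<le> c" "c \<le> d"
  shows "integral {a..d} g = integral {a..b} g + integral {b..c} g + integral {c..d} g"
proof -
  have "g integrable_on {a..c}" using assms by (meson integrable_subinterval_real atLeastatMost_subset_iff order_refl)
  then show ?thesis
    using Henstock_Kurzweil_Integration.integral_combine[of a c d g]
      Henstock_Kurzweil_Integration.integral_combine[of a b c g] assms by simp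
qed

text \<open>
  An insertion merely delays the later part of the control, so its effect on a time-dependent running
  cost is controlled by the modulus of continuity of this cost under translations.
\<close>

lemma insertion_integral:
  fixes \<psi> :: "real \<Rightarrow> 'a::metric_space \<Rightarrow> real"
  assumes int: "\<And>\<alpha> \<theta>. \<alpha> \<in> controls A \<Longrightarrow> 0 \<le> \<theta> \<Longrightarrow> (\<lambda>t. \<psi> (t + \<theta>) (\<alpha> t)) integrable_on {0..T}"
    and bound: "\<And>t a. 0 \<le> t \<Longrightarrow> a \<in> A \<Longrightarrow> \<bar>\<psi> t a\<bar> \<le> C"
    and D: "\<And>t. t \<in> {0..T} \<Longrightarrow> d t \<ge> 0" "d integrable_on {0..T}" "integral {0..T} d \<le> D"
    and shift: "\<And>t a. t \<in> {0..T} \<Longrightarrow> a \<in> A \<Longrightarrow> \<bar>\<psi> (t + \<theta>) a - \<psi> t a\<bar> \<le> d t"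
    and \<beta>: "\<beta> \<in> controls A" and a: "a \<in> A" and s: "0 \<le> s" and \<theta>: "0 \<le> \<theta>" "\<theta> \<le> \<kappa>"
    and T: "0 \<le> T" and C: "0 \<le> C"
  shows "\<bar>integral {0..T} (\<lambda>t. \<psi> t (ins s \<theta> a \<beta> t)) - integral {0..T} (\<lambda>t. \<psi> t (\<beta> t))\<bar> \<le> 2 * C * \<kappa> + D"
proof -
  define \<gamma> where "\<gamma> = ins s \<theta> a \<beta>"
  let ?g = "\<lambda>t. \<psi> t (\<gamma> t)" and ?b = "\<lambda>t. \<psi> t (\<beta> t)"
  have \<gamma>: "\<gamma> \<in> controls A" unfolding \<gamma>_def by (rule ins_controls[OF \<beta> a s \<theta>(1)])
  have ig: "?g integrable_on {0..T}" and ib: "?b integrable_on {0..T}"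
    using int[OF \<gamma>, of 0] int[OF \<beta>, of 0] by auto
  have sub: "h integrable_on {x..y}" if "h integrable_on {0..T}" "0 \<le> x" "y \<le> T" for h :: "real \<Rightarrow> real" and x y
    using that by (meson integrable_subinterval_real atLeastatMost_subset_iff)
  have D0: "0 \<le> D" using integral_nonneg[OF D(2) D(1)] D(3) by simp
  have C\<kappa>: "C * \<theta> \<le> C * \<kappa>" "0 \<le> C * \<theta>" using C \<theta> by (auto intro: mult_left_mono)
  have piece: "\<bar>integral {x..y} (\<lambda>t. \<psi> t (\<delta> t))\<bar> \<le> C * (y - x)"
    if \<delta>: "\<delta> \<in> controls A" and xy: "0 \<le> x" "x \<le> y" "y \<le> T" for \<delta> x y
  proof (rule integral_abs_le_const[OF _ xy(2) _ C])
    show "(\<lambda>t. \<psi> t (\<delta> t)) integrable_on {x..y}" by (rule sub[OF _ xy(1,3)]) (use int[OF \<delta>, of 0] in simp)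
    show "\<bar>\<psi> t (\<delta> t)\<bar> \<le> C" if "t \<in> {x..y}" for t
      using bound[of t "\<delta> t"] control_in[OF \<delta>, of t] that xy by simp
  qed
  consider "T \<le> s" | "s < T" "T < s + \<theta>" | "s < T" "s + \<theta> \<le> T" by linarith
  then have "\<bar>integral {0..T} ?g - integral {0..T} ?b\<bar> \<le> 2 * C * \<theta> + D"
  proof cases
    case 1
    have "integral {0..T} ?g = integral {0..T} ?b"
      by (rule integral_spike[OF negligible_sing[of T]]) (use 1 in \<open>auto simp: \<gamma>_def ins_def\<close>)
    then show ?thesis using C\<kappa> D0 by simp
  next
    case 2
    have "integral {0..s} ?g = integral {0..s} ?b"
      by (rule integral_spike[OF negligible_sing[of s]]) (auto simp: \<gamma>_def ins_def)
    moreover have "integral {0..T} ?g = integral {0..s} ?g + integral {s..T} ?g"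
      "integral {0..T} ?b = integral {0..s} ?b + integral {s..T} ?b"
      using s 2 ig ib by (simp_all add: Henstock_Kurzweil_Integration.integral_combine)
    moreover have "\<bar>integral {s..T} ?g\<bar> \<le> C * (T - s)" "\<bar>integral {s..T} ?b\<bar> \<le> C * (T - s)"
      using s 2 piece[OF \<gamma>, of s T] piece[OF \<beta>, of s T] by auto
    moreover have "C * (T - s) \<le> C * \<theta>" using 2 C by (intro mult_left_mono) auto
    ultimately show ?thesis using D0 by linarith
  next
    case 3
    have "integral {0..s} ?g = integral {0..s} ?b"
      by (rule integral_spike[OF negligible_sing[of s]]) (auto simp: \<gamma>_def ins_def)
    moreover have "integral {0..T} ?g = integral {0..s} ?g + integral {s..s + \<theta>} ?g + integral {s + \<theta>..T} ?g"
      using s 3 \<theta> by (intro integral_split3[OF ig]) auto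
    moreover have "integral {0..T} ?b = integral {0..s} ?b + integral {s..T - \<theta>} ?b + integral {T - \<theta>..T} ?b"
      using s 3 \<theta> by (intro integral_split3[OF ib]) auto
    moreover have "integral {s + \<theta>..T} ?g = integral {s..T - \<theta>} (\<lambda>t. \<psi> (t + \<theta>) (\<beta> t))"
    proof -
      have "integral {s + \<theta>..T} ?g = integral {s + \<theta>..(T - \<theta>) + \<theta>} ?g" by simp
      also have "\<dots> = integral {s..T - \<theta>} (?g \<circ> (+) \<theta>)" by (rule integral_shift_Icc_real[symmetric])
      also have "\<dots> = integral {s..T - \<theta>} (\<lambda>t. \<psi> (t + \<theta>) (\<beta> t))"
        by (rule integral_cong) (use \<theta> in \<open>auto simp: \<gamma>_def ins_def add.commute\<close>)
      finally show ?thesis .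
    qed
    moreover have "\<bar>integral {s..T - \<theta>} (\<lambda>t. \<psi> (t + \<theta>) (\<beta> t)) - integral {s..T - \<theta>} ?b\<bar> \<le> D"
    proof -
      have i1: "(\<lambda>t. \<psi> (t + \<theta>) (\<beta> t)) integrable_on {s..T - \<theta>}" "?b integrable_on {s..T - \<theta>}"
        by (rule sub[OF int[OF \<beta> \<theta>(1)] s], use \<theta> in simp, rule sub[OF ib s], use \<theta> in simp)
      have "integral {s..T - \<theta>} (\<lambda>t. \<psi> (t + \<theta>) (\<beta> t)) - integral {s..T - \<theta>} ?b
          = integral {s..T - \<theta>} (\<lambda>t. \<psi> (t + \<theta>) (\<beta> t) - \<psi> t (\<beta> t))"
        using i1 by (simp add: integral_diff)
      also have "norm \<dots> \<le> integral {s..T - \<theta>} d"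
      proof (rule Henstock_Kurzweil_Integration.integral_norm_bound_integral)
        show "(\<lambda>t. \<psi> (t + \<theta>) (\<beta> t) - \<psi> t (\<beta> t)) integrable_on {s..T - \<theta>}"
          by (rule integrable_diff[OF i1])
        show "d integrable_on {s..T - \<theta>}" by (rule sub[OF D(2) s]) (use \<theta> in simp)
        show "norm (\<psi> (t + \<theta>) (\<beta> t) - \<psi> t (\<beta> t)) \<le> d t" if "t \<in> {s..T - \<theta>}" for t
          using shift[of t "\<beta> t"] control_in[OF \<beta>, of t] that s \<theta> by simp
      qed
      also have "\<dots> \<le> integral {0..T} d"
      proof (rule integral_subset_le)
        show "d integrable_on {s..T - \<theta>}" by (rule sub[OF D(2) s]) (use \<theta> in simp)
      qed (use D s \<theta> in auto)
      finally show ?thesis using D(3) by simp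
    qed
    moreover have "\<bar>integral {s..s + \<theta>} ?g\<bar> \<le> C * (s + \<theta> - s)"
      by (rule piece[OF \<gamma>]) (use s 3 \<theta> in auto)
    moreover have "\<bar>integral {T - \<theta>..T} ?b\<bar> \<le> C * (T - (T - \<theta>))"
      by (rule piece[OF \<beta>]) (use s 3 \<theta> in auto)
    ultimately show ?thesis by (simp add: abs_le_iff)
  qed
  then show ?thesis using C\<kappa> unfolding \<gamma>_def by linarith
qed

lemma inserted_controls: "inserted A \<kappa> \<alpha> m \<beta> \<Longrightarrow> \<alpha> \<in> controls A \<Longrightarrow> \<beta> \<in> controls A"
  by (induction rule: inserted.induct) (auto intro: ins_controls)

lemma insertions_integral:
  fixes \<psi> :: "real \<Rightarrow> 'a::metric_space \<Rightarrow> real"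
  assumes ins: "inserted A \<kappa> \<alpha> m \<beta>" and \<alpha>: "\<alpha> \<in> controls A"
    and int: "\<And>\<alpha> \<theta>. \<alpha> \<in> controls A \<Longrightarrow> 0 \<le> \<theta> \<Longrightarrow> (\<lambda>t. \<psi> (t + \<theta>) (\<alpha> t)) integrable_on {0..T}"
    and bound: "\<And>t a. 0 \<le> t \<Longrightarrow> a \<in> A \<Longrightarrow> \<bar>\<psi> t a\<bar> \<le> C"
    and D: "\<And>\<theta>. 0 \<le> \<theta> \<Longrightarrow> \<theta> \<le> \<kappa> \<Longrightarrow> d \<theta> integrable_on {0..T} \<and> integral {0..T} (d \<theta>) \<le> D"
    and shift: "\<And>\<theta> t a. 0 \<le> \<theta> \<Longrightarrow> \<theta> \<le> \<kappa> \<Longrightarrow> t \<in> {0..T} \<Longrightarrow> a \<in> A \<Longrightarrow> \<bar>\<psi> (t + \<theta>) a - \<psi> t a\<bar> \<le> d \<theta> t"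
    and T: "0 \<le> T" and C: "0 \<le> C" and A: "A \<noteq> {}"
  shows "\<bar>integral {0..T} (\<lambda>t. \<psi> t (\<beta> t)) - integral {0..T} (\<lambda>t. \<psi> t (\<alpha> t))\<bar> \<le> m * (2 * C * \<kappa> + D)"
  using ins
proof (induction rule: inserted.induct)
  case (one m \<beta> s \<theta> a)
  have "\<bar>integral {0..T} (\<lambda>t. \<psi> t (ins s \<theta> a \<beta> t)) - integral {0..T} (\<lambda>t. \<psi> t (\<beta> t))\<bar> \<le> 2 * C * \<kappa> + D"
  proof (rule insertion_integral[where A=A and d="d \<theta>"])
    show "0 \<le> d \<theta> t" if "t \<in> {0..T}" for t
      using shift[OF one(3,4) that] A abs_ge_zero order_trans by blast
  qed (use one D shift int bound T C inserted_controls[OF one(1) \<alpha>] in auto)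
  with one.IH show ?case by (simp add: algebra_simps abs_le_iff)
qed simp

lemma (in player) mode_variation:
  assumes T: "0 < T"
  shows "\<exists>V\<ge>0. \<exists>\<theta>0>0. \<forall>\<alpha> X W \<theta>. hybrid \<alpha> X W \<longrightarrow> \<alpha> \<in> controls A \<longrightarrow> 0 \<le> \<theta> \<longrightarrow> \<theta> \<le> \<theta>0 \<longrightarrow>
    (\<lambda>t. \<bar>real_of_int (W (t + \<theta>)) - real_of_int (W t)\<bar>) integrable_on {0..T} \<and>
    integral {0..T} (\<lambda>t. \<bar>real_of_int (W (t + \<theta>)) - real_of_int (W t)\<bar>) \<le> V * \<theta>"
proof -
  obtain n :: nat where n: "4 * M * T / gap < n" using reals_Archimedean2 by blast
  have pos: "0 < 4 * M * T / gap" using M_pos T gap_pos by simp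
  then have n0: "0 < real n" using n by linarith
  define h where "h = T / n"
  have h: "0 < h" "n * h = T" using T n0 by (auto simp: h_def)
  have "M * h < gap / 4" using n n0 gap_pos T by (simp add: h_def field_simps)
  define \<theta>0 where "\<theta>0 = gap / (4 * M)"
  have \<theta>0: "0 < \<theta>0" "M * \<theta>0 = gap / 4" using gap_pos M_pos by (auto simp: \<theta>0_def)
  have short: "M * (h + \<theta>) < gap" if "\<theta> \<le> \<theta>0" for \<theta>
  proof -
    have "M * \<theta> \<le> M * \<theta>0" using that M_pos by simp
    then show ?thesis using \<open>M * h < gap / 4\<close> \<theta>0(2) gap_pos unfolding distrib_left by linarith
  qed
  show ?thesis
  proof (rule exI[of _ "2 * real n"], rule conjI, simp, rule exI[of _ \<theta>0], intro conjI allI impI)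
    fix \<alpha> X W \<theta> assume *: "hybrid \<alpha> X W" "\<alpha> \<in> controls A" "0 \<le> \<theta>" "\<theta> \<le> \<theta>0"
    from mode_translation[OF *(1,2) h(1) *(3) short[OF *(4)], of n]
    show "(\<lambda>t. \<bar>real_of_int (W (t + \<theta>)) - real_of_int (W t)\<bar>) integrable_on {0..T}"
      "integral {0..T} (\<lambda>t. \<bar>real_of_int (W (t + \<theta>)) - real_of_int (W t)\<bar>) \<le> 2 * real n * \<theta>"
      unfolding h(2) by (simp_all add: mult_ac)
  qed (use \<theta>0 in auto)
qed

lemma (in player) hybrid_continuous:
  assumes "hybrid \<alpha> X W" "\<alpha> \<in> controls A" shows "continuous_on {0..} X"
  by (rule continuous_on_atLeastI, rule solves_continuous[OF hybridD(3)[OF assms(1)] order_refl assms(2)])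
    (use hybridD(1)[OF assms(1)] in auto)

lemma (in player) hybrid_mode_measurable:
  assumes "hybrid \<alpha> X W" "\<alpha> \<in> controls A"
  shows "{t \<in> {0..}. W t = 1} \<in> sets (lebesgue_on {0..})"
proof -
  define g where "g n t = (if t \<in> {0..real n} then real_of_int (W t) else 0)" for n t
  have g: "g n \<in> borel_measurable lebesgue" for n
    unfolding g_def
    by (rule borel_measurable_if_I[OF absolutely_integrable_imp_borel_measurable[OF mode_integrable[OF assms order_refl]]]) auto
  have meas: "{t \<in> {0..real n}. W t = 1} \<in> sets lebesgue" for n
  proof -
    from g have "g n -` {1} \<inter> space lebesgue \<in> sets lebesgue" by (rule measurable_sets) simp
    also have "g n -` {1} \<inter> space lebesgue = {t \<in> {0..real n}. W t = 1}" by (auto simp: g_def split: if_splits)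
    finally show ?thesis .
  qed
  have "(\<Union>n. {t \<in> {0..real n}. W t = 1}) \<in> sets lebesgue" using meas by auto
  moreover have "(\<Union>n. {t \<in> {0..real n}. W t = 1}) = {t \<in> {0..}. W t = 1}"
    by (auto simp: real_arch_simple)
  ultimately show ?thesis by (auto simp: sets_restrict_space_iff)
qed

text \<open>
  The two parts of the running cost are kept apart: a change of one control enters one of them directly,
  and the other one only through the state.
\<close>

locale game = P: player f e \<rho> A L M + Q: player g e' \<eta> B L' M'
  for f :: "'x::euclidean_space \<Rightarrow> int \<Rightarrow> 'a::metric_space \<Rightarrow> 'x" and e \<rho> A L M
    and g :: "'y::euclidean_space \<Rightarrow> int \<Rightarrow> 'b::metric_space \<Rightarrow> 'y" and e' \<eta> B L' M' +
  fixes l :: "'x \<Rightarrow> 'y \<Rightarrow> int \<Rightarrow> int \<Rightarrow> 'a \<Rightarrow> 'b \<Rightarrow> real"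
    and l1 :: "'x \<Rightarrow> 'y \<Rightarrow> int \<Rightarrow> int \<Rightarrow> 'a \<Rightarrow> real"
    and l2 :: "'x \<Rightarrow> 'y \<Rightarrow> int \<Rightarrow> int \<Rightarrow> 'b \<Rightarrow> real"
    and lam C K :: real
  assumes l_split: "\<And>x y w z a b. w \<in> {-1, 1} \<Longrightarrow> z \<in> {-1, 1} \<Longrightarrow> a \<in> A \<Longrightarrow> b \<in> B \<Longrightarrow>
      l x y w z a b = l1 x y w z a + l2 x y w z b"
    and l1_cont: "\<And>x y w z. w \<in> {-1, 1} \<Longrightarrow> z \<in> {-1, 1} \<Longrightarrow> continuous_on A (l1 x y w z)"
    and l2_cont: "\<And>x y w z. w \<in> {-1, 1} \<Longrightarrow> z \<in> {-1, 1} \<Longrightarrow> continuous_on B (l2 x y w z)"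
    and l1_bound: "\<And>x y w z a. w \<in> {-1, 1} \<Longrightarrow> z \<in> {-1, 1} \<Longrightarrow> a \<in> A \<Longrightarrow> \<bar>l1 x y w z a\<bar> \<le> C"
    and l2_bound: "\<And>x y w z b. w \<in> {-1, 1} \<Longrightarrow> z \<in> {-1, 1} \<Longrightarrow> b \<in> B \<Longrightarrow> \<bar>l2 x y w z b\<bar> \<le> C"
    and l1_lip: "\<And>x y x' y' w z a. w \<in> {-1, 1} \<Longrightarrow> z \<in> {-1, 1} \<Longrightarrow> a \<in> A \<Longrightarrow>
      \<bar>l1 x y w z a - l1 x' y' w z a\<bar> \<le> K * (norm (x - x') + norm (y - y'))"
    and l2_lip: "\<And>x y x' y' w z b. w \<in> {-1, 1} \<Longrightarrow> z \<in> {-1, 1} \<Longrightarrow> b \<in> B \<Longrightarrow>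
      \<bar>l2 x y w z b - l2 x' y' w z b\<bar> \<le> K * (norm (x - x') + norm (y - y'))"
    and lam_pos: "0 < lam" and C_nonneg: "0 \<le> C" and K_nonneg: "0 \<le> K"

lemma caratheodory_modes:
  fixes F :: "'x::euclidean_space \<Rightarrow> 'y::euclidean_space \<Rightarrow> int \<Rightarrow> int \<Rightarrow> 'c::metric_space \<Rightarrow> real"
    and X :: "real \<Rightarrow> 'x" and Y :: "real \<Rightarrow> 'y" and W Z :: "real \<Rightarrow> int"
    and u :: "real \<Rightarrow> 'c"
  assumes X: "continuous_on {0..} X" and Y: "continuous_on {0..} Y"
    and W: "{t \<in> {0..}. W t = 1} \<in> sets (lebesgue_on {0..})" "\<And>t. 0 \<le> t \<Longrightarrow> W t \<in> {-1, 1}"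
    and Z: "{t \<in> {0..}. Z t = 1} \<in> sets (lebesgue_on {0..})" "\<And>t. 0 \<le> t \<Longrightarrow> Z t \<in> {-1, 1}"
    and u: "u \<in> controls U"
    and cont: "\<And>x y w z. w \<in> {-1, 1} \<Longrightarrow> z \<in> {-1, 1} \<Longrightarrow> continuous_on U (F x y w z)"
    and lip: "\<And>x y x' y' w z a. w \<in> {-1, 1} \<Longrightarrow> z \<in> {-1, 1} \<Longrightarrow> a \<in> U \<Longrightarrow>
      \<bar>F x y w z a - F x' y' w z a\<bar> \<le> K * (norm (x - x') + norm (y - y'))" and K: "0 \<le> K"
  shows "(\<lambda>t. F (X t) (Y t) (W t) (Z t) (u t)) \<in> borel_measurable (lebesgue_on {0..})"
proof -
  have XY: "(\<lambda>t. (X t, Y t)) \<in> borel_measurable (lebesgue_on {0..})"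
    using X Y by (intro continuous_imp_measurable_on_sets_lebesgue continuous_on_Pair) auto
  have fixed: "(\<lambda>t. F (X t) (Y t) w z (u t)) \<in> borel_measurable (lebesgue_on {0..})"
    if wz: "w \<in> {-1, 1}" "z \<in> {-1, 1}" for w z
  proof -
    have "(\<lambda>t. (\<lambda>s a. F (fst s) (snd s) w z a) (X t, Y t) (u t)) \<in> borel_measurable (lebesgue_on {0..})"
    proof (rule caratheodory_measurable[where F="\<lambda>s a. F (fst s) (snd s) w z a" and u=u, OF XY])
      show "(\<lambda>t. F (fst s) (snd s) w z (u t)) \<in> borel_measurable (lebesgue_on {0..})" for s
        by (rule control_measurable[OF u cont[OF wz]]) simp
      fix t assume "t \<in> space (lebesgue_on {0 :: real..})"
      then have a: "u t \<in> U" using u by (simp add: controls_def)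
      have "(K * 2)-lipschitz_on UNIV (\<lambda>s. F (fst s) (snd s) w z (u t))"
      proof (rule lipschitz_onI)
        fix s s' :: "'x \<times> 'y"
        have "\<bar>F (fst s) (snd s) w z (u t) - F (fst s') (snd s') w z (u t)\<bar>
            \<le> K * (norm (fst (s - s')) + norm (snd (s - s')))" using lip[OF wz a] by simp
        also have "\<dots> \<le> K * (norm (s - s') + norm (s - s'))"
          using K norm_fst_le[of "fst (s - s')" "snd (s - s')"] norm_snd_le[of "snd (s - s')" "fst (s - s')"]
          by (intro mult_left_mono add_mono) (simp_all only: prod.collapse)
        finally show "dist (F (fst s) (snd s) w z (u t)) (F (fst s') (snd s') w z (u t)) \<le> K * 2 * dist s s'"
          by (simp add: dist_norm)
      qed (use K in simp)
      then show "continuous_on UNIV (\<lambda>s. F (fst s) (snd s) w z (u t))" by (rule lipschitz_on_continuous_on)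
    qed
    then show ?thesis by simp
  qed
  have "(\<lambda>t. F (X t) (Y t) (W t) (Z t) (u t)) \<in> borel_measurable (lebesgue_on {0..}) \<longleftrightarrow>
    (\<lambda>t. if W t = 1 then if Z t = 1 then F (X t) (Y t) 1 1 (u t) else F (X t) (Y t) 1 (-1) (u t)
      else if Z t = 1 then F (X t) (Y t) (-1) 1 (u t) else F (X t) (Y t) (-1) (-1) (u t))
    \<in> borel_measurable (lebesgue_on {0..})"
    by (rule measurable_cong) (use W(2) Z(2) in force)
  also have "\<dots>"
    using W(1) Z(1) by (intro measurable_If fixed) auto
  finally show ?thesis .
qed

lemma bounded_integrable:
  fixes F :: "real \<Rightarrow> real"
  assumes "F \<in> borel_measurable (lebesgue_on {0..})" "\<And>t. 0 \<le> t \<Longrightarrow> \<bar>F t\<bar> \<le> C"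
  shows "F absolutely_integrable_on {0..T}"
proof (rule measurable_bounded_by_integrable_imp_absolutely_integrable[where g="\<lambda>_. C"])
  show "F \<in> borel_measurable (lebesgue_on {0..T})" by (rule measurable_restrict_mono[OF assms(1)]) auto
qed (use assms(2) integrable_const_ivl in auto)

text \<open>A jump of the modes costs at most \<open>2 C\<close>, and it is visible in \<open>\<bar>w - w'\<bar> = 2\<close>.\<close>

lemma modes_lipschitz:
  fixes F :: "'x::euclidean_space \<Rightarrow> 'y::euclidean_space \<Rightarrow> int \<Rightarrow> int \<Rightarrow> 'c \<Rightarrow> real"
  assumes bound: "\<And>x y w z. w \<in> {-1, 1} \<Longrightarrow> z \<in> {-1, 1} \<Longrightarrow> \<bar>F x y w z a\<bar> \<le> C"
    and lip: "\<And>x y x' y' w z. w \<in> {-1, 1} \<Longrightarrow> z \<in> {-1, 1} \<Longrightarrow>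
      \<bar>F x y w z a - F x' y' w z a\<bar> \<le> K * (norm (x - x') + norm (y - y'))"
    and m: "w \<in> {-1, 1}" "z \<in> {-1, 1}" "w' \<in> {-1, 1}" "z' \<in> {-1, 1}" and C: "0 \<le> C" and K: "0 \<le> K"
  shows "\<bar>F x y w z a - F x' y' w' z' a\<bar> \<le> K * (norm (x - x') + norm (y - y')) +
    C * (\<bar>real_of_int w - real_of_int w'\<bar> + \<bar>real_of_int z - real_of_int z'\<bar>)"
proof (cases "w = w' \<and> z = z'")
  case True
  then show ?thesis using lip[OF m(1,2), of x y x' y'] by simp
next
  case False
  then have "2 \<le> \<bar>real_of_int w - real_of_int w'\<bar> + \<bar>real_of_int z - real_of_int z'\<bar>" using m by auto
  then have "C * 2 \<le> C * (\<bar>real_of_int w - real_of_int w'\<bar> + \<bar>real_of_int z - real_of_int z'\<bar>)"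
    using C by (rule mult_left_mono)
  moreover have "\<bar>F x y w z a - F x' y' w' z' a\<bar> \<le> C * 2"
    using bound[OF m(1,2), of x y] bound[OF m(3,4), of x' y'] by linarith
  moreover have "0 \<le> K * (norm (x - x') + norm (y - y'))" using K by simp
  ultimately show ?thesis by linarith
qed

context game begin

abbreviation J :: "'x \<Rightarrow> 'y \<Rightarrow> int \<Rightarrow> int \<Rightarrow> (real \<Rightarrow> 'a) \<Rightarrow> (real \<Rightarrow> 'b) \<Rightarrow> real" where
  "J x y w z \<alpha> \<beta> \<equiv> cost f g l lam e \<rho> e' \<eta> x y w z \<alpha> \<beta>"

definition \<phi> :: "'x \<Rightarrow> 'y \<Rightarrow> int \<Rightarrow> int \<Rightarrow> (real \<Rightarrow> 'a) \<Rightarrow> (real \<Rightarrow> 'b) \<Rightarrow> real \<Rightarrow> real" where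
  "\<phi> x y w z \<alpha> \<beta> t = exp (- lam * t) *
     (l1 (P.pos x w \<alpha> t) (Q.pos y z \<beta> t) (P.mode x w \<alpha> t) (Q.mode y z \<beta> t) (\<alpha> t) +
      l2 (P.pos x w \<alpha> t) (Q.pos y z \<beta> t) (P.mode x w \<alpha> t) (Q.mode y z \<beta> t) (\<beta> t))"

definition admissible_start :: "'x \<Rightarrow> 'y \<Rightarrow> int \<Rightarrow> int \<Rightarrow> bool" where
  "admissible_start x y w z \<longleftrightarrow> w \<in> {-1, 1} \<and> z \<in> {-1, 1} \<and> 0 \<le> P.depth w x \<and> 0 \<le> Q.depth z y"

lemma l1_measurable:
  assumes hX: "P.hybrid \<alpha>' X W" "\<alpha>' \<in> controls A" and hY: "Q.hybrid \<beta> Y Z" "\<beta> \<in> controls B"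
    and \<alpha>: "\<alpha> \<in> controls A"
  shows "(\<lambda>t. l1 (X t) (Y t) (W t) (Z t) (\<alpha> t)) \<in> borel_measurable (lebesgue_on {0..})"
  by (rule caratheodory_modes[OF P.hybrid_continuous[OF hX] Q.hybrid_continuous[OF hY]
        P.hybrid_mode_measurable[OF hX] P.hybridD(1)[OF hX(1)] Q.hybrid_mode_measurable[OF hY]
        Q.hybridD(1)[OF hY(1)] \<alpha> l1_cont l1_lip K_nonneg])

lemma l2_measurable:
  assumes hX: "P.hybrid \<alpha> X W" "\<alpha> \<in> controls A" and hY: "Q.hybrid \<beta>' Y Z" "\<beta>' \<in> controls B"
    and \<beta>: "\<beta> \<in> controls B"
  shows "(\<lambda>t. l2 (X t) (Y t) (W t) (Z t) (\<beta> t)) \<in> borel_measurable (lebesgue_on {0..})"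
  by (rule caratheodory_modes[OF P.hybrid_continuous[OF hX] Q.hybrid_continuous[OF hY]
        P.hybrid_mode_measurable[OF hX] P.hybridD(1)[OF hX(1)] Q.hybrid_mode_measurable[OF hY]
        Q.hybridD(1)[OF hY(1)] \<beta> l2_cont l2_lip K_nonneg])

lemma exp_measurable: "(\<lambda>t. exp (- lam * t)) \<in> borel_measurable (lebesgue_on {0..})"
  by (intro continuous_imp_measurable_on_sets_lebesgue continuous_intros) auto

context
  fixes x y w z assumes start: "admissible_start x y w z"
begin

lemma trP:
  assumes "\<alpha> \<in> controls A"
  shows "P.hybrid \<alpha> (P.pos x w \<alpha>) (P.mode x w \<alpha>)" "P.pos x w \<alpha> 0 = x" "P.mode x w \<alpha> 0 = w"
  using P.trajectory_hybrid[OF assms] start by (auto simp: admissible_start_def)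

lemma trQ:
  assumes "\<beta> \<in> controls B"
  shows "Q.hybrid \<beta> (Q.pos y z \<beta>) (Q.mode y z \<beta>)" "Q.pos y z \<beta> 0 = y" "Q.mode y z \<beta> 0 = z"
  using Q.trajectory_hybrid[OF assms] start by (auto simp: admissible_start_def)

lemma modes:
  assumes "\<alpha> \<in> controls A" "\<beta> \<in> controls B" "0 \<le> t"
  shows "P.mode x w \<alpha> t \<in> {-1, 1}" "Q.mode y z \<beta> t \<in> {-1, 1}"
  using P.hybridD(1)[OF trP(1)[OF assms(1)] assms(3)] Q.hybridD(1)[OF trQ(1)[OF assms(2)] assms(3)] by auto

lemma \<phi>_measurable:
  assumes "\<alpha> \<in> controls A" "\<beta> \<in> controls B"
  shows "\<phi> x y w z \<alpha> \<beta> \<in> borel_measurable (lebesgue_on {0..})"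
  unfolding \<phi>_def
  by (intro borel_measurable_times borel_measurable_add exp_measurable
      l1_measurable[OF trP(1)[OF assms(1)] assms(1) trQ(1)[OF assms(2)] assms(2,1)]
      l2_measurable[OF trP(1)[OF assms(1)] assms(1) trQ(1)[OF assms(2)] assms(2,2)])

lemma \<phi>_bound:
  assumes "\<alpha> \<in> controls A" "\<beta> \<in> controls B" "0 \<le> t"
  shows "\<bar>\<phi> x y w z \<alpha> \<beta> t\<bar> \<le> 2 * C * exp (- lam * t)"
proof -
  have "\<bar>l1 (P.pos x w \<alpha> t) (Q.pos y z \<beta> t) (P.mode x w \<alpha> t) (Q.mode y z \<beta> t) (\<alpha> t) +
      l2 (P.pos x w \<alpha> t) (Q.pos y z \<beta> t) (P.mode x w \<alpha> t) (Q.mode y z \<beta> t) (\<beta> t)\<bar> \<le> 2 * C"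
    using l1_bound[OF modes[OF assms] control_in[OF assms(1,3)], of "P.pos x w \<alpha> t" "Q.pos y z \<beta> t"]
      l2_bound[OF modes[OF assms] control_in[OF assms(2,3)], of "P.pos x w \<alpha> t" "Q.pos y z \<beta> t"]
    by linarith
  then show ?thesis unfolding \<phi>_def by (simp add: abs_mult mult.commute mult_left_mono)
qed

lemma \<phi>_integrable:
  assumes "\<alpha> \<in> controls A" "\<beta> \<in> controls B"
  shows "\<phi> x y w z \<alpha> \<beta> absolutely_integrable_on {0..T}"
proof (rule bounded_integrable[OF \<phi>_measurable[OF assms]])
  fix t :: real assume t: "0 \<le> t"
  have "2 * C * exp (- lam * t) \<le> 2 * C * 1" using t lam_pos C_nonneg by (intro mult_left_mono) auto
  with \<phi>_bound[OF assms t] show "\<bar>\<phi> x y w z \<alpha> \<beta> t\<bar> \<le> 2 * C" by simp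
qed

lemma cost_tail:
  assumes "\<alpha> \<in> controls A" "\<beta> \<in> controls B" "0 \<le> T"
  shows "\<bar>J x y w z \<alpha> \<beta> - integral {0..T} (\<phi> x y w z \<alpha> \<beta>)\<bar> \<le> 2 * C * exp (- lam * T) / lam"
proof -
  let ?\<phi> = "\<phi> x y w z \<alpha> \<beta>"
  have dom: "((\<lambda>t. 2 * C * exp (- lam * t)) has_integral (2 * C * (exp (- lam * T) / lam))) {T..}" for T
    by (intro has_integral_mult_right has_integral_exp_minus_to_infinity lam_pos)
  have abs: "?\<phi> absolutely_integrable_on {T..}" if "0 \<le> T" for T
  proof (rule measurable_bounded_by_integrable_imp_absolutely_integrable)
    show "?\<phi> \<in> borel_measurable (lebesgue_on {T..})"
      by (rule measurable_restrict_mono[OF \<phi>_measurable[OF assms(1,2)]]) (use that in auto)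
    show "(\<lambda>t. 2 * C * exp (- lam * t)) integrable_on {T..}" using dom by blast
  qed (use \<phi>_bound[OF assms(1,2)] that in auto)
  have "J x y w z \<alpha> \<beta> = (LINT t:{0..}|lebesgue. ?\<phi> t)"
    unfolding cost_def case_prod_beta Let_def P.pos_def[symmetric] Q.pos_def[symmetric]
      P.mode_def[symmetric] Q.mode_def[symmetric]
    using modes[OF assms(1,2)] control_in[OF assms(1)] control_in[OF assms(2)]
    by (intro set_lebesgue_integral_cong) (auto simp: \<phi>_def l_split)
  also have "\<dots> = integral {0..} ?\<phi>" by (rule set_lebesgue_integral_eq_integral(2)[OF abs]) simp
  also have "\<dots> = integral {0..T} ?\<phi> + integral {T..} ?\<phi>"
  proof -
    have "{0..} = {0..T} \<union> {T..}" using assms(3) by auto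
    moreover have "integral ({0..T} \<union> {T..}) ?\<phi> = integral {0..T} ?\<phi> + integral {T..} ?\<phi>"
    proof (rule integral_Un)
      show "?\<phi> integrable_on {0..T}" using \<phi>_integrable[OF assms(1,2)] by (simp add: absolutely_integrable_on_def)
      show "?\<phi> integrable_on {T..}" using abs[OF assms(3)] by (simp add: absolutely_integrable_on_def)
      have "{0..T} \<inter> {T..} = {T}" using assms(3) by auto
      then show "negligible ({0..T} \<inter> {T..})" by simp
    qed
    ultimately show ?thesis by simp
  qed
  finally have "J x y w z \<alpha> \<beta> - integral {0..T} ?\<phi> = integral {T..} ?\<phi>" by simp
  moreover have "norm (integral {T..} ?\<phi>) \<le> integral {T..} (\<lambda>t. 2 * C * exp (- lam * t))"
  proof (rule Henstock_Kurzweil_Integration.integral_norm_bound_integral)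
    show "?\<phi> integrable_on {T..}" using abs[OF assms(3)] by (simp add: absolutely_integrable_on_def)
  qed (use dom \<phi>_bound[OF assms(1,2)] assms(3) in auto)
  ultimately show ?thesis using integral_unique[OF dom, of T] by simp
qed

lemma cost_bounded:
  assumes "\<alpha> \<in> controls A" "\<beta> \<in> controls B"
  shows "\<bar>J x y w z \<alpha> \<beta>\<bar> \<le> 2 * C / lam"
  using cost_tail[OF assms order_refl] by simp

lemma tail_small:
  assumes "0 < \<epsilon>" obtains T0 where "0 < T0" "\<And>T. T0 \<le> T \<Longrightarrow> 4 * C * exp (- lam * T) / lam \<le> \<epsilon>"
proof -
  have "((\<lambda>T. 4 * C * exp (- lam * T) / lam) \<longlongrightarrow> 4 * C * 0 / lam) at_top"
    by (intro tendsto_intros filterlim_compose[OF exp_at_bot] filterlim_tendsto_neg_mult_at_bot[OF tendsto_const])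
      (use lam_pos in \<open>auto intro: filterlim_ident\<close>)
  then have "\<forall>\<^sub>F T in at_top. 4 * C * exp (- lam * T) / lam < \<epsilon>"
    using assms by (intro order_tendstoD(2)) auto
  then obtain N where "\<And>T. N \<le> T \<Longrightarrow> 4 * C * exp (- lam * T) / lam < \<epsilon>" by (auto simp: eventually_at_top_linorder)
  then show thesis by (intro that[of "max N 1"]) (auto intro: less_imp_le)
qed

lemma cost_truncation:
  assumes "0 < \<epsilon>"
  shows "\<exists>T. \<forall>\<alpha>\<in>controls A. \<forall>\<alpha>'\<in>controls A. \<forall>\<beta>\<in>controls B. \<forall>\<beta>'\<in>controls B.
    aeq T \<alpha> \<alpha>' \<longrightarrow> aeq T \<beta> \<beta>' \<longrightarrow> \<bar>J x y w z \<alpha> \<beta> - J x y w z \<alpha>' \<beta>'\<bar> \<le> \<epsilon>"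
proof -
  obtain T where T: "0 < T" and small: "4 * C * exp (- lam * T) / lam \<le> \<epsilon>"
    using tail_small[OF assms] by blast
  show ?thesis
  proof (intro exI[of _ T] ballI impI)
    fix \<alpha> \<alpha>' \<beta> \<beta>'
    assume *: "\<alpha> \<in> controls A" "\<alpha>' \<in> controls A" "\<beta> \<in> controls B" "\<beta>' \<in> controls B" "aeq T \<alpha> \<alpha>'" "aeq T \<beta> \<beta>'"
    obtain N1 where N1: "negligible N1" "\<And>t. t \<in> {0..T} - N1 \<Longrightarrow> \<alpha> t = \<alpha>' t" using *(5) by (auto simp: aeq_def)
    obtain N2 where N2: "negligible N2" "\<And>t. t \<in> {0..T} - N2 \<Longrightarrow> \<beta> t = \<beta>' t" using *(6) by (auto simp: aeq_def)
    have "integral {0..T} (\<phi> x y w z \<alpha> \<beta>) = integral {0..T} (\<phi> x y w z \<alpha>' \<beta>')"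
    proof (rule integral_spike[OF negligible_Un[OF N1(1) N2(1)]])
      fix t assume t: "t \<in> {0..T} - (N1 \<union> N2)"
      then have t': "0 \<le> t" "t \<le> T" by auto
      have "P.pos x w \<alpha> t = P.pos x w \<alpha>' t \<and> P.mode x w \<alpha> t = P.mode x w \<alpha>' t"
        by (rule P.hybrid_causal[OF trP(1)[OF *(1)] trP(1)[OF *(2)] *(1,2) _ _ *(5) t']) (simp_all add: trP *(1,2))
      moreover have "Q.pos y z \<beta> t = Q.pos y z \<beta>' t \<and> Q.mode y z \<beta> t = Q.mode y z \<beta>' t"
        by (rule Q.hybrid_causal[OF trQ(1)[OF *(3)] trQ(1)[OF *(4)] *(3,4) _ _ *(6) t']) (simp_all add: trQ *(3,4))
      ultimately show "\<phi> x y w z \<alpha>' \<beta>' t = \<phi> x y w z \<alpha> \<beta> t" using N1(2)[of t] N2(2)[of t] t by (simp add: \<phi>_def)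
    qed
    moreover have "\<bar>J x y w z \<alpha> \<beta> - integral {0..T} (\<phi> x y w z \<alpha> \<beta>)\<bar> \<le> 4 * C * exp (- lam * T) / lam / 2"
      using cost_tail[OF *(1,3), of T] T by simp
    moreover have "\<bar>J x y w z \<alpha>' \<beta>' - integral {0..T} (\<phi> x y w z \<alpha>' \<beta>')\<bar> \<le> 4 * C * exp (- lam * T) / lam / 2"
      using cost_tail[OF *(2,4), of T] T by simp
    ultimately show "\<bar>J x y w z \<alpha> \<beta> - J x y w z \<alpha>' \<beta>'\<bar> \<le> \<epsilon>" using small by (simp add: abs_le_iff)
  qed
qed

end

end

context game begin

context
  fixes x y w z assumes start: "admissible_start x y w z"
begin

text \<open>
  The horizon \<open>T\<close> is chosen first, by the discount. It bounds the region that the trajectories can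
  reach, which gives the rate \<open>c\<close> and the length \<open>h\<close> of a step. The size \<open>E\<close> of the first push comes last: on
  \<open>[0, T]\<close> the costs differ by at most \<open>G * E\<close>.
\<close>

lemma delay_map:
  assumes \<epsilon>: "0 < \<epsilon>"
  shows "\<exists>\<delta>>0. \<exists>\<Phi>. delaying A \<delta> \<Phi> \<and>
    (\<forall>\<alpha>\<in>controls A. \<forall>\<beta>\<in>controls B. \<bar>J x y w z (\<Phi> \<alpha>) \<beta> - J x y w z \<alpha> \<beta>\<bar> \<le> \<epsilon>)"
proof -
  note trP = trP[OF start] and trQ = trQ[OF start]
  have wx: "w \<in> {-1, 1}" "0 \<le> P.depth w x" using start by (auto simp: admissible_start_def)
  obtain T0 where T0: "0 < T0" "\<And>T. T0 \<le> T \<Longrightarrow> 4 * C * exp (- lam * T) / lam \<le> \<epsilon> / 2"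
    using tail_small[OF start, of "\<epsilon> / 2"] \<epsilon> by auto
  define R where "R = norm x + M * T0 + 1"
  obtain c r where u: "P.uniform (R + 2) c r" using P.uniform_exists by blast
  then have c: "0 < c" and r: "0 < r" by (auto simp: P.uniform_def)
  obtain h where ad: "P.admissible c r h" using P.admissible_exists[OF c r] by blast
  have h: "0 < h" "M * h \<le> P.gap / 4" "M * h \<le> 1" using ad by (auto simp: P.admissible_def)
  have hg: "M * h < P.gap" using h(2) P.gap_pos by linarith
  define n where "n = nat \<lceil>T0 / h\<rceil>"
  define T where "T = real n * h"
  have n: "real n = of_int \<lceil>T0 / h\<rceil>" using T0(1) h(1) by (simp add: n_def)
  have T: "T0 \<le> T" "T \<le> T0 + h"
  proof -
    have "T0 / h \<le> real n" "real n \<le> T0 / h + 1" unfolding n by linarith+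
    then show "T0 \<le> T" "T \<le> T0 + h" unfolding T_def using h(1) by (simp_all add: field_simps)
  qed
  have T_pos: "0 < T" using T(1) T0(1) by simp
  have n0: "n \<noteq> 0"
  proof
    assume "n = 0"
    then have "T = 0" unfolding T_def by simp
    with T_pos show False by simp
  qed
  have "M * T \<le> M * (T0 + h)" using T(2) P.M_pos by simp
  then have R: "norm x + M * (real n * h) \<le> R" using h(3) unfolding R_def T_def by (simp add: distrib_left)
  obtain Ct E0 where Ct: "0 \<le> Ct" and E0: "0 < E0" and track: "\<forall>E x x' w \<alpha> X W X' W'. 0 < E \<longrightarrow> E \<le> E0 \<longrightarrow> w \<in> {-1, 1} \<longrightarrow>
      norm x + M * (real n * h) \<le> R \<longrightarrow> norm (x - x') \<le> E \<longrightarrow> 0 \<le> P.depth w x \<longrightarrow> 0 \<le> P.depth w x' \<longrightarrow>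
      \<alpha> \<in> controls A \<longrightarrow> P.hybrid \<alpha> X W \<longrightarrow> X 0 = x \<longrightarrow> W 0 = w \<longrightarrow>
      P.hybrid (P.follow c h n E x w x' w \<alpha>) X' W' \<longrightarrow> X' 0 = x' \<longrightarrow> W' 0 = w \<longrightarrow>
      (\<forall>t\<in>{0..real n * h}. norm (X' t - X t) \<le> Ct * E) \<and>
      integral {0..real n * h} (\<lambda>t. \<bar>real_of_int (W' t) - real_of_int (W t)\<bar>) \<le> Ct * E \<and>
      inserted A (Ct * E) \<alpha> (2 * n) (P.follow c h n E x w x' w \<alpha>)"
    using P.tracking[OF u ad, of n] by blast
  obtain V1 \<theta>1 where V1: "0 \<le> V1" "0 < \<theta>1" "\<And>\<alpha> X W \<theta>. P.hybrid \<alpha> X W \<Longrightarrow> \<alpha> \<in> controls A \<Longrightarrow> 0 \<le> \<theta> \<Longrightarrow> \<theta> \<le> \<theta>1 \<Longrightarrow>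
    (\<lambda>t. \<bar>real_of_int (W (t + \<theta>)) - real_of_int (W t)\<bar>) integrable_on {0..T} \<and>
    integral {0..T} (\<lambda>t. \<bar>real_of_int (W (t + \<theta>)) - real_of_int (W t)\<bar>) \<le> V1 * \<theta>"
    using P.mode_variation[OF T_pos] by blast
  obtain V2 \<theta>2 where V2: "0 \<le> V2" "0 < \<theta>2" "\<And>\<alpha> X W \<theta>. Q.hybrid \<alpha> X W \<Longrightarrow> \<alpha> \<in> controls B \<Longrightarrow> 0 \<le> \<theta> \<Longrightarrow> \<theta> \<le> \<theta>2 \<Longrightarrow>
    (\<lambda>t. \<bar>real_of_int (W (t + \<theta>)) - real_of_int (W t)\<bar>) integrable_on {0..T} \<and>
    integral {0..T} (\<lambda>t. \<bar>real_of_int (W (t + \<theta>)) - real_of_int (W t)\<bar>) \<le> V2 * \<theta>"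
    using Q.mode_variation[OF T_pos] by blast
  define S where "S = lam * C + K * (M + M')"
  have S: "0 \<le> S" using lam_pos C_nonneg K_nonneg P.M_pos Q.M_pos by (simp add: S_def)
  define D0 where "D0 = S * T + C * (V1 + V2)"
  define G where "G = (2 * K * T + 2 * C + real (2 * n) * (2 * C + D0)) * Ct"
  have G: "0 \<le> G"
    using K_nonneg C_nonneg Ct S T_pos V1(1) V2(1) by (simp add: G_def D0_def)
  define E where "E = Min {E0, \<theta>1 / (Ct + 1), \<theta>2 / (Ct + 1), \<epsilon> / 2 / (G + 1)}"
  have E_pos: "0 < E" using E0 V1(2) V2(2) Ct \<epsilon> G by (simp add: E_def)
  have "E \<le> E0" "E \<le> \<theta>1 / (Ct + 1)" "E \<le> \<theta>2 / (Ct + 1)" "E \<le> \<epsilon> / 2 / (G + 1)" by (simp_all add: E_def)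
  then have E: "E \<le> E0" "(Ct + 1) * E \<le> \<theta>1" "(Ct + 1) * E \<le> \<theta>2" "(G + 1) * E \<le> \<epsilon> / 2"
    using Ct G by (simp_all add: field_simps)
  define \<kappa> where "\<kappa> = Ct * E"
  have \<kappa>: "0 \<le> \<kappa>" "\<kappa> \<le> \<theta>1" "\<kappa> \<le> \<theta>2" using E Ct E_pos by (simp_all add: \<kappa>_def distrib_right)
  have GE: "G * E \<le> \<epsilon> / 2" using E(4) E_pos by (simp add: distrib_right)
  define \<Phi> where "\<Phi> = P.follow c h n E x w x w"
  have E_nonneg: "0 \<le> E" using E_pos by simp
  have \<Phi>: "\<Phi> \<alpha> \<in> controls A" if "\<alpha> \<in> controls A" for \<alpha>
    unfolding \<Phi>_def by (rule P.follow_controls[OF c h(1) hg that E_nonneg wx wx])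
  have "0 < P.k1 c" using c by (simp add: P.k1_def)
  then have \<delta>: "0 < P.k1 c * E" using E_pos by simp
  have "aeq (t + P.k1 c * E) (\<Phi> \<alpha>) (\<Phi> \<alpha>')"
    if "0 \<le> t" "\<alpha> \<in> controls A" "\<alpha>' \<in> controls A" "aeq t \<alpha> \<alpha>'" for t \<alpha> \<alpha>'
    using P.follow_causal[OF c h(1) hg that(2,3,4,1) E_nonneg wx wx, of n] n0 by (simp add: \<Phi>_def)
  then have delaying: "delaying A (P.k1 c * E) \<Phi>" using \<Phi> by (simp add: delaying_def)
  have close: "\<bar>J x y w z (\<Phi> \<alpha>) \<beta> - J x y w z \<alpha> \<beta>\<bar> \<le> \<epsilon>" if \<alpha>: "\<alpha> \<in> controls A" and \<beta>: "\<beta> \<in> controls B" for \<alpha> \<beta>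
  proof -
    define X W where "X = P.pos x w \<alpha>" and "W = P.mode x w \<alpha>"
    define X' W' where "X' = P.pos x w (\<Phi> \<alpha>)" and "W' = P.mode x w (\<Phi> \<alpha>)"
    define Y Z where "Y = Q.pos y z \<beta>" and "Z = Q.mode y z \<beta>"
    have hX: "P.hybrid \<alpha> X W" and hX': "P.hybrid (\<Phi> \<alpha>) X' W'" and hY: "Q.hybrid \<beta> Y Z"
      unfolding X_def W_def X'_def W'_def Y_def Z_def by (rule trP trQ \<alpha> \<beta> \<Phi>[OF \<alpha>])+
    have W: "W t \<in> {-1, 1}" "W' t \<in> {-1, 1}" "Z t \<in> {-1, 1}" if "0 \<le> t" for t
      using P.hybridD(1)[OF hX that] P.hybridD(1)[OF hX' that] Q.hybridD(1)[OF hY that] by auto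
    have "(\<forall>t\<in>{0..real n * h}. norm (X' t - X t) \<le> Ct * E) \<and>
      integral {0..real n * h} (\<lambda>t. \<bar>real_of_int (W' t) - real_of_int (W t)\<bar>) \<le> Ct * E \<and>
      inserted A (Ct * E) \<alpha> (2 * n) (P.follow c h n E x w x w \<alpha>)"
      by (rule track[rule_format, of E w x x \<alpha> X W X' W'])
        (use E_pos E(1) wx R \<alpha> hX hX' in \<open>auto simp: \<Phi>_def X_def W_def X'_def W'_def trP \<Phi>[unfolded \<Phi>_def]\<close>)
    then have near: "\<And>t. 0 \<le> t \<Longrightarrow> t \<le> T \<Longrightarrow> norm (X' t - X t) \<le> \<kappa>"
      and near_mode: "integral {0..T} (\<lambda>t. \<bar>real_of_int (W' t) - real_of_int (W t)\<bar>) \<le> \<kappa>"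
      and ins: "inserted A \<kappa> \<alpha> (2 * n) (\<Phi> \<alpha>)"
      by (auto simp: T_def \<kappa>_def \<Phi>_def)
    define \<psi> where "\<psi> t a = exp (- lam * t) * l1 (X t) (Y t) (W t) (Z t) a" for t a
    have exp1: "exp (- lam * t) \<le> 1" if "0 \<le> t" for t using that lam_pos by simp
    have \<psi>_bound: "\<bar>\<psi> t a\<bar> \<le> C" if "0 \<le> t" "a \<in> A" for t a
    proof -
      have "exp (- lam * t) * \<bar>l1 (X t) (Y t) (W t) (Z t) a\<bar> \<le> 1 * C"
        using exp1[OF that(1)] l1_bound[OF W(1,3)[OF that(1)] that(2)] by (intro mult_mono) auto
      then show ?thesis by (simp add: \<psi>_def abs_mult)
    qed
    have l1_diff: "\<bar>l1 x1 y1 w1 z1 a - l1 x2 y2 w2 z2 a\<bar> \<le> K * (norm (x1 - x2) + norm (y1 - y2)) +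
        C * (\<bar>real_of_int w1 - real_of_int w2\<bar> + \<bar>real_of_int z1 - real_of_int z2\<bar>)"
      if "w1 \<in> {-1, 1}" "z1 \<in> {-1, 1}" "w2 \<in> {-1, 1}" "z2 \<in> {-1, 1}" "a \<in> A" for x1 y1 w1 z1 x2 y2 w2 z2 a
      by (rule modes_lipschitz[where F=l1, OF l1_bound l1_lip that(1-4) C_nonneg K_nonneg]) (use that in auto)
    have l2_diff: "\<bar>l2 x1 y1 w1 z1 b - l2 x2 y2 w2 z2 b\<bar> \<le> K * (norm (x1 - x2) + norm (y1 - y2)) +
        C * (\<bar>real_of_int w1 - real_of_int w2\<bar> + \<bar>real_of_int z1 - real_of_int z2\<bar>)"
      if "w1 \<in> {-1, 1}" "z1 \<in> {-1, 1}" "w2 \<in> {-1, 1}" "z2 \<in> {-1, 1}" "b \<in> B" for x1 y1 w1 z1 x2 y2 w2 z2 b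
      by (rule modes_lipschitz[where F=l2, OF l2_bound l2_lip that(1-4) C_nonneg K_nonneg]) (use that in auto)
    \<comment> \<open>First replace the trajectory only, keeping the delayed control in the running cost.\<close>
    define \<mu> where "\<mu> t = \<psi> t (\<Phi> \<alpha> t) + exp (- lam * t) * l2 (X t) (Y t) (W t) (Z t) (\<beta> t)" for t
    have \<psi>_int: "(\<lambda>t. \<psi> t (\<gamma> t)) integrable_on {0..T}" if "\<gamma> \<in> controls A" for \<gamma>
    proof -
      have "(\<lambda>t. \<psi> t (\<gamma> t)) \<in> borel_measurable (lebesgue_on {0..})"
        unfolding \<psi>_def by (intro borel_measurable_times exp_measurable l1_measurable[OF hX \<alpha> hY \<beta> that])
      then have "(\<lambda>t. \<psi> t (\<gamma> t)) absolutely_integrable_on {0..T}"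
        by (rule bounded_integrable) (rule \<psi>_bound, assumption, rule control_in[OF that])
      then show ?thesis by (simp add: absolutely_integrable_on_def)
    qed
    have l2_int: "(\<lambda>t. exp (- lam * t) * l2 (X t) (Y t) (W t) (Z t) (\<beta> t)) integrable_on {0..T}"
    proof -
      have "(\<lambda>t. exp (- lam * t) * l2 (X t) (Y t) (W t) (Z t) (\<beta> t)) absolutely_integrable_on {0..T}"
      proof (rule bounded_integrable[where C="1 * C"])
        show "(\<lambda>t. exp (- lam * t) * l2 (X t) (Y t) (W t) (Z t) (\<beta> t)) \<in> borel_measurable (lebesgue_on {0..})"
          by (intro borel_measurable_times exp_measurable l2_measurable[OF hX \<alpha> hY \<beta> \<beta>])
        show "\<bar>exp (- lam * t) * l2 (X t) (Y t) (W t) (Z t) (\<beta> t)\<bar> \<le> 1 * C" if "0 \<le> t" for t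
          unfolding abs_mult using exp1[OF that] l2_bound[OF W(1,3)[OF that] control_in[OF \<beta> that]]
          by (intro mult_mono) auto
      qed
      then show ?thesis by (simp add: absolutely_integrable_on_def)
    qed
    have \<mu>_int: "\<mu> integrable_on {0..T}" unfolding \<mu>_def by (rule integrable_add[OF \<psi>_int[OF \<Phi>[OF \<alpha>]] l2_int])
    have \<phi>_int: "\<phi> x y w z \<gamma> \<beta> integrable_on {0..T}" if "\<gamma> \<in> controls A" for \<gamma>
      using \<phi>_integrable[OF start that \<beta>] by (simp add: absolutely_integrable_on_def)
    have modes_int: "(\<lambda>t. \<bar>real_of_int (W' t) - real_of_int (W t)\<bar>) integrable_on {0..T}"
      by (rule P.mode_diff_integrable[OF hX \<alpha> hX' \<Phi>[OF \<alpha>] order_refl])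
    let ?e = "\<lambda>t. 2 * K * \<kappa> + 2 * C * \<bar>real_of_int (W' t) - real_of_int (W t)\<bar>"
    have "norm (integral {0..T} (\<lambda>t. \<phi> x y w z (\<Phi> \<alpha>) \<beta> t - \<mu> t)) \<le> integral {0..T} ?e"
    proof (rule Henstock_Kurzweil_Integration.integral_norm_bound_integral)
      show "(\<lambda>t. \<phi> x y w z (\<Phi> \<alpha>) \<beta> t - \<mu> t) integrable_on {0..T}" by (rule integrable_diff[OF \<phi>_int[OF \<Phi>[OF \<alpha>]] \<mu>_int])
      show "?e integrable_on {0..T}" by (intro integrable_add integrable_const_ivl integrable_on_mult_right modes_int)
      fix t assume "t \<in> {0..T}"
      then have t: "0 \<le> t" "t \<le> T" by auto
      note m = W(2)[OF t(1)] W(3)[OF t(1)] W(1)[OF t(1)] W(3)[OF t(1)]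
      have "K * norm (X' t - X t) \<le> K * \<kappa>" using near[OF t] K_nonneg by (rule mult_left_mono)
      then have le: "\<bar>l1 (X' t) (Y t) (W' t) (Z t) (\<Phi> \<alpha> t) - l1 (X t) (Y t) (W t) (Z t) (\<Phi> \<alpha> t)\<bar> +
        \<bar>l2 (X' t) (Y t) (W' t) (Z t) (\<beta> t) - l2 (X t) (Y t) (W t) (Z t) (\<beta> t)\<bar> \<le> ?e t"
        using l1_diff[OF m control_in[OF \<Phi>[OF \<alpha>] t(1)], of "X' t" "Y t" "X t" "Y t"]
          l2_diff[OF m control_in[OF \<beta> t(1)], of "X' t" "Y t" "X t" "Y t"] by simp
      have "\<phi> x y w z (\<Phi> \<alpha>) \<beta> t - \<mu> t = exp (- lam * t) *
        ((l1 (X' t) (Y t) (W' t) (Z t) (\<Phi> \<alpha> t) - l1 (X t) (Y t) (W t) (Z t) (\<Phi> \<alpha> t)) +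
         (l2 (X' t) (Y t) (W' t) (Z t) (\<beta> t) - l2 (X t) (Y t) (W t) (Z t) (\<beta> t)))"
        by (simp add: \<phi>_def \<mu>_def \<psi>_def X'_def W'_def Y_def Z_def algebra_simps)
      then have "norm (\<phi> x y w z (\<Phi> \<alpha>) \<beta> t - \<mu> t) \<le> 1 *
        \<bar>(l1 (X' t) (Y t) (W' t) (Z t) (\<Phi> \<alpha> t) - l1 (X t) (Y t) (W t) (Z t) (\<Phi> \<alpha> t)) +
         (l2 (X' t) (Y t) (W' t) (Z t) (\<beta> t) - l2 (X t) (Y t) (W t) (Z t) (\<beta> t))\<bar>"
        using exp1[OF t(1)] by (simp only: real_norm_def abs_mult abs_exp_cancel) (intro mult_right_mono, auto)
      then show "norm (\<phi> x y w z (\<Phi> \<alpha>) \<beta> t - \<mu> t) \<le> ?e t"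
        unfolding mult_1 by (rule order_trans[OF order_trans[OF _ abs_triangle_ineq] le])
    qed
    also have "integral {0..T} ?e = 2 * K * \<kappa> * T + 2 * C * integral {0..T} (\<lambda>t. \<bar>real_of_int (W' t) - real_of_int (W t)\<bar>)"
      using T_pos modes_int by (subst integral_add) (auto intro!: integrable_on_mult_right)
    also have "\<dots> \<le> 2 * K * \<kappa> * T + 2 * C * \<kappa>"
      using near_mode C_nonneg by (intro add_left_mono mult_left_mono) auto
    finally have 1: "\<bar>integral {0..T} (\<phi> x y w z (\<Phi> \<alpha>) \<beta>) - integral {0..T} \<mu>\<bar> \<le> 2 * K * \<kappa> * T + 2 * C * \<kappa>"
      using integral_diff[OF \<phi>_int[OF \<Phi>[OF \<alpha>]] \<mu>_int] by simp
    have "integral {0..T} \<mu> - integral {0..T} (\<phi> x y w z \<alpha> \<beta>) =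
        integral {0..T} (\<lambda>t. \<psi> t (\<Phi> \<alpha> t)) - integral {0..T} (\<lambda>t. \<psi> t (\<alpha> t))"
    proof -
      have "\<phi> x y w z \<alpha> \<beta> = (\<lambda>t. \<psi> t (\<alpha> t) + exp (- lam * t) * l2 (X t) (Y t) (W t) (Z t) (\<beta> t))"
        by (auto simp: \<phi>_def \<psi>_def X_def W_def Y_def Z_def algebra_simps)
      then show ?thesis
        unfolding \<mu>_def using integral_add[OF \<psi>_int[OF \<alpha>] l2_int] integral_add[OF \<psi>_int[OF \<Phi>[OF \<alpha>]] l2_int] by simp
    qed
    moreover
    define d where "d \<theta> t = S * \<theta> + C * (\<bar>real_of_int (W (t + \<theta>)) - real_of_int (W t)\<bar> +
      \<bar>real_of_int (Z (t + \<theta>)) - real_of_int (Z t)\<bar>)" for \<theta> t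
    have "\<bar>integral {0..T} (\<lambda>t. \<psi> t (\<Phi> \<alpha> t)) - integral {0..T} (\<lambda>t. \<psi> t (\<alpha> t))\<bar> \<le> real (2 * n) * (2 * C * \<kappa> + D0 * \<kappa>)"
    proof (rule insertions_integral[OF ins \<alpha>, where d=d])
      fix \<gamma> \<theta> assume \<gamma>: "\<gamma> \<in> controls A" and \<theta>: "0 \<le> (\<theta> :: real)"
      have "(\<lambda>t. exp (- lam * (t + \<theta>))) \<in> borel_measurable (lebesgue_on {0..})"
        by (intro continuous_imp_measurable_on_sets_lebesgue continuous_intros) auto
      moreover have "(\<lambda>t. l1 (X (\<theta> + t)) (Y (\<theta> + t)) (W (\<theta> + t)) (Z (\<theta> + t)) (\<gamma> t)) \<in> borel_measurable (lebesgue_on {0..})"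
        by (rule l1_measurable[OF P.hybrid_shift[OF hX \<theta>] controls_shift[OF \<alpha> \<theta>]
              Q.hybrid_shift[OF hY \<theta>] controls_shift[OF \<beta> \<theta>] \<gamma>])
      ultimately have "(\<lambda>t. \<psi> (t + \<theta>) (\<gamma> t)) \<in> borel_measurable (lebesgue_on {0..})"
        unfolding \<psi>_def by (simp add: add.commute)
      then have "(\<lambda>t. \<psi> (t + \<theta>) (\<gamma> t)) absolutely_integrable_on {0..T}"
        by (rule bounded_integrable[where C=C]) (use \<theta> in \<open>auto intro!: \<psi>_bound control_in[OF \<gamma>]\<close>)
      then show "(\<lambda>t. \<psi> (t + \<theta>) (\<gamma> t)) integrable_on {0..T}" by (simp add: absolutely_integrable_on_def)
    next
      fix \<theta> assume \<theta>: "0 \<le> \<theta>" "\<theta> \<le> \<kappa>"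
      from V1(3)[OF hX \<alpha> \<theta>(1)] \<theta> \<kappa>
      have i1: "(\<lambda>t. \<bar>real_of_int (W (t + \<theta>)) - real_of_int (W t)\<bar>) integrable_on {0..T}"
        "integral {0..T} (\<lambda>t. \<bar>real_of_int (W (t + \<theta>)) - real_of_int (W t)\<bar>) \<le> V1 * \<theta>" by auto
      from V2(3)[OF hY \<beta> \<theta>(1)] \<theta> \<kappa>
      have i2: "(\<lambda>t. \<bar>real_of_int (Z (t + \<theta>)) - real_of_int (Z t)\<bar>) integrable_on {0..T}"
        "integral {0..T} (\<lambda>t. \<bar>real_of_int (Z (t + \<theta>)) - real_of_int (Z t)\<bar>) \<le> V2 * \<theta>" by auto
      let ?s = "\<lambda>t. \<bar>real_of_int (W (t + \<theta>)) - real_of_int (W t)\<bar> + \<bar>real_of_int (Z (t + \<theta>)) - real_of_int (Z t)\<bar>"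
      have s: "?s integrable_on {0..T}" "integral {0..T} ?s \<le> (V1 + V2) * \<theta>"
        using i1 i2 integral_add[OF i1(1) i2(1)] by (auto intro: integrable_add simp: distrib_right)
      have "integral {0..T} (d \<theta>) = S * \<theta> * T + C * integral {0..T} ?s"
        unfolding d_def using T_pos s(1) by (subst integral_add) (auto intro!: integrable_on_mult_right)
      also have "\<dots> \<le> S * \<theta> * T + C * ((V1 + V2) * \<theta>)"
        using s(2) C_nonneg by (intro add_left_mono mult_left_mono)
      also have "\<dots> = D0 * \<theta>" by (simp add: D0_def algebra_simps)
      also have "\<dots> \<le> D0 * \<kappa>"
        using \<theta>(2) S T_pos C_nonneg V1(1) V2(1) by (intro mult_left_mono) (simp_all add: D0_def)
      finally show "d \<theta> integrable_on {0..T} \<and> integral {0..T} (d \<theta>) \<le> D0 * \<kappa>"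
        unfolding d_def by (auto intro!: integrable_add integrable_on_mult_right integrable_const_ivl s(1))
    next
      fix \<theta> t a assume \<theta>: "0 \<le> \<theta>" "\<theta> \<le> \<kappa>" and "t \<in> {0..T}" and a: "a \<in> A"
      then have t: "0 \<le> t" "0 \<le> t + \<theta>" by auto
      let ?l = "\<lambda>t. l1 (X t) (Y t) (W t) (Z t) a"
      have "norm (X (t + \<theta>) - X t) \<le> M * \<theta>" "norm (Y (t + \<theta>) - Y t) \<le> M' * \<theta>"
        using P.hybrid_speed[OF hX \<alpha> t] Q.hybrid_speed[OF hY \<beta> t] \<theta> by auto
      then have "K * (norm (X (t + \<theta>) - X t) + norm (Y (t + \<theta>) - Y t)) \<le> K * (M * \<theta> + M' * \<theta>)"
        using K_nonneg by (intro mult_left_mono) auto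
      then have l: "\<bar>?l (t + \<theta>) - ?l t\<bar> \<le> K * (M * \<theta> + M' * \<theta>) + C * (\<bar>real_of_int (W (t + \<theta>)) - real_of_int (W t)\<bar> +
        \<bar>real_of_int (Z (t + \<theta>)) - real_of_int (Z t)\<bar>)" (is "_ \<le> ?r")
        using l1_diff[OF W(1,3)[OF t(2)] W(1,3)[OF t(1)] a, of "X (t + \<theta>)" "Y (t + \<theta>)" "X t" "Y t"] by linarith
      have ex: "\<bar>exp (- lam * (t + \<theta>)) - exp (- lam * t)\<bar> \<le> lam * \<theta>"
      proof -
        have e: "exp (- lam * (t + \<theta>)) = exp (- lam * t) * exp (- lam * \<theta>)" by (simp add: algebra_simps flip: exp_add)
        have le: "exp (- lam * \<theta>) \<le> 1" using \<theta> lam_pos by simp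
        have "\<bar>exp (- lam * (t + \<theta>)) - exp (- lam * t)\<bar> = exp (- lam * t) * (1 - exp (- lam * \<theta>))"
        proof -
          have "exp (- lam * (t + \<theta>)) - exp (- lam * t) = - (exp (- lam * t) * (1 - exp (- lam * \<theta>)))"
            unfolding e by (simp add: algebra_simps)
          then show ?thesis using le by (simp add: abs_mult)
        qed
        also have "\<dots> \<le> 1 * (1 - exp (- lam * \<theta>))" using exp1[OF t(1)] le by (intro mult_right_mono) auto
        also have "\<dots> \<le> lam * \<theta>" using exp_ge_add_one_self[of "- lam * \<theta>"] by simp
        finally show ?thesis .
      qed
      have "\<psi> (t + \<theta>) a - \<psi> t a = exp (- lam * (t + \<theta>)) * (?l (t + \<theta>) - ?l t) +
          (exp (- lam * (t + \<theta>)) - exp (- lam * t)) * ?l t"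
        by (simp add: \<psi>_def algebra_simps)
      then have "\<bar>\<psi> (t + \<theta>) a - \<psi> t a\<bar> \<le> exp (- lam * (t + \<theta>)) * \<bar>?l (t + \<theta>) - ?l t\<bar> +
          \<bar>exp (- lam * (t + \<theta>)) - exp (- lam * t)\<bar> * \<bar>?l t\<bar>"
        by (metis abs_exp_cancel abs_mult abs_triangle_ineq)
      also have "\<dots> \<le> 1 * ?r + (lam * \<theta>) * C"
        using l ex exp1[OF t(2)] l1_bound[OF W(1,3)[OF t(1)] a] \<theta> lam_pos
        by (intro add_mono mult_mono) auto
      also have "\<dots> = d \<theta> t" by (simp add: d_def S_def algebra_simps)
      finally show "\<bar>\<psi> (t + \<theta>) a - \<psi> t a\<bar> \<le> d \<theta> t" .
    qed (use \<psi>_bound T_pos C_nonneg P.A_nonempty in auto)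
    ultimately have "\<bar>integral {0..T} (\<phi> x y w z (\<Phi> \<alpha>) \<beta>) - integral {0..T} (\<phi> x y w z \<alpha> \<beta>)\<bar>
      \<le> 2 * K * \<kappa> * T + 2 * C * \<kappa> + real (2 * n) * (2 * C * \<kappa> + D0 * \<kappa>)"
      using 1 by linarith
    also have "\<dots> = G * E" by (simp add: G_def \<kappa>_def algebra_simps)
    finally have 2: "\<bar>integral {0..T} (\<phi> x y w z (\<Phi> \<alpha>) \<beta>) - integral {0..T} (\<phi> x y w z \<alpha> \<beta>)\<bar> \<le> \<epsilon> / 2"
      using GE by linarith
    have tail: "2 * C * exp (- lam * T) / lam \<le> \<epsilon> / 4" using T0(2)[OF T(1)] by simp
    have "\<bar>J x y w z \<gamma> \<beta> - integral {0..T} (\<phi> x y w z \<gamma> \<beta>)\<bar> \<le> \<epsilon> / 4" if "\<gamma> \<in> controls A" for \<gamma>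
      using cost_tail[OF start that \<beta>, of T] T_pos tail by linarith
    from this[OF \<alpha>] this[OF \<Phi>[OF \<alpha>]] 2 show ?thesis by linarith
  qed
  show ?thesis using \<delta> delaying close by blast
qed

end

text \<open>
  Exchanging the players keeps the sign of the cost, so the exchanged game serves only to transfer
  \<open>delay_map\<close>, which is indifferent to who minimizes.
\<close>

lemma game_swap:
  "game g e' \<eta> B L' M' f e \<rho> A L M (\<lambda>y x z w b a. l x y w z a b) (\<lambda>y x z w. l2 x y w z)
     (\<lambda>y x z w. l1 x y w z) lam C K"
proof unfold_locales
  show "\<bar>l2 x y w z b - l2 x' y' w z b\<bar> \<le> K * (norm (y - y') + norm (x - x'))"
    if "z \<in> {-1, 1}" "w \<in> {-1, 1}" "b \<in> B" for x y x' y' w z b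
    using l2_lip[OF that(2,1,3)] by (simp add: add.commute)
  show "\<bar>l1 x y w z a - l1 x' y' w z a\<bar> \<le> K * (norm (y - y') + norm (x - x'))"
    if "z \<in> {-1, 1}" "w \<in> {-1, 1}" "a \<in> A" for x y x' y' w z a
    using l1_lip[OF that(2,1,3)] by (simp add: add.commute)
  show "l x y w z a b = l2 x y w z b + l1 x y w z a"
    if "z \<in> {-1, 1}" "w \<in> {-1, 1}" "b \<in> B" "a \<in> A" for x y w z a b
    using l_split[OF that(2,1,4,3)] by simp
qed (use l1_cont l2_cont l1_bound l2_bound lam_pos C_nonneg K_nonneg in auto)

lemma cost_swap:
  "cost f g l lam e \<rho> e' \<eta> x y w z \<alpha> \<beta> =
   cost g f (\<lambda>y x z w b a. l x y w z a b) lam e' \<eta> e \<rho> y x z w \<beta> \<alpha>"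
  unfolding cost_def case_prod_beta Let_def by simp

theorem game_has_value:
  assumes start: "admissible_start x y w z"
  shows "lower_value f g l lam e \<rho> e' \<eta> A B x y w z = upper_value f g l lam e \<rho> e' \<eta> A B x y w z"
  unfolding lower_value_def upper_value_def
proof (rule game_value[OF P.A_nonempty Q.A_nonempty cost_bounded[OF start] cost_truncation[OF start] delay_map[OF start]])
  interpret S: game g e' \<eta> B L' M' f e \<rho> A L M "\<lambda>y x z w b a. l x y w z a b" "\<lambda>y x z w. l2 x y w z"
     "\<lambda>y x z w. l1 x y w z" lam C K
    by (rule game_swap)
  fix \<epsilon> :: real assume "0 < \<epsilon>"
  moreover have "S.admissible_start y x z w" using start by (simp add: admissible_start_def S.admissible_start_def)
  ultimately show "\<exists>\<delta>>0. \<exists>\<Phi>. delaying B \<delta> \<Phi> \<and>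
      (\<forall>\<alpha>\<in>controls A. \<forall>\<beta>\<in>controls B. \<bar>J x y w z \<alpha> (\<Phi> \<beta>) - J x y w z \<alpha> \<beta>\<bar> \<le> \<epsilon>)"
    using S.delay_map[of y x z w \<epsilon>] unfolding cost_swap by blast
qed

end

section \<open>Existence of the value\<close>

lemma regular_bounds:
  fixes F :: "'s::metric_space \<Rightarrow> 'u::topological_space \<Rightarrow> 'v::real_normed_vector"
  assumes "regular U F"
  obtains M L where "0 < M" "0 < L" "\<And>s. continuous_on U (F s)" "\<And>s u. u \<in> U \<Longrightarrow> norm (F s u) \<le> M"
    "\<And>s s' u. u \<in> U \<Longrightarrow> norm (F s u - F s' u) \<le> L * dist s s'"
proof -
  have c: "continuous_on (UNIV \<times> U) (\<lambda>(s, u). F s u)" and b: "bounded ((\<lambda>(s, u). F s u) ` (UNIV \<times> U))"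
    using assms by (auto simp: regular_def)
  obtain L where L: "\<And>u. u \<in> U \<Longrightarrow> L-lipschitz_on UNIV (\<lambda>s. F s u)" using assms by (auto simp: regular_def)
  obtain M where M: "\<And>z. z \<in> (\<lambda>(s, u). F s u) ` (UNIV \<times> U) \<Longrightarrow> norm z \<le> M" using b unfolding bounded_iff by blast
  show thesis
  proof (rule that[of "max M 1" "max L 1"])
    show "continuous_on U (F s)" for s
    proof -
      have "continuous_on U (\<lambda>u. case (s, u) of (s, u) \<Rightarrow> F s u)"
        by (rule continuous_on_compose2[OF c]) (auto intro!: continuous_on_Pair continuous_on_const continuous_on_id)
      then show ?thesis by simp
    qed
    show "norm (F s u) \<le> max M 1" if "u \<in> U" for s u
    proof -
      have "F s u \<in> (\<lambda>(s, u). F s u) ` (UNIV \<times> U)" using that by (auto intro: image_eqI[of _ _ "(s, u)"])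
      from M[OF this] show ?thesis by simp
    qed
    show "norm (F s u - F s' u) \<le> max L 1 * dist s s'" if "u \<in> U" for s s' u
    proof -
      have "norm (F s u - F s' u) \<le> L * dist s s'"
        using lipschitz_onD[OF L[OF that], of s s'] by (simp add: dist_norm)
      also have "\<dots> \<le> max L 1 * dist s s'" by (intro mult_right_mono) auto
      finally show ?thesis .
    qed
  qed auto
qed

lemma regular_player:
  fixes f :: "'x::euclidean_space \<Rightarrow> int \<Rightarrow> 'a::metric_space \<Rightarrow> 'x"
  assumes "e \<in> Basis" "\<rho> (-1) < \<rho> 1" "regular ({-1, 1} \<times> A) (\<lambda>x (w, a). f x w a)" "controllable e \<rho> A f"
  obtains L M where "player f e \<rho> A L M"
proof -
  obtain M L where "0 < M" "0 < L" and c: "\<And>x. continuous_on ({-1, 1} \<times> A) (\<lambda>(w, a). f x w a)"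
    and b: "\<And>x u. u \<in> {-1, 1} \<times> A \<Longrightarrow> norm (case u of (w, a) \<Rightarrow> f x w a) \<le> M"
    and l: "\<And>x y u. u \<in> {-1, 1} \<times> A \<Longrightarrow>
      norm ((case u of (w, a) \<Rightarrow> f x w a) - (case u of (w, a) \<Rightarrow> f y w a)) \<le> L * dist x y"
    using regular_bounds[OF assms(3)] by blast
  have "player f e \<rho> A L M"
  proof
    fix w :: int and x y assume w: "w \<in> {-1, 1}"
    have "continuous_on A (\<lambda>a. case (w, a) of (w, a) \<Rightarrow> f x w a)"
      by (rule continuous_on_compose2[OF c]) (use w in \<open>auto intro!: continuous_on_Pair continuous_on_const continuous_on_id\<close>)
    then show "continuous_on A (\<lambda>a. f x w a)" by simp
    fix a assume a: "a \<in> A"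
    show "norm (f x w a) \<le> M" using b[of "(w, a)" x] w a by simp
    show "norm (f x w a - f y w a) \<le> L * norm (x - y)" using l[of "(w, a)" x y] w a by (simp add: dist_norm)
  qed (use assms \<open>0 < M\<close> \<open>0 < L\<close> in auto)
  then show thesis by (rule that)
qed

lemma regular_running_cost:
  fixes l :: "'x::euclidean_space \<Rightarrow> 'y::euclidean_space \<Rightarrow> int \<Rightarrow> int \<Rightarrow> 'a::metric_space \<Rightarrow> real"
  assumes "regular ({-1, 1} \<times> {-1, 1} \<times> A) (\<lambda>(x, y) (w, z, a). l x y w z a)"
  obtains C K where "0 < C" "0 < K"
    "\<And>x y w z. w \<in> {-1, 1} \<Longrightarrow> z \<in> {-1, 1} \<Longrightarrow> continuous_on A (l x y w z)"
    "\<And>x y w z a. w \<in> {-1, 1} \<Longrightarrow> z \<in> {-1, 1} \<Longrightarrow> a \<in> A \<Longrightarrow> \<bar>l x y w z a\<bar> \<le> C"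
    "\<And>x y x' y' w z a. w \<in> {-1, 1} \<Longrightarrow> z \<in> {-1, 1} \<Longrightarrow> a \<in> A \<Longrightarrow>
      \<bar>l x y w z a - l x' y' w z a\<bar> \<le> K * (norm (x - x') + norm (y - y'))"
proof -
  let ?F = "\<lambda>(x, y) (w, z, a). l x y w z a"
  obtain C K where CK: "0 < C" "0 < K" and c: "\<And>s. continuous_on ({-1, 1} \<times> {-1, 1} \<times> A) (?F s)"
    and b: "\<And>s u. u \<in> {-1, 1} \<times> {-1, 1} \<times> A \<Longrightarrow> norm (?F s u) \<le> C"
    and l: "\<And>s s' u. u \<in> {-1, 1} \<times> {-1, 1} \<times> A \<Longrightarrow> norm (?F s u - ?F s' u) \<le> K * dist s s'"
    using regular_bounds[OF assms] by blast
  show thesis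
  proof (rule that[OF CK])
    fix x x' :: 'x and y y' :: 'y and w z :: int assume wz: "w \<in> {-1, 1}" "z \<in> {-1, 1}"
    have "continuous_on A (\<lambda>a. ?F (x, y) (w, z, a))"
      by (rule continuous_on_compose2[OF c]) (use wz in \<open>auto intro!: continuous_on_Pair continuous_on_const continuous_on_id\<close>)
    then show "continuous_on A (l x y w z)" by simp
    fix a assume a: "a \<in> A"
    have u: "(w, z, a) \<in> {-1, 1} \<times> {-1, 1} \<times> A" using wz a by blast
    show "\<bar>l x y w z a\<bar> \<le> C" using b[OF u, of "(x, y)"] by simp
    have "\<bar>l x y w z a - l x' y' w z a\<bar> \<le> K * dist (x, y) (x', y')" using l[OF u, of "(x, y)" "(x', y')"] by simp
    also have "\<dots> \<le> K * (norm (x - x') + norm (y - y'))"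
      using CK norm_Pair_le[of "x - x'" "y - y'"] by (intro mult_left_mono) (auto simp: dist_norm)
    finally show "\<bar>l x y w z a - l x' y' w z a\<bar> \<le> K * (norm (x - x') + norm (y - y'))" .
  qed
qed

theorem mainTheorem4:
  fixes f :: "'x::euclidean_space \<Rightarrow> int \<Rightarrow> 'a::metric_space \<Rightarrow> 'x"
    and g :: "'y::euclidean_space \<Rightarrow> int \<Rightarrow> 'b::metric_space \<Rightarrow> 'y"
    and l :: "'x \<Rightarrow> 'y \<Rightarrow> int \<Rightarrow> int \<Rightarrow> 'a \<Rightarrow> 'b \<Rightarrow> real"
    and l1 :: "'x \<Rightarrow> 'y \<Rightarrow> int \<Rightarrow> int \<Rightarrow> 'a \<Rightarrow> real"
    and l2 :: "'x \<Rightarrow> 'y \<Rightarrow> int \<Rightarrow> int \<Rightarrow> 'b \<Rightarrow> real"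
    and lam :: real
    and e :: 'x and e' :: 'y
    and \<rho> \<eta> :: "int \<Rightarrow> real"
    and A :: "'a set" and B :: "'b set"
  assumes "e \<in> Basis" and "e' \<in> Basis"
    and "\<rho> (-1) < \<rho> 1" and "\<eta> (-1) < \<eta> 1"
    and "compact A" and "compact B"
    and "regular ({-1, 1} \<times> A) (\<lambda>x (w, a). f x w a)"
    and "regular ({-1, 1} \<times> B) (\<lambda>y (z, b). g y z b)"
    and "regular ({-1, 1} \<times> {-1, 1} \<times> A) (\<lambda>(x, y) (w, z, a). l1 x y w z a)"
    and "regular ({-1, 1} \<times> {-1, 1} \<times> B) (\<lambda>(x, y) (w, z, b). l2 x y w z b)"
    and "\<And>x y w z a b. w \<in> {-1, 1} \<Longrightarrow> z \<in> {-1, 1} \<Longrightarrow> a \<in> A \<Longrightarrow> b \<in> B \<Longrightarrow>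
           l x y w z a b = l1 x y w z a + l2 x y w z b \<and> 0 \<le> l x y w z a b"
    and "lam > 0"
    and "controllable e \<rho> A f" and "controllable e' \<eta> B g"
    and "\<And>w z x y p q. w \<in> {-1, 1} \<Longrightarrow> z \<in> {-1, 1} \<Longrightarrow>
           LH f g l A B w z x y p q = UH f g l A B w z x y p q"
  shows "\<forall>w\<in>{-1, 1}. \<forall>z\<in>{-1, 1}.
           \<forall>(x, y) \<in> closure (sector e \<rho> w) \<times> closure (sector e' \<eta> z).
             lower_value f g l lam e \<rho> e' \<eta> A B x y w z =
             upper_value f g l lam e \<rho> e' \<eta> A B x y w z"
proof -
  obtain L M where P: "player f e \<rho> A L M" using regular_player assms(1,3,7,13) by blast
  obtain L' M' where Q: "player g e' \<eta> B L' M'" using regular_player assms(2,4,8,14) by blast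
  obtain C1 K1 where l1: "0 < C1" "0 < K1"
    "\<And>x y w z. w \<in> {-1, 1} \<Longrightarrow> z \<in> {-1, 1} \<Longrightarrow> continuous_on A (l1 x y w z)"
    "\<And>x y w z a. w \<in> {-1, 1} \<Longrightarrow> z \<in> {-1, 1} \<Longrightarrow> a \<in> A \<Longrightarrow> \<bar>l1 x y w z a\<bar> \<le> C1"
    "\<And>x y x' y' w z a. w \<in> {-1, 1} \<Longrightarrow> z \<in> {-1, 1} \<Longrightarrow> a \<in> A \<Longrightarrow>
      \<bar>l1 x y w z a - l1 x' y' w z a\<bar> \<le> K1 * (norm (x - x') + norm (y - y'))"
    using regular_running_cost[OF assms(9)] by blast
  obtain C2 K2 where l2: "0 < C2" "0 < K2"
    "\<And>x y w z. w \<in> {-1, 1} \<Longrightarrow> z \<in> {-1, 1} \<Longrightarrow> continuous_on B (l2 x y w z)"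
    "\<And>x y w z b. w \<in> {-1, 1} \<Longrightarrow> z \<in> {-1, 1} \<Longrightarrow> b \<in> B \<Longrightarrow> \<bar>l2 x y w z b\<bar> \<le> C2"
    "\<And>x y x' y' w z b. w \<in> {-1, 1} \<Longrightarrow> z \<in> {-1, 1} \<Longrightarrow> b \<in> B \<Longrightarrow>
      \<bar>l2 x y w z b - l2 x' y' w z b\<bar> \<le> K2 * (norm (x - x') + norm (y - y'))"
    using regular_running_cost[OF assms(10)] by blast
  have "game f e \<rho> A L M g e' \<eta> B L' M' l l1 l2 lam (max C1 C2) (max K1 K2)"
  proof (intro game.intro P Q game_axioms.intro)
    fix x x' :: 'x and y y' :: 'y and w z :: int assume wz: "w \<in> {-1, 1}" "z \<in> {-1, 1}"
    have K: "K1 * (norm (x - x') + norm (y - y')) \<le> max K1 K2 * (norm (x - x') + norm (y - y'))"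
      "K2 * (norm (x - x') + norm (y - y')) \<le> max K1 K2 * (norm (x - x') + norm (y - y'))"
      by (intro mult_right_mono; simp)+
    show "\<bar>l1 x y w z a\<bar> \<le> max C1 C2" "\<bar>l1 x y w z a - l1 x' y' w z a\<bar> \<le> max K1 K2 * (norm (x - x') + norm (y - y'))"
      if "a \<in> A" for a
      using l1(4)[OF wz that, of x y] order_trans[OF l1(5)[OF wz that] K(1)] by auto
    show "\<bar>l2 x y w z b\<bar> \<le> max C1 C2" "\<bar>l2 x y w z b - l2 x' y' w z b\<bar> \<le> max K1 K2 * (norm (x - x') + norm (y - y'))"
      if "b \<in> B" for b
      using l2(4)[OF wz that, of x y] order_trans[OF l2(5)[OF wz that] K(2)] by auto
    show "l x y w z a b = l1 x y w z a + l2 x y w z b" if "a \<in> A" "b \<in> B" for a b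
      using assms(11)[OF wz that] by blast
    show "continuous_on A (l1 x y w z)" "continuous_on B (l2 x y w z)"
      using l1(3)[OF wz] l2(3)[OF wz] by auto
  qed (use assms(12) l1(1,2) in auto)
  then interpret game f e \<rho> A L M g e' \<eta> B L' M' l l1 l2 lam "max C1 C2" "max K1 K2" .
  show ?thesis
  proof (intro ballI, clarify)
    fix w z :: int and x y
    assume "w \<in> {-1, 1}" "z \<in> {-1, 1}" "x \<in> closure (sector e \<rho> w)" "y \<in> closure (sector e' \<eta> z)"
    then have "admissible_start x y w z"
      using P.closure_sector Q.closure_sector by (auto simp: admissible_start_def)
    then show "lower_value f g l lam e \<rho> e' \<eta> A B x y w z = upper_value f g l lam e \<rho> e' \<eta> A B x y w z"
      by (rule game_has_value)
  qed
qed

end
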